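(* Let $F_I^\circ$ be a (nonempty) open face of dimension $m$ that is accessible for the product interaction $g_\Pi$. Then $$\dim_H\bigl(F_I^\circ,d_{\partial,\Pi}\bigr)=\frac{m}{1-\frac{A_I}{2}} .$$
   Context: Let $X$ be a compact smooth $n$-dimensional manifold with corners (locally modelled on $[0,\infty)^k\times\mathbb R^{n-k}$, $0\le k\le n$) whose boundary hypersurfaces $H_1,\dots,H_N$ are globally embedded, and let $X^\circ=X\setminus\partial X$. For each $i$ let $\rho_i:X\to[0,\infty)$ be a smooth boundary-defining function of $H_i$: $H_i=\rho_i^{-1}(0)$, $d\rho_i\neq0$ on $H_i$, and $\rho_i>0$ on $X\setminus H_i$. Let $g_0$ be a smooth Riemannian metric on $X$ (up to the boundary), and let $\alpha_1,\dots,\alpha_N\ge 0$. On $X^\circ$ put $g_\Pi=\bigl(\prod_{i=1}^N\rho_i^{-\alpha_i}\bigr)g_0$, with Riemannian distance $d_{g_\Pi}$. For $p\in X$, $I(p)=\{i: p\in H_i\}$; for nonempty $I\subseteq\{1,\dots,N\}$, the open face is $F_I^\circ=\{p\in X: I(p)=I\}$, a smooth manifold without boundary of codimension $|I|$ when nonempty, and $A_I=\sum_{i\in I}\alpha_i$. A point $p\in\partial X$ is accessible for $g_\Pi$ if there is a $d_{g_\Pi}$-Cauchy sequence in $X^\circ$ converging to $p$ in the topology of $X$; an open face is accessible if all its points are; for a nonempty open face this is equivalent to $A_I<2$. For $z$ in an accessible open face, all sequences in $X^\circ$ converging to $z$ in the topology of $X$ are $d_{g_\Pi}$-Cauchy and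 equivalent; $\overline z$ denotes the resulting point of the metric completion of $(X^\circ,d_{g_\Pi})$. The induced boundary distance $d_{\partial,\Pi}(z,z')$ is the distance in that completion between $\overline z$ and $\overline{z'}$. $\dim_H$ denotes Hausdorff dimension. *)

theory Defs
  imports "HOL-Analysis.Analysis"
begin

section \<open>Smooth maps on subsets of Euclidean space\<close>

primrec Ck_on :: "nat \<Rightarrow> 'a::real_normed_vector set \<Rightarrow> ('a \<Rightarrow> 'b::real_normed_vector) \<Rightarrow> bool" where
  "Ck_on 0 U f \<longleftrightarrow> continuous_on U f"
| "Ck_on (Suc k) U f \<longleftrightarrow>
     f differentiable_on U \<and> (\<forall>v. Ck_on k U (\<lambda>x. frechet_derivative f (at x) v))"

text \<open>\<^const>\<open>Ck_on\<close> is only meant for open sets. On an arbitrary set (here: relatively open subsets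
  of \<open>[0,\<infinity>)\<^sup>k \<times> \<real>\<^bsup>n-k\<^esup>\<close>) smoothness means local smooth extendability.\<close>

definition smooth_map_on ::
    "'a::euclidean_space set \<Rightarrow> ('a \<Rightarrow> 'b::euclidean_space) \<Rightarrow> bool" where
  "smooth_map_on S f \<longleftrightarrow>
     (\<forall>x\<in>S. \<exists>U g. open U \<and> x \<in> U \<and> (\<forall>k. Ck_on k U g) \<and> (\<forall>y\<in>U \<inter> S. g y = f y))"


section \<open>Manifolds with corners\<close>

text \<open>The coordinates with index in \<open>corner\<close> are the ones constrained to be nonnegative, so the
  model space is \<open>[0,\<infinity>)\<^sup>k \<times> \<real>\<^bsup>n-k\<^esup>\<close> with \<open>k = card corner\<close> and \<open>n = CARD('n)\<close>.\<close>

record ('a, 'n::finite) corner_chart =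
  chart_dom :: "'a set"
  corner :: "'n set"
  coord :: "'a \<Rightarrow> real ^ 'n"

definition corner_model :: "'n::finite set \<Rightarrow> (real ^ 'n) set" where
  "corner_model K = {x. \<forall>j\<in>K. 0 \<le> x $ j}"

definition chart_inv :: "('a, 'n::finite) corner_chart \<Rightarrow> real ^ 'n \<Rightarrow> 'a" where
  "chart_inv c = the_inv_into (chart_dom c) (coord c)"

definition is_chart :: "'a topology \<Rightarrow> ('a, 'n::finite) corner_chart \<Rightarrow> bool" where
  "is_chart X c \<longleftrightarrow>
     openin X (chart_dom c) \<and>
     openin (top_of_set (corner_model (corner c))) (coord c ` chart_dom c) \<and>
     homeomorphic_map (subtopology X (chart_dom c))
       (top_of_set (coord c ` chart_dom c)) (coord c)"

definition transition ::
    "('a, 'n::finite) corner_chart \<Rightarrow> ('a, 'n) corner_chart \<Rightarrow> real ^ 'n \<Rightarrow> real ^ 'n" where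
  "transition c c' = coord c' \<circ> chart_inv c"

definition smoothly_compatible ::
    "('a, 'n::finite) corner_chart \<Rightarrow> ('a, 'n) corner_chart \<Rightarrow> bool" where
  "smoothly_compatible c c' \<longleftrightarrow>
     smooth_map_on (coord c ` (chart_dom c \<inter> chart_dom c')) (transition c c') \<and>
     smooth_map_on (coord c' ` (chart_dom c \<inter> chart_dom c')) (transition c' c)"

definition smooth_atlas :: "'a topology \<Rightarrow> ('a, 'n::finite) corner_chart set \<Rightarrow> bool" where
  "smooth_atlas X A \<longleftrightarrow>
     (\<forall>c\<in>A. is_chart X c) \<and> (\<Union>c\<in>A. chart_dom c) = topspace X \<and>
     (\<forall>c\<in>A. \<forall>c'\<in>A. smoothly_compatible c c')"

definition manifold_with_corners ::
    "'a topology \<Rightarrow> ('a, 'n::finite) corner_chart set \<Rightarrow> bool" where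
  "manifold_with_corners X A \<longleftrightarrow>
     Hausdorff_space X \<and> second_countable X \<and> smooth_atlas X A"

definition maximal_atlas ::
    "'a topology \<Rightarrow> ('a, 'n::finite) corner_chart set \<Rightarrow> ('a, 'n) corner_chart set" where
  "maximal_atlas X A = {c. is_chart X c \<and> (\<forall>c'\<in>A. smoothly_compatible c c')}"

text \<open>The points with exactly \<open>k\<close> vanishing corner coordinates. By invariance of the corner
  depth under diffeomorphisms, the choice of the chart is immaterial.\<close>

definition depth_stratum :: "('a, 'n::finite) corner_chart set \<Rightarrow> nat \<Rightarrow> 'a set" where
  "depth_stratum A k =
     {p. \<exists>c\<in>A. p \<in> chart_dom c \<and> card {j \<in> corner c. coord c p $ j = 0} = k}"

definition mfd_interior :: "('a, 'n::finite) corner_chart set \<Rightarrow> 'a set" where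
  "mfd_interior A = depth_stratum A 0"

definition boundary_hypersurfaces ::
    "'a topology \<Rightarrow> ('a, 'n::finite) corner_chart set \<Rightarrow> 'a set set" where
  "boundary_hypersurfaces X A =
     (\<lambda>C. X closure_of C) ` connected_components_of (subtopology X (depth_stratum A 1))"

text \<open>Embedded \<open>m\<close>-dimensional submanifold of a manifold with corners: near each of its points it
  is the common zero set of \<open>n - m\<close> of the coordinates of some smooth chart.\<close>

definition embedded_submanifold ::
    "'a topology \<Rightarrow> ('a, 'n::finite) corner_chart set \<Rightarrow> nat \<Rightarrow> 'a set \<Rightarrow> bool" where
  "embedded_submanifold X A m S \<longleftrightarrow>
     S \<subseteq> topspace X \<and>
     (\<forall>p\<in>S. \<exists>c\<in>maximal_atlas X A. p \<in> chart_dom c \<and>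
        (\<exists>J. card J + m = CARD('n) \<and>
             S \<inter> chart_dom c = {q \<in> chart_dom c. \<forall>j\<in>J. coord c q $ j = 0}))"

definition smooth_function :: "('a, 'n::finite) corner_chart set \<Rightarrow> ('a \<Rightarrow> real) \<Rightarrow> bool" where
  "smooth_function A f \<longleftrightarrow> (\<forall>c\<in>A. smooth_map_on (coord c ` chart_dom c) (f \<circ> chart_inv c))"

text \<open>Derivatives within a relatively open subset of the model space are unique, also at its
  boundary points, so \<^const>\<open>frechet_derivative\<close> is meaningful below.\<close>

definition boundary_defining ::
    "'a topology \<Rightarrow> ('a, 'n::finite) corner_chart set \<Rightarrow> 'a set \<Rightarrow> ('a \<Rightarrow> real) \<Rightarrow> bool" where
  "boundary_defining X A H \<rho> \<longleftrightarrow>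
     smooth_function A \<rho> \<and>
     H = {p \<in> topspace X. \<rho> p = 0} \<and>
     (\<forall>p\<in>topspace X - H. \<rho> p > 0) \<and>
     (\<forall>p\<in>H. \<forall>c\<in>A. p \<in> chart_dom c \<longrightarrow>
        frechet_derivative (\<rho> \<circ> chart_inv c) (at (coord c p) within coord c ` chart_dom c)
          \<noteq> (\<lambda>_. 0))"

definition incident :: "nat \<Rightarrow> (nat \<Rightarrow> 'a set) \<Rightarrow> 'a \<Rightarrow> nat set" where
  "incident N H p = {i \<in> {1..N}. p \<in> H i}"

definition open_face :: "'a topology \<Rightarrow> nat \<Rightarrow> (nat \<Rightarrow> 'a set) \<Rightarrow> nat set \<Rightarrow> 'a set" where
  "open_face X N H I = {p \<in> topspace X. incident N H p = I}"


section \<open>Riemannian metrics and distance\<close>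

text \<open>A 2-tensor field is a family of local expressions: \<open>g c p v w\<close> is the value at \<open>p\<close> on the
  tangent vectors whose components in the chart \<open>c\<close> are \<open>v\<close> and \<open>w\<close>.\<close>

type_synonym ('a, 'n) tensor2 =
  "('a, 'n) corner_chart \<Rightarrow> 'a \<Rightarrow> real ^ 'n \<Rightarrow> real ^ 'n \<Rightarrow> real"

definition riemannian_metric ::
    "('a, 'n::finite) corner_chart set \<Rightarrow> ('a, 'n) tensor2 \<Rightarrow> bool" where
  "riemannian_metric A g \<longleftrightarrow>
     (\<forall>c\<in>A. \<forall>p\<in>chart_dom c. bilinear (g c p) \<and>
        (\<forall>v w. g c p v w = g c p w v) \<and> (\<forall>v. v \<noteq> 0 \<longrightarrow> 0 < g c p v v)) \<and>
     (\<forall>c\<in>A. \<forall>v w. smooth_map_on (coord c ` chart_dom c) (\<lambda>x. g c (chart_inv c x) v w)) \<and>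
     (\<forall>c\<in>A. \<forall>c'\<in>A. \<forall>p\<in>chart_dom c \<inter> chart_dom c'.
        let D = frechet_derivative (transition c c')
                  (at (coord c p) within coord c ` (chart_dom c \<inter> chart_dom c'))
        in \<forall>v w. g c p v w = g c' p (D v) (D w))"

text \<open>Only evaluated at interior points, where all \<open>\<rho> i p\<close> are positive.\<close>

definition product_metric ::
    "nat \<Rightarrow> (nat \<Rightarrow> 'a \<Rightarrow> real) \<Rightarrow> (nat \<Rightarrow> real) \<Rightarrow> ('a, 'n::finite) tensor2 \<Rightarrow> ('a, 'n) tensor2" where
  "product_metric N \<rho> \<alpha> g = (\<lambda>c p v w. (\<Prod>i=1..N. \<rho> i p powr - \<alpha> i) * g c p v w)"

text \<open>Continuous curves on \<open>[0,1]\<close> with a finite subdivision into pieces that lie in a single chart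
  and are \<open>C\<^sup>1\<close> up to their end points.\<close>

definition piecewise_C1_curve ::
    "'a topology \<Rightarrow> ('a, 'n::finite) corner_chart set \<Rightarrow> 'a set \<Rightarrow> (real \<Rightarrow> 'a) \<Rightarrow> bool" where
  "piecewise_C1_curve X A Y \<gamma> \<longleftrightarrow>
     pathin (subtopology X Y) \<gamma> \<and>
     (\<exists>(k::nat) s. s 0 = 0 \<and> s k = 1 \<and>
        (\<forall>i<k. s i < s (Suc i) \<and>
           (\<exists>c\<in>A. \<gamma> ` {s i..s (Suc i)} \<subseteq> chart_dom c \<and>
              (\<exists>D. continuous_on {s i..s (Suc i)} D \<and>
                 (\<forall>t\<in>{s i..s (Suc i)}.
                    ((coord c \<circ> \<gamma>) has_vector_derivative D t) (at t within {s i..s (Suc i)}))))))"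

text \<open>Well defined off the finitely many break points; independent of the chosen chart by the
  transformation law of \<open>g\<close>.\<close>

definition speed ::
    "('a, 'n::finite) corner_chart set \<Rightarrow> ('a, 'n) tensor2 \<Rightarrow> (real \<Rightarrow> 'a) \<Rightarrow> real \<Rightarrow> real" where
  "speed A g \<gamma> t =
     (let c = (SOME c. c \<in> A \<and> \<gamma> t \<in> chart_dom c);
          v = vector_derivative (coord c \<circ> \<gamma>) (at t)
      in sqrt (g c (\<gamma> t) v v))"

definition curve_length ::
    "('a, 'n::finite) corner_chart set \<Rightarrow> ('a, 'n) tensor2 \<Rightarrow> (real \<Rightarrow> 'a) \<Rightarrow> ennreal" where
  "curve_length A g \<gamma> = (\<integral>\<^sup>+t\<in>{0..1}. ennreal (speed A g \<gamma> t) \<partial>lborel)"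

text \<open>Connectedness is not assumed: the distance between different components is \<open>\<infinity>\<close>.\<close>

definition riemannian_dist ::
    "'a topology \<Rightarrow> ('a, 'n::finite) corner_chart set \<Rightarrow> 'a set \<Rightarrow> ('a, 'n) tensor2 \<Rightarrow>
       'a \<Rightarrow> 'a \<Rightarrow> ennreal" where
  "riemannian_dist X A Y g p q =
     (INF \<gamma> \<in> {\<gamma>. piecewise_C1_curve X A Y \<gamma> \<and> \<gamma> 0 = p \<and> \<gamma> 1 = q}. curve_length A g \<gamma>)"


section \<open>Metric completion and the induced boundary distance\<close>

definition cauchy_seqs :: "'a set \<Rightarrow> ('a \<Rightarrow> 'a \<Rightarrow> ennreal) \<Rightarrow> (nat \<Rightarrow> 'a) set" where
  "cauchy_seqs Y d =
     {x. range x \<subseteq> Y \<and> (\<forall>e>0. \<exists>M. \<forall>m\<ge>M. \<forall>n\<ge>M. d (x m) (x n) < e)}"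

definition cauchy_equiv ::
    "'a set \<Rightarrow> ('a \<Rightarrow> 'a \<Rightarrow> ennreal) \<Rightarrow> ((nat \<Rightarrow> 'a) \<times> (nat \<Rightarrow> 'a)) set" where
  "cauchy_equiv Y d =
     {(x, y). x \<in> cauchy_seqs Y d \<and> y \<in> cauchy_seqs Y d \<and> (\<lambda>n. d (x n) (y n)) \<longlonglongrightarrow> 0}"

definition completion_points ::
    "'a set \<Rightarrow> ('a \<Rightarrow> 'a \<Rightarrow> ennreal) \<Rightarrow> (nat \<Rightarrow> 'a) set set" where
  "completion_points Y d = cauchy_seqs Y d // cauchy_equiv Y d"

definition completion_dist ::
    "('a \<Rightarrow> 'a \<Rightarrow> ennreal) \<Rightarrow> (nat \<Rightarrow> 'a) set \<Rightarrow> (nat \<Rightarrow> 'a) set \<Rightarrow> ennreal" where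
  "completion_dist d P Q = (THE r. \<forall>x\<in>P. \<forall>y\<in>Q. (\<lambda>n. d (x n) (y n)) \<longlonglongrightarrow> r)"

definition accessible :: "'a topology \<Rightarrow> 'a set \<Rightarrow> ('a \<Rightarrow> 'a \<Rightarrow> ennreal) \<Rightarrow> 'a \<Rightarrow> bool" where
  "accessible X Y d p \<longleftrightarrow> (\<exists>x\<in>cauchy_seqs Y d. limitin X x p sequentially)"

text \<open>The completion point \<open>z\<close>-bar: the class of all sequences in \<open>Y\<close> converging to \<open>z\<close> in \<open>X\<close>.\<close>

definition completion_point ::
    "'a topology \<Rightarrow> 'a set \<Rightarrow> ('a \<Rightarrow> 'a \<Rightarrow> ennreal) \<Rightarrow> 'a \<Rightarrow> (nat \<Rightarrow> 'a) set" where
  "completion_point X Y d z =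
     (THE P. P \<in> completion_points Y d \<and>
        (\<forall>x. range x \<subseteq> Y \<and> limitin X x z sequentially \<longrightarrow> x \<in> P))"

definition boundary_dist ::
    "'a topology \<Rightarrow> 'a set \<Rightarrow> ('a \<Rightarrow> 'a \<Rightarrow> ennreal) \<Rightarrow> 'a \<Rightarrow> 'a \<Rightarrow> ennreal" where
  "boundary_dist X Y d z z' =
     completion_dist d (completion_point X Y d z) (completion_point X Y d z')"


section \<open>Hausdorff dimension\<close>

definition ext_diam :: "('a \<Rightarrow> 'a \<Rightarrow> ennreal) \<Rightarrow> 'a set \<Rightarrow> ennreal" where
  "ext_diam d U = (SUP x\<in>U. SUP y\<in>U. d x y)"

text \<open>\<open>(diam U)\<^sup>s\<close> for sets of finite diameter, with \<open>(diam U)\<^sup>0 = 1\<close> for \<open>U \<noteq> {}\<close> (note that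
  \<open>0 powr 0 = 0\<close>); the empty set contributes \<open>0\<close>.\<close>

definition diam_powr :: "('a \<Rightarrow> 'a \<Rightarrow> ennreal) \<Rightarrow> real \<Rightarrow> 'a set \<Rightarrow> ennreal" where
  "diam_powr d s U =
     (if U = {} then 0 else if s = 0 then 1 else ennreal (enn2real (ext_diam d U) powr s))"

definition hausdorff_premeasure ::
    "('a \<Rightarrow> 'a \<Rightarrow> ennreal) \<Rightarrow> real \<Rightarrow> real \<Rightarrow> 'a set \<Rightarrow> ennreal" where
  "hausdorff_premeasure d s \<delta> S =
     (INF U \<in> {U :: nat \<Rightarrow> 'a set. (\<forall>i. U i \<subseteq> S \<and> ext_diam d (U i) \<le> ennreal \<delta>) \<and> S \<subseteq> (\<Union>i. U i)}.
        \<Sum>i. diam_powr d s (U i))"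

definition hausdorff_measure :: "('a \<Rightarrow> 'a \<Rightarrow> ennreal) \<Rightarrow> real \<Rightarrow> 'a set \<Rightarrow> ennreal" where
  "hausdorff_measure d s S = (SUP \<delta>\<in>{0<..}. hausdorff_premeasure d s \<delta> S)"

definition hausdorff_dim :: "'a set \<Rightarrow> ('a \<Rightarrow> 'a \<Rightarrow> ennreal) \<Rightarrow> ereal" where
  "hausdorff_dim S d = Inf {ereal s |s. 0 \<le> s \<and> hausdorff_measure d s S = 0}"

end

theory Submission
  imports Defs
begin

text \<open>
  Put \<open>b = A\<^sub>I / 2\<close>. Near the face, \<open>r = (\<Sum>i\<in>I. \<rho> i)\<close> is comparable to the size of the
  conormal coordinates and \<open>g\<^sub>\<Pi>\<close> has length element at least a multiple of \<open>r powr (- b)\<close> times the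
  Euclidean one, and at most a multiple of \<open>s powr (- b)\<close> after moving inward by \<open>s\<close>. To join two points
  at Euclidean distance \<open>L\<close> one moves inward by \<open>L\<close>, across, and back, at cost of order
  \<open>L powr (1 - b)\<close>; conversely a curve joining two points of the face either stays where \<open>r \<le> L\<close> or reaches
  \<open>r = L\<close>, and both cost at least that much. For \<open>b \<ge> 1\<close> the radial cost diverges, so accessibility forces
  \<open>b < 1\<close>. Thus the boundary distance is locally bi-Lipschitz to the snowflake
  \<open>\<bar>z - z'\<bar> powr (1 - b)\<close> on a flat \<open>m\<close>-dimensional piece, whose dimension is \<open>m / (1 - b)\<close>.
  All estimates are local, and the only input on the corner structure is that the derivative
  of \<open>\<rho> i\<close> at a zero is nonnegative on the tangent cone, hence positive on the inward diagonal.
\<close>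

section \<open>Hausdorff measure of snowflakes\<close>

text \<open>Completion points are represented by sequences in the interior, where r is positive. So
  the lower estimate compares interior points and carries a defect \<open>r powr (1 - b)\<close> of
  the starting point, which vanishes only in the limit towards the face. Nothing prevents a nearly
  shortest curve from leaving the chart; it is stopped once its coordinate distance from the start
  equals that of its end points, and a length bound up to that time suffices. Lengths are bounded
  below by calibrations: a function whose differential is dominated by the norm of g cannot vary
  along a curve by more than its length. The calibrations are linear functions and multiples of
  \<open>r powr (1 - b)\<close>, or of \<open>ln r\<close> when \<open>b \<ge> 1\<close>. All
  constants are local and an open face may fail to be compact, so null sets are glued by countable
  stability of the Hausdorff measure, while for nonvanishing one small cube is enough. The chart
  that flattens the face comes from the maximal atlas and differs from the one carrying the
  estimates; a transition that is Lipschitz in both directions joins them.\<close>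

lemma hausdorff_measure_eq_0_iff:
  "hausdorff_measure d s S = 0 \<longleftrightarrow>
    (\<forall>\<delta>>0. \<forall>e>0. \<exists>U::nat \<Rightarrow> 'a set. (\<forall>i. U i \<subseteq> S \<and> ext_diam d (U i) \<le> ennreal \<delta>) \<and>
       S \<subseteq> (\<Union>i. U i) \<and> (\<Sum>i. diam_powr d s (U i)) < e)"
  unfolding hausdorff_measure_def hausdorff_premeasure_def bot_ennreal[symmetric]
    SUP_bot_conv INF_eq_bot_iff
  by (auto simp: Bex_def)

text \<open>The n-th set receives the share \<open>e / 2 ^ (n + 1)\<close> of the error, and the
  covers are merged along a pairing of the natural numbers. This glues the local pieces of a
  face.\<close>

lemma hausdorff_measure_countable_Union_eq_0:
  assumes "\<And>n::nat. hausdorff_measure d s (T n) = 0"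
  shows "hausdorff_measure d s (\<Union>n. T n) = 0"
  unfolding hausdorff_measure_eq_0_iff
proof (intro allI impI)
  fix \<delta> :: real and e0 :: ennreal
  assume "\<delta> > 0" "e0 > 0"
  \<comment> \<open>Summing the strict bounds gives only a total of at most e, so some room below
    \<open>e0\<close> is reserved.\<close>
  then obtain e where e: "0 < e" "e < e0" using dense by blast
  have "\<exists>U::nat \<Rightarrow> 'a set. (\<forall>i. U i \<subseteq> T n \<and> ext_diam d (U i) \<le> ennreal \<delta>) \<and>
       T n \<subseteq> (\<Union>i. U i) \<and> (\<Sum>i. diam_powr d s (U i)) < e * ennreal ((1/2) ^ Suc n)" for n
  proof -
    have "e * ennreal ((1/2) ^ Suc n) > 0"
      using e(1) by (simp add: ennreal_zero_less_mult_iff del: power_Suc)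
    then show ?thesis
      using assms[of n] \<open>\<delta> > 0\<close> unfolding hausdorff_measure_eq_0_iff by blast
  qed
  then obtain U where U: "\<And>n i. U n i \<subseteq> T n" "\<And>n i. ext_diam d (U n i) \<le> ennreal \<delta>"
    "\<And>n. T n \<subseteq> (\<Union>i. U n i)" "\<And>n. (\<Sum>i. diam_powr d s (U n i)) < e * ennreal ((1/2) ^ Suc n)"
    by metis
  define V where "V k = case_prod U (prod_decode k)" for k
  have "(\<Sum>k. diam_powr d s (V k)) = (\<Sum>n. \<Sum>i. diam_powr d s (U n i))"
    unfolding V_def
    using suminf_ennreal_2dimen[of "\<lambda>n. \<Sum>i. diam_powr d s (U n i)" "\<lambda>x. diam_powr d s (case_prod U x)"]
    by (simp add: o_def)
  also have "\<dots> \<le> (\<Sum>n. e * ennreal ((1/2) ^ Suc n))"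
    by (intro suminf_le summableI less_imp_le U)
  also have "\<dots> = e"
    proof -
    have "(\<Sum>n. ennreal ((1/2) ^ Suc n)) = 1"
      using power_half_series
      by (subst suminf_ennreal2) (auto simp: sums_iff simp del: power_Suc)
    then show ?thesis by (simp only: ennreal_suminf_cmult mult_1_right)
  qed
  finally have "(\<Sum>k. diam_powr d s (V k)) < e0" using e by simp
  moreover have "(\<Union>n. T n) \<subseteq> (\<Union>k. V k)"
  proof
    fix z assume "z \<in> (\<Union>n. T n)"
    then obtain n i where "z \<in> U n i" using U(3) by blast
    then have "z \<in> V (prod_encode (n, i))" by (simp add: V_def)
    then show "z \<in> (\<Union>k. V k)" by blast
  qed
  moreover have "V k \<subseteq> (\<Union>n. T n)" "ext_diam d (V k) \<le> ennreal \<delta>" for k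
    using U(1,2) by (auto simp: V_def split: prod.split)
  ultimately show "\<exists>U. (\<forall>i. U i \<subseteq> (\<Union>n. T n) \<and> ext_diam d (U i) \<le> ennreal \<delta>) \<and>
       (\<Union>n. T n) \<subseteq> (\<Union>i. U i) \<and> (\<Sum>i. diam_powr d s (U i)) < e0"
    by blast
qed

text \<open>The form in which a box count is used: all members share one diameter bound b, so the
  count times \<open>b powr s\<close> dominates the sum. The condition \<open>s > 0\<close> keeps
  away from the convention at exponent 0, where every nonempty set weighs 1.\<close>

lemma hausdorff_measure_eq_0_finite_cover:
  assumes "\<And>\<delta> e. \<delta> > 0 \<Longrightarrow> e > 0 \<Longrightarrow>
     \<exists>P b. finite P \<and> \<Union>P = S \<and> (\<forall>U\<in>P. ext_diam d U \<le> ennreal b) \<and> 0 \<le> b \<and> b \<le> \<delta> \<and> real (card P) * b powr s < e"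
    and "s > 0"
  shows "hausdorff_measure d s S = 0"
  unfolding hausdorff_measure_eq_0_iff
proof (intro allI impI)
  fix \<delta> :: real and e0 :: ennreal
  assume \<delta>: "\<delta> > 0" and "e0 > 0"
  then obtain e where e: "0 < e" "e < e0" using dense by blast
  then have "enn2real e > 0" using enn2real_positive_iff[of e] by (metis order_less_le_trans top_greatest)
  from assms(1)[OF \<delta> this] obtain P b
    where "finite P \<and> \<Union>P = S \<and> (\<forall>U\<in>P. ext_diam d U \<le> ennreal b) \<and> 0 \<le> b \<and> b \<le> \<delta> \<and>
      real (card P) * b powr s < enn2real e" by (elim exE)
  then have P: "finite P" "\<Union>P = S" "\<And>U. U \<in> P \<Longrightarrow> ext_diam d U \<le> ennreal b"
    "0 \<le> b" "b \<le> \<delta>" "real (card P) * b powr s < enn2real e" by auto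
  obtain h where h: "bij_betw h {0..<card P} P"
    using ex_bij_betw_nat_finite[OF P(1)] by blast
  \<comment> \<open>A cover is a sequence, so the finite family is padded by empty sets, whose
    weight and diameter are 0.\<close>
  define U where "U i = (if i < card P then h i else {})" for i
  have hP: "h i \<in> P" if "i < card P" for i using h that by (auto simp: bij_betw_def)
  have "(\<Sum>i. diam_powr d s (U i)) = (\<Sum>i<card P. diam_powr d s (U i))"
    by (intro suminf_finite) (auto simp: U_def diam_powr_def)
  also have "\<dots> \<le> (\<Sum>i<card P. ennreal (b powr s))"
  proof (intro sum_mono)
    fix i assume "i \<in> {..<card P}"
    then have "ext_diam d (U i) \<le> ennreal b" using P hP by (auto simp: U_def)
    then have "enn2real (ext_diam d (U i)) \<le> b"
      using P(4) by (metis enn2real_mono enn2real_ennreal ennreal_less_top)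
    then show "diam_powr d s (U i) \<le> ennreal (b powr s)"
      using \<open>s > 0\<close> by (auto simp: diam_powr_def intro!: ennreal_leI powr_mono2)
  qed
  also have "\<dots> = ennreal (real (card P) * b powr s)"
    by (simp add: ennreal_mult ennreal_of_nat_eq_real_of_nat)
  also have "\<dots> \<le> ennreal (enn2real e)" using P(6) by (intro ennreal_leI) simp
  also have "\<dots> \<le> e" by (simp add: ennreal_enn2real_if)
  finally have "(\<Sum>i. diam_powr d s (U i)) < e0" using e by simp
  moreover have "S \<subseteq> (\<Union>i. U i)"
  proof
    fix z assume "z \<in> S"
    then obtain i where "i < card P" "z \<in> h i" using P(2) h by (auto simp: bij_betw_def) (metis UnionE atLeast0LessThan imageE lessThan_iff)
    then show "z \<in> (\<Union>i. U i)" by (auto simp: U_def)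
  qed
  moreover have "U i \<subseteq> S" for i using hP P(2) by (auto simp: U_def)
  moreover have "ext_diam d (U i) \<le> ennreal \<delta>" for i
    using hP[of i] P(3)[of "h i"] P(5) order_trans[OF _ ennreal_leI[OF P(5)]]
    by (cases "i < card P") (auto simp: U_def ext_diam_def bot_ennreal)
  ultimately show "\<exists>U. (\<forall>i. U i \<subseteq> S \<and> ext_diam d (U i) \<le> ennreal \<delta>) \<and>
       S \<subseteq> (\<Union>i. U i) \<and> (\<Sum>i. diam_powr d s (U i)) < e0"
    by blast
qed

text \<open>Box counting: cutting each of the m free coordinates into k intervals gives at most
  \<open>k ^ m\<close> pieces, of d-diameter of order \<open>k powr (- \<beta>)\<close>. The total
  weight is of order \<open>k powr (m - \<beta> * s)\<close> and tends to 0 since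
  \<open>s > m / \<beta>\<close>.\<close>

lemma hausdorff_measure_snowflake_eq_0:
  fixes f :: "'a \<Rightarrow> real ^ 'n::finite"
  assumes J: "card J + m = CARD('n)"
    and bounded: "\<And>z j. z \<in> T \<Longrightarrow> \<bar>f z $ j\<bar> \<le> R"
    and flat: "\<And>z j. z \<in> T \<Longrightarrow> j \<in> J \<Longrightarrow> f z $ j = 0"
    and D: "\<And>z z'. z \<in> T \<Longrightarrow> z' \<in> T \<Longrightarrow> d z z' \<le> ennreal (C * norm (f z - f z') powr \<beta>)"
    and "C > 0" "\<beta> > 0" "R > 0" and s: "s > real m / \<beta>"
  shows "hausdorff_measure d s T = 0"
proof (rule hausdorff_measure_eq_0_finite_cover)
  show "s > 0" using s \<open>\<beta> > 0\<close> by (meson divide_nonneg_pos le_less_trans of_nat_0_le_iff)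
  fix \<delta> e :: real assume "\<delta> > 0" "e > 0"
  \<comment> \<open>Points of one piece differ by at most \<open>2 * R / k\<close> in every
    coordinate, hence by at most \<open>a / k\<close> in the l1 norm, which bounds the Euclidean
    one.\<close>
  define a where "a = real CARD('n) * (2 * R)"
  have "a > 0" using \<open>R > 0\<close> by (simp add: a_def)
  define b where "b k = C * (a / real k) powr \<beta>" for k :: nat
  have bs: "real k ^ m * b k powr s = (C powr s * a powr (\<beta> * s)) * real k powr (real m - \<beta> * s)"
    if "k > 0" for k
    using that \<open>C > 0\<close> \<open>a > 0\<close>
    by (simp add: b_def powr_mult powr_divide powr_powr powr_diff powr_realpow)
  have "(\<lambda>k. real k powr (real m - \<beta> * s)) \<longlonglongrightarrow> 0"
    using s \<open>\<beta> > 0\<close> by (intro tendsto_neg_powr filterlim_real_sequentially) (simp add: field_simps)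
  then have "(\<lambda>k. (C powr s * a powr (\<beta> * s)) * real k powr (real m - \<beta> * s)) \<longlonglongrightarrow> (C powr s * a powr (\<beta> * s)) * 0"
    by (intro tendsto_mult tendsto_const)
  then have "\<forall>\<^sub>F k in sequentially. (C powr s * a powr (\<beta> * s)) * real k powr (real m - \<beta> * s) < e"
    using \<open>e > 0\<close> by (simp add: order_tendsto_iff)
  moreover have "b \<longlonglongrightarrow> C * 0"
  proof -
    have "(\<lambda>k. C * (a powr \<beta> * real k powr - \<beta>)) \<longlonglongrightarrow> C * (a powr \<beta> * 0)"
      using \<open>\<beta> > 0\<close> by (intro tendsto_mult tendsto_const tendsto_neg_powr filterlim_real_sequentially) simp
    moreover have "b = (\<lambda>k. C * (a powr \<beta> * real k powr - \<beta>))"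
      using \<open>a > 0\<close> by (auto simp: b_def powr_divide powr_minus field_simps)
    ultimately show ?thesis by simp
  qed
  then have "\<forall>\<^sub>F k in sequentially. b k < \<delta>"
    using \<open>\<delta> > 0\<close> by (simp add: order_tendsto_iff)
  ultimately have "\<forall>\<^sub>F k in sequentially. k > 0 \<and> b k < \<delta> \<and> (C powr s * a powr (\<beta> * s)) * real k powr (real m - \<beta> * s) < e"
    using eventually_gt_at_top by eventually_elim auto
  then obtain k where k: "k > 0" "b k < \<delta>" "real k ^ m * b k powr s < e"
    using bs by (auto simp: eventually_sequentially)
  \<comment> \<open>Only the coordinates outside J are cut, as the others vanish; neighbouring
    closed pieces may overlap.\<close>
  define W where "W \<kappa> = {z\<in>T. \<forall>j\<in>-J. f z $ j \<in> {2 * R * real (\<kappa> j) / real k - R .. 2 * R * (real (\<kappa> j) + 1) / real k - R}}" for \<kappa> :: "'n \<Rightarrow> nat"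
  define P where "P = W ` PiE (-J) (\<lambda>_. {..<k})"
  have "finite P" unfolding P_def by (intro finite_imageI finite_PiE) auto
  have "card (- J) = m" using J by (simp add: Compl_eq_Diff_UNIV card_Diff_subset)
  then have "card P \<le> k ^ m"
    unfolding P_def using card_image_le[of "PiE (-J) (\<lambda>_. {..<k})" W]
    by (simp add: finite_PiE card_PiE)
  then have "real (card P) \<le> real k ^ m"
    by (metis of_nat_le_iff of_nat_power)
  then have "real (card P) * b k powr s \<le> real k ^ m * b k powr s"
    by (intro mult_right_mono) auto
  then have "real (card P) * b k powr s < e" using k(3) by simp
  moreover have "\<Union>P = T"
  proof
    show "\<Union>P \<subseteq> T" by (auto simp: P_def W_def)
    show "T \<subseteq> \<Union>P"
    proof
      fix z assume z: "z \<in> T"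
      \<comment> \<open>Rescaling of \<open>{-R..R}\<close> to \<open>{0..k}\<close>. The end point
        k belongs to the last interval, whose index is \<open>k - 1\<close>.\<close>
      define q where "q j = (f z $ j + R) * real k / (2 * R)" for j
      have q: "q j \<ge> 0" "q j \<le> real k" for j
      proof -
        have "\<bar>f z $ j\<bar> \<le> R" using bounded[OF z] .
        then have "f z $ j + R \<le> 2 * R" "0 \<le> f z $ j + R" by linarith+
        then have "(f z $ j + R) * real k \<le> (2 * R) * real k" "0 \<le> f z $ j + R"
          by (auto intro!: mult_right_mono)
        then show "q j \<ge> 0" "q j \<le> real k" using \<open>R > 0\<close> by (auto simp: q_def pos_divide_le_eq mult.commute)
      qed
      have "\<exists>i<k. real i \<le> q j \<and> q j \<le> real i + 1" for j
      proof (cases "q j = real k")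
        case True
        then show ?thesis using k(1) by (intro exI[of _ "k - 1"]) (auto simp: of_nat_diff)
      next
        case False
        then have "q j < real k" using q(2)[of j] by simp
        then have "nat \<lfloor>q j\<rfloor> < k" using q(1)[of j] by linarith
        then show ?thesis using q(1)[of j] by (intro exI[of _ "nat \<lfloor>q j\<rfloor>"]) linarith
      qed
      then obtain \<kappa> where \<kappa>: "\<And>j. \<kappa> j < k" "\<And>j. real (\<kappa> j) \<le> q j" "\<And>j. q j \<le> real (\<kappa> j) + 1"
        by metis
      have "f z $ j = 2 * R * q j / real k - R" for j
        using k(1) \<open>R > 0\<close> by (simp add: q_def)
      then have "z \<in> W (restrict \<kappa> (-J))"
        using z \<kappa>(2,3) k(1) \<open>R > 0\<close> by (auto simp: W_def divide_right_mono mult_left_mono)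
      moreover have "restrict \<kappa> (-J) \<in> PiE (-J) (\<lambda>_. {..<k})" using \<kappa>(1) by auto
      ultimately show "z \<in> \<Union>P" unfolding P_def by blast
    qed
  qed
  moreover have "ext_diam d U \<le> ennreal (b k)" if U: "U \<in> P" for U
    unfolding ext_diam_def
  proof (intro SUP_least)
    fix z z' assume zz: "z \<in> U" "z' \<in> U"
    obtain \<kappa> where \<kappa>: "U = W \<kappa>" using U by (auto simp: P_def)
    have T: "z \<in> T" "z' \<in> T" using zz by (auto simp: \<kappa> W_def)
    have "\<bar>(f z - f z') $ j\<bar> \<le> 2 * R / real k" for j
    proof (cases "j \<in> J")
      case True
      then show ?thesis using flat T \<open>R > 0\<close> by simp
    next
      case False
      have "2 * R * (real (\<kappa> j) + 1) / real k = 2 * R * real (\<kappa> j) / real k + 2 * R / real k"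
        using k(1) by (simp add: field_simps)
      moreover have "f z $ j \<in> {2 * R * real (\<kappa> j) / real k - R .. 2 * R * (real (\<kappa> j) + 1) / real k - R}"
        "f z' $ j \<in> {2 * R * real (\<kappa> j) / real k - R .. 2 * R * (real (\<kappa> j) + 1) / real k - R}"
        using zz False unfolding \<kappa> W_def by blast+
      ultimately show ?thesis
        unfolding vector_minus_component atLeastAtMost_iff by linarith
    qed
    then have "norm (f z - f z') \<le> (\<Sum>j\<in>(UNIV::'n set). 2 * R / real k)"
      by (intro order_trans[OF norm_le_l1_cart] sum_mono) simp
    then have "norm (f z - f z') \<le> a / real k" by (simp add: a_def)
    then have "C * norm (f z - f z') powr \<beta> \<le> b k"
      unfolding b_def using \<open>C > 0\<close> \<open>\<beta> > 0\<close> by (intro mult_left_mono powr_mono2) auto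
    then show "d z z' \<le> ennreal (b k)"
      by (intro order_trans[OF D[OF T]] ennreal_leI)
  qed
  moreover have "0 \<le> b k" "b k \<le> \<delta>" using k \<open>C > 0\<close> by (auto simp: b_def)
  ultimately show "\<exists>P b. finite P \<and> \<Union>P = T \<and> (\<forall>U\<in>P. ext_diam d U \<le> ennreal b) \<and> 0 \<le> b \<and> b \<le> \<delta> \<and> real (card P) * b powr s < e"
    using \<open>finite P\<close> by blast
qed

text \<open>Mass distribution with \<open>n\<close>-dimensional Lebesgue measure: the sets of a cover and the \<open>m\<close>-dimensional
  cube are thickened by \<open>[0, \<eta>]\<close> in the coordinates of \<open>J\<close>.\<close>

lemma hausdorff_measure_snowflake_neq_0:
  fixes f :: "'a \<Rightarrow> real ^ 'n::finite"
  assumes J: "card J + m = CARD('n)"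
    and "Q \<subseteq> S" and "\<eta> > 0"
    and cube: "\<And>y. (\<And>j. j \<in> J \<Longrightarrow> y $ j = 0) \<Longrightarrow> (\<And>j. j \<notin> J \<Longrightarrow> y $ j \<in> {a $ j..a $ j + \<eta>}) \<Longrightarrow>
       \<exists>z\<in>Q. f z = y"
    and D: "\<And>z z'. z \<in> Q \<Longrightarrow> z' \<in> Q \<Longrightarrow> ennreal (c * norm (f z - f z') powr \<beta>) \<le> d z z'"
    and "c > 0" "\<beta> > 0" and s: "0 \<le> s" "s < real m / \<beta>"
  shows "hausdorff_measure d s S \<noteq> 0"
proof
  assume "hausdorff_measure d s S = 0"
  have "m > 0" using s by (cases m) auto
  \<comment> \<open>The box \<open>B i\<close> below has edges \<open>2 * t i\<close> in m
    directions and \<eta> in the others; its volume is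
    \<open>K * b i powr (m / \<beta>)\<close>.\<close>
  define K where "K = (2 * (1 / c) powr (1 / \<beta>)) ^ m * \<eta> ^ card J"
  have "K > 0" using \<open>c > 0\<close> \<open>\<eta> > 0\<close> by (simp add: K_def)
  \<comment> \<open>A cover of total weight below this number would give boxes of total volume less
    than \<open>\<eta> ^ CARD('n)\<close>, the volume of the thickened cube. The diameters are
    bounded by 1 so that their powers decrease with the exponent.\<close>
  have "ennreal (\<eta> ^ CARD('n) / K) > 0" using \<open>K > 0\<close> \<open>\<eta> > 0\<close> by simp
  with \<open>hausdorff_measure d s S = 0\<close>[unfolded hausdorff_measure_eq_0_iff, rule_format, OF zero_less_one]
  obtain U where U': "(\<forall>i. U i \<subseteq> S \<and> ext_diam d (U i) \<le> ennreal 1) \<and> S \<subseteq> (\<Union>i::nat. U i) \<and>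
    (\<Sum>i. diam_powr d s (U i)) < ennreal (\<eta> ^ CARD('n) / K)" by meson
  then have U: "\<And>i. U i \<subseteq> S" "\<And>i. ext_diam d (U i) \<le> ennreal 1" "S \<subseteq> (\<Union>i. U i)"
    "(\<Sum>i. diam_powr d s (U i)) < ennreal (\<eta> ^ CARD('n) / K)"
    by simp_all
  define b where "b i = enn2real (ext_diam d (U i))" for i
  have b: "0 \<le> b i" "b i \<le> 1" for i
    using U(2)[of i] enn2real_mono[OF U(2)[of i]] by (auto simp: b_def)
  have ediam: "ext_diam d (U i) = ennreal (b i)" for i
    unfolding b_def using U(2)[of i] by (intro ennreal_enn2real[symmetric]) (simp add: order_le_less_trans)
  define t where "t i = (b i / c) powr (1 / \<beta>)" for i
  \<comment> \<open>Every point of \<open>U i \<inter> Q\<close> has its image within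
    \<open>t i\<close> of the image of one chosen point, so this box contains the thickened image.
    Only the part of \<open>U i\<close> in Q is controlled, since the cover is one of S.\<close>
  define B where "B i = (if U i \<inter> Q = {} then {} else
      let u = f (SOME z. z \<in> U i \<inter> Q) in
      cbox (\<chi> j. if j \<in> J then 0 else u $ j - t i) (\<chi> j. if j \<in> J then \<eta> else u $ j + t i))" for i
  have in_B: "y \<in> B i" if z: "z \<in> U i \<inter> Q"
    and y: "\<And>j. j \<in> J \<Longrightarrow> y $ j \<in> {0..\<eta>}" "\<And>j. j \<notin> J \<Longrightarrow> y $ j = f z $ j" for y z i
  proof -
    define w where "w = (SOME z. z \<in> U i \<inter> Q)"
    have w: "w \<in> U i \<inter> Q" unfolding w_def using z by (rule someI)
    have "ennreal (c * norm (f z - f w) powr \<beta>) \<le> ext_diam d (U i)"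
      unfolding ext_diam_def using w z by (intro SUP_upper2[of z] SUP_upper2[of w] D) auto
    then have "c * norm (f z - f w) powr \<beta> \<le> b i"
      unfolding ediam using b(1) by (simp add: ennreal_le_iff)
    then have "norm (f z - f w) powr \<beta> \<le> b i / c" using \<open>c > 0\<close> by (simp add: field_simps)
    then have "(norm (f z - f w) powr \<beta>) powr (1 / \<beta>) \<le> t i"
      unfolding t_def using \<open>\<beta> > 0\<close> by (intro powr_mono2) auto
    then have "norm (f z - f w) \<le> t i" using \<open>\<beta> > 0\<close> by (simp add: powr_powr)
    then have "\<bar>f z $ j - f w $ j\<bar> \<le> t i" for j
      using component_le_norm_cart[of "f z - f w" j] by simp
    then have "f w $ j - t i \<le> f z $ j \<and> f z $ j \<le> f w $ j + t i" for j
      by (smt (verit, best))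
    then have "y \<in> cbox (\<chi> j. if j \<in> J then 0 else f w $ j - t i) (\<chi> j. if j \<in> J then \<eta> else f w $ j + t i)"
      using y by (auto simp: mem_box_cart)
    then show ?thesis using z by (auto simp only: B_def Let_def w_def split: if_splits)
  qed
  have tt: "(2 * t i) ^ m * \<eta> ^ card J = K * b i powr (real m / \<beta>)" for i
    using b(1)[of i] \<open>c > 0\<close> \<open>m > 0\<close>
    by (cases "b i = 0")
       (auto simp: t_def K_def powr_divide power_mult_distrib powr_powr powr_realpow[symmetric] power_divide)
  have vol: "emeasure lborel (cbox u v) = ennreal (measure lborel (cbox u v))" for u v :: "real ^ 'n"
    using emeasure_lborel_cbox_finite[of u v] by (intro emeasure_eq_ennreal_measure) (auto simp: less_top)
  have emB: "emeasure lborel (B i) \<le> ennreal K * diam_powr d s (U i)" for i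
  proof (cases "U i \<inter> Q = {}")
    case True
    then show ?thesis by (simp add: B_def)
  next
    case False
    define u where "u = f (SOME z. z \<in> U i \<inter> Q)"
    have "t i \<ge> 0" by (simp add: t_def)
    have "emeasure lborel (B i) = emeasure lborel (cbox (\<chi> j. if j \<in> J then 0 else u $ j - t i) (\<chi> j. if j \<in> J then \<eta> else u $ j + t i) :: (real^'n) set)"
      using False by (simp only: B_def u_def Let_def if_False)
    also have "\<dots> = ennreal (measure lborel (cbox (\<chi> j. if j \<in> J then 0 else u $ j - t i) (\<chi> j. if j \<in> J then \<eta> else u $ j + t i) :: (real^'n) set))"
      by (rule vol)
    also have "measure lborel (cbox (\<chi> j. if j \<in> J then 0 else u $ j - t i) (\<chi> j. if j \<in> J then \<eta> else u $ j + t i) :: (real^'n) set)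
      = (\<Prod>j\<in>UNIV. if j \<in> J then \<eta> else 2 * t i)"
      using \<open>t i \<ge> 0\<close> \<open>\<eta> > 0\<close>
      by (subst content_cbox_cart) (auto simp: interval_ne_empty_cart intro!: prod.cong)
    also have "\<dots> = \<eta> ^ card J * (2 * t i) ^ card (- J)"
      by (simp add: prod.If_cases)
    also have "card (- J) = m" using J by (simp add: Compl_eq_Diff_UNIV card_Diff_subset)
    also have "\<eta> ^ card J * (2 * t i) ^ m = K * b i powr (real m / \<beta>)" using tt[of i] by (simp add: mult.commute)
    \<comment> \<open>Uses \<open>b i \<le> 1\<close> and \<open>s < m / \<beta>\<close>; the case
      distinction follows the convention in \<open>diam_powr\<close> for exponent 0.\<close>
    also have "\<dots> \<le> K * (if s = 0 then 1 else b i powr s)"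
    proof -
      have "b i powr (real m / \<beta>) \<le> b i powr s" "b i powr (real m / \<beta>) \<le> 1"
        using s b[of i] by (auto intro!: powr_mono' powr_le1)
      then show ?thesis using \<open>K > 0\<close> by (auto intro!: mult_left_mono)
    qed
    also have "ennreal \<dots> = ennreal K * diam_powr d s (U i)"
      using False \<open>K > 0\<close> by (auto simp: diam_powr_def b_def ennreal_mult)
    finally show ?thesis by (simp add: ennreal_leI)
  qed
  define a' where "a' = (\<chi> j. if j \<in> J then 0 else a $ j)"
  have "cbox a' (\<chi> j. a' $ j + \<eta>) \<subseteq> (\<Union>i. B i)"
  proof
    fix y assume y: "y \<in> cbox a' (\<chi> j. a' $ j + \<eta>)"
    define y' where "y' = (\<chi> j. if j \<in> J then 0 else y $ j)"
    have yj: "a' $ j \<le> y $ j" "y $ j \<le> a' $ j + \<eta>" for j using y by (auto simp: mem_box_cart)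
    have "y' $ j \<in> {a $ j..a $ j + \<eta>}" if "j \<notin> J" for j
      using yj[of j] that by (simp add: a'_def y'_def)
    then obtain z where z: "z \<in> Q" "f z = y'" using cube[of y'] by (auto simp: y'_def)
    then obtain i where i: "z \<in> U i" using \<open>Q \<subseteq> S\<close> U(3) by blast
    have "y $ j \<in> {0..\<eta>}" if "j \<in> J" for j using yj[of j] that by (simp add: a'_def)
    then have "y \<in> B i" using i z by (intro in_B[of z]) (auto simp: y'_def)
    then show "y \<in> (\<Union>i. B i)" by blast
  qed
  moreover have Bs: "B i \<in> sets lborel" for i by (auto simp: B_def Let_def)
  ultimately have "emeasure lborel (cbox a' (\<chi> j. a' $ j + \<eta>)) \<le> emeasure lborel (\<Union>i. B i)"
    by (intro emeasure_mono) auto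
  also have "\<dots> \<le> (\<Sum>i. emeasure lborel (B i))" using Bs by (intro emeasure_subadditive_countably) auto
  also have "\<dots> \<le> (\<Sum>i. ennreal K * diam_powr d s (U i))" by (intro suminf_le summableI emB)
  also have "\<dots> = ennreal K * (\<Sum>i. diam_powr d s (U i))" by simp
  also have "\<dots> < ennreal K * ennreal (\<eta> ^ CARD('n) / K)"
    using U(4) \<open>K > 0\<close> by (intro ennreal_mult_strict_left_mono) auto
  also have "\<dots> = ennreal (\<eta> ^ CARD('n))"
    using \<open>K > 0\<close> \<open>\<eta> > 0\<close> by (simp flip: ennreal_mult)
  also have "\<dots> = ennreal (measure lborel (cbox a' (\<chi> j. a' $ j + \<eta>)))"
    using \<open>\<eta> > 0\<close> by (subst content_cbox_cart) (auto simp: interval_ne_empty_cart)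
  also have "\<dots> = emeasure lborel (cbox a' (\<chi> j. a' $ j + \<eta>))"
    by (rule vol[symmetric])
  finally show False by simp
qed

lemma hausdorff_dim_eqI:
  assumes "0 \<le> t"
    and "\<And>s. t < s \<Longrightarrow> hausdorff_measure d s S = 0"
    and "\<And>s. 0 \<le> s \<Longrightarrow> s < t \<Longrightarrow> hausdorff_measure d s S \<noteq> 0"
  shows "hausdorff_dim S d = ereal t"
  unfolding hausdorff_dim_def
proof (rule antisym)
  show "Inf {ereal s |s. 0 \<le> s \<and> hausdorff_measure d s S = 0} \<le> ereal t"
  proof (rule ereal_le_epsilon2)
    fix e :: real assume "0 < e"
    then have "hausdorff_measure d (t + e) S = 0" "0 \<le> t + e" using assms by auto
    then show "Inf {ereal s |s. 0 \<le> s \<and> hausdorff_measure d s S = 0} \<le> ereal t + ereal e"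
      by (intro Inf_lower) auto
  qed
  show "ereal t \<le> Inf {ereal s |s. 0 \<le> s \<and> hausdorff_measure d s S = 0}"
    using assms(3) by (intro Inf_greatest) (auto simp: not_less[symmetric])
qed

section \<open>Integrals of arbitrary functions\<close>

text \<open>No measurability is assumed: \<^const>\<open>speed\<close> picks a chart at each time separately.\<close>

lemma nn_integral_affine_any:
  fixes f :: "real \<Rightarrow> ennreal"
  assumes "c \<noteq> 0"
  shows "(\<integral>\<^sup>+x. f x \<partial>lborel) = ennreal \<bar>c\<bar> * (\<integral>\<^sup>+x. f (t + c * x) \<partial>lborel)"
proof -
  \<comment> \<open>A simple function below f is measurable, so the substitution holds for it, and
    the supremum over such functions gives one inequality. Applied to the inverse affine map, the
    same inequality gives the other.\<close>
  have le: "(\<integral>\<^sup>+x. f x \<partial>lborel) \<le> ennreal \<bar>c\<bar> * (\<integral>\<^sup>+x. f (t + c * x) \<partial>lborel)"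
    if "c \<noteq> 0" for f :: "real \<Rightarrow> ennreal" and c t
    unfolding nn_integral_def[of lborel f]
  proof (rule SUP_least, clarify)
    fix u :: "real \<Rightarrow> ennreal" assume u: "simple_function lborel u" "u \<le> f"
    have "integral\<^sup>S lborel u = (\<integral>\<^sup>+x. u x \<partial>lborel)"
      using u(1) by (simp add: nn_integral_eq_simple_integral)
    also have "\<dots> = ennreal \<bar>c\<bar> * (\<integral>\<^sup>+x. u (t + c * x) \<partial>lborel)"
      using borel_measurable_simple_function[OF u(1)] that
      by (intro nn_integral_real_affine) auto
    also have "\<dots> \<le> ennreal \<bar>c\<bar> * (\<integral>\<^sup>+x. f (t + c * x) \<partial>lborel)"
      using u(2) by (intro mult_left_mono nn_integral_mono) (auto simp: le_fun_def)
    finally show "integral\<^sup>S lborel u \<le> ennreal \<bar>c\<bar> * (\<integral>\<^sup>+x. f (t + c * x) \<partial>lborel)" .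
  qed
  have "ennreal \<bar>c\<bar> * (\<integral>\<^sup>+x. f (t + c * x) \<partial>lborel)
      \<le> ennreal \<bar>c\<bar> * (ennreal \<bar>1 / c\<bar> * (\<integral>\<^sup>+x. f (t + c * (- t / c + 1 / c * x)) \<partial>lborel))"
    using assms by (intro mult_left_mono le) auto
  also have "\<dots> = (ennreal \<bar>c\<bar> * ennreal \<bar>1 / c\<bar>) * (\<integral>\<^sup>+x. f x \<partial>lborel)"
    using assms by (simp add: field_simps mult.assoc)
  also have "ennreal \<bar>c\<bar> * ennreal \<bar>1 / c\<bar> = 1"
    using assms by (simp add: ennreal_mult[symmetric] flip: abs_mult)
  finally show ?thesis using le[OF assms, of f t] by simp
qed

text \<open>Dividing a simple minorant of the multiple by c yields a minorant of f. This direction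
  is the one used to compare lengths under a change of parameter.\<close>

lemma nn_integral_cmult_le:
  assumes "c > 0"
  shows "(\<integral>\<^sup>+x. ennreal c * f x \<partial>M) \<le> ennreal c * (\<integral>\<^sup>+x. f x \<partial>M)"
  unfolding nn_integral_def[of M "\<lambda>x. ennreal c * f x"]
proof (rule SUP_least, clarify)
  fix u assume u: "simple_function M u" "u \<le> (\<lambda>x. ennreal c * f x)"
  note [measurable] = borel_measurable_simple_function[OF u(1)]
  have inv: "ennreal c * (ennreal (1 / c) * y) = y" "ennreal (1 / c) * (ennreal c * y) = y" for y
    using assms by (simp_all flip: mult.assoc ennreal_mult)
  have "ennreal (1 / c) * u x \<le> f x" for x
    using mult_left_mono[of "u x" "ennreal c * f x" "ennreal (1 / c)"] u(2) by (simp add: inv le_fun_def)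
  then have "ennreal c * (\<integral>\<^sup>+x. ennreal (1 / c) * u x \<partial>M) \<le> ennreal c * (\<integral>\<^sup>+x. f x \<partial>M)"
    by (intro mult_left_mono nn_integral_mono) auto
  also have "(\<integral>\<^sup>+x. ennreal (1 / c) * u x \<partial>M) = ennreal (1 / c) * integral\<^sup>S M u"
    using u(1) by (simp add: nn_integral_cmult nn_integral_eq_simple_integral)
  finally show "integral\<^sup>S M u \<le> ennreal c * (\<integral>\<^sup>+x. f x \<partial>M)" by (simp add: inv)
qed

text \<open>For functions that are not measurable \<open>nn_integral\<close> is a supremum over
  simple minorants, and additivity can fail. Subadditivity over measurable domains survives because
  a minorant on the union restricts to minorants on A and on B.\<close>

lemma nn_integral_Un_le:
  assumes A: "A \<in> sets M" and B: "B \<in> sets M"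
  shows "(\<integral>\<^sup>+x\<in>A \<union> B. f x \<partial>M) \<le> (\<integral>\<^sup>+x\<in>A. f x \<partial>M) + (\<integral>\<^sup>+x\<in>B. f x \<partial>M)"
  unfolding nn_integral_def[of M "\<lambda>x. f x * indicator (A \<union> B) x"]
proof (rule SUP_least, clarify)
  fix u assume u: "simple_function M u" "u \<le> (\<lambda>x. f x * indicator (A \<union> B) x)"
  note [measurable] = borel_measurable_simple_function[OF u(1)] A B
  have ux: "u x \<le> f x * indicator (A \<union> B) x" for x using u(2) by (simp add: le_fun_def)
  have "integral\<^sup>S M u = (\<integral>\<^sup>+x. u x \<partial>M)"
    using u(1) by (simp add: nn_integral_eq_simple_integral)
  also have "\<dots> \<le> (\<integral>\<^sup>+x. u x * indicator A x + u x * indicator B x \<partial>M)"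
  proof (intro nn_integral_mono)
    fix x show "u x \<le> u x * indicator A x + u x * indicator B x"
      using ux[of x] by (cases "x \<in> A"; cases "x \<in> B") auto
  qed
  also have "\<dots> = (\<integral>\<^sup>+x\<in>A. u x \<partial>M) + (\<integral>\<^sup>+x\<in>B. u x \<partial>M)"
    by (intro nn_integral_add) auto
  also have "\<dots> \<le> (\<integral>\<^sup>+x\<in>A. f x \<partial>M) + (\<integral>\<^sup>+x\<in>B. f x \<partial>M)"
  proof (intro add_mono nn_integral_mono)
    fix x show "u x * indicator A x \<le> f x * indicator A x"
      using ux[of x] by (cases "x \<in> A") auto
    show "u x * indicator B x \<le> f x * indicator B x"
      using ux[of x] by (cases "x \<in> B") auto
  qed
  finally show "integral\<^sup>S M u \<le> (\<integral>\<^sup>+x\<in>A. f x \<partial>M) + (\<integral>\<^sup>+x\<in>B. f x \<partial>M)" .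
qed

text \<open>The fundamental theorem for the gauge integral yields the difference without
  integrability of the derivative. The Lebesgue integral of its absolute value is then either
  infinite, where the claim is trivial, or finite, where k is integrable. The comparison with \<phi>
  is pointwise and comes last, so \<phi> may be as irregular as \<open>speed\<close>.\<close>

lemma abs_diff_le_nn_integral_deriv_bound:
  fixes h h' \<phi> :: "real \<Rightarrow> real"
  assumes "a \<le> b" and cont: "continuous_on {a..b} h" and S: "finite S"
    and deriv: "\<And>t. t \<in> {a<..<b} - S \<Longrightarrow> (h has_real_derivative h' t) (at t)"
    and bound: "\<And>t. t \<in> {a<..<b} - S \<Longrightarrow> \<bar>h' t\<bar> \<le> \<phi> t"
  shows "ennreal \<bar>h b - h a\<bar> \<le> (\<integral>\<^sup>+t\<in>{a..b}. ennreal (\<phi> t) \<partial>lborel)"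
proof -
  \<comment> \<open>Set to 0 at the exceptional times, so that the comparison with
    \<open>ennreal (\<phi> t)\<close> holds at every time.\<close>
  define k where "k t = (if t \<in> {a<..<b} - S then h' t else 0)" for t
  have "(k has_integral (h b - h a)) {a..b}"
    by (rule fundamental_theorem_of_calculus_interior_strong[OF S \<open>a \<le> b\<close> _ cont])
       (auto simp: k_def deriv has_real_derivative_iff_has_vector_derivative[symmetric])
  then have k: "(k has_integral (h b - h a)) UNIV"
    by (rule has_integral_on_superset) (auto simp: k_def)
  have "ennreal \<bar>h b - h a\<bar> \<le> (\<integral>\<^sup>+t. ennreal \<bar>k t\<bar> \<partial>lebesgue)"
  proof (cases "(\<integral>\<^sup>+t. ennreal \<bar>k t\<bar> \<partial>lebesgue) = \<infinity>")
    case False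
    have "k \<in> borel_measurable lebesgue"
      using has_integral_implies_lebesgue_measurable[OF k] by simp
    then have int: "integrable lebesgue k"
      using False by (intro integrableI_bounded) (auto simp: less_top)
    have "h b - h a = integral\<^sup>L lebesgue k"
      using has_integral_integral_lebesgue[OF int] k has_integral_unique by blast
    then show ?thesis
      using integral_norm_bound_ennreal[OF int] by simp
  qed simp
  also have "\<dots> = (\<integral>\<^sup>+t. ennreal \<bar>k t\<bar> \<partial>lborel)" by (rule nn_integral_completion)
  also have "\<dots> \<le> (\<integral>\<^sup>+t\<in>{a..b}. ennreal (\<phi> t) \<partial>lborel)"
    using bound by (intro nn_integral_mono) (auto simp: k_def indicator_def intro!: ennreal_leI)
  finally show ?thesis .
qed

section \<open>Smooth maps\<close>

text \<open>All later uses of smoothness go through this: an extension G on a small ball, with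
  continuous directional derivatives and a uniform bound on the differential. The bound comes from
  the continuity of the finitely many derivatives along basis vectors.\<close>

lemma smooth_map_on_local_C1:
  fixes f :: "'a::euclidean_space \<Rightarrow> 'b::euclidean_space"
  assumes "smooth_map_on S f" "x \<in> S"
  obtains e G G' L where "e > 0" "L > 0"
    and "\<And>y. y \<in> ball x e \<Longrightarrow> (G has_derivative G' y) (at y)"
    and "\<And>y v. y \<in> ball x e \<Longrightarrow> norm (G' y v) \<le> L * norm v"
    and "\<And>v. continuous_on (ball x e) (\<lambda>y. G' y v)"
    and "\<And>y. y \<in> ball x e \<inter> S \<Longrightarrow> G y = f y"
proof -
  obtain U G where U: "open U" "x \<in> U" "\<And>k. Ck_on k U G" "\<And>y. y \<in> U \<inter> S \<Longrightarrow> G y = f y"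
    using assms unfolding smooth_map_on_def by metis
  define G' where "G' y = frechet_derivative G (at y)" for y
  have "Ck_on (Suc 0) U G" by (rule U(3))
  then have diff: "G differentiable_on U" and cont: "continuous_on U (\<lambda>y. G' y v)" for v
    by (auto simp: G'_def)
  have G': "(G has_derivative G' y) (at y)" if "y \<in> U" for y
    using diff that \<open>open U\<close> at_within_open[OF that \<open>open U\<close>]
    by (auto simp: differentiable_on_def G'_def frechet_derivative_works[symmetric])
  \<comment> \<open>The summand 1 lets the strict bound persist near x and makes L positive.\<close>
  define L where "L = (\<Sum>b\<in>Basis. norm (G' x b)) + 1"
  have "continuous_on U (\<lambda>y. \<Sum>b\<in>Basis. norm (G' y b))"
    by (intro continuous_intros cont)
  then have "isCont (\<lambda>y. \<Sum>b\<in>Basis. norm (G' y b)) x"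
    using U(1,2) by (simp add: continuous_on_eq_continuous_at)
  then have "\<forall>\<^sub>F y in at x. (\<Sum>b\<in>Basis. norm (G' y b)) < L"
    unfolding isCont_def by (rule order_tendstoD) (simp add: L_def)
  moreover have "\<forall>\<^sub>F y in at x. y \<in> U"
    using U(1,2) eventually_at_topological by blast
  ultimately have "\<forall>\<^sub>F y in at x. (\<Sum>b\<in>Basis. norm (G' y b)) < L \<and> y \<in> U"
    by eventually_elim simp
  then obtain e where e: "e > 0" "\<And>y. y \<noteq> x \<Longrightarrow> dist y x < e \<Longrightarrow> (\<Sum>b\<in>Basis. norm (G' y b)) < L \<and> y \<in> U"
    unfolding eventually_at by blast
  have e': "(\<Sum>b\<in>Basis. norm (G' y b)) < L \<and> y \<in> U" if "y \<in> ball x e" for y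
    using e(2)[of y] that U(2) by (cases "y = x") (auto simp: L_def dist_commute)
  show thesis
  proof
    show "e > 0" by fact
    show "L > 0" unfolding L_def by (simp add: sum_nonneg add_nonneg_pos)
    show "(G has_derivative G' y) (at y)" if "y \<in> ball x e" for y using e'[OF that] G' by blast
    show "G y = f y" if "y \<in> ball x e \<inter> S" for y using e'[of y] that U(4) by blast
    show "continuous_on (ball x e) (\<lambda>y. G' y v)" for v
      using cont by (rule continuous_on_subset) (use e' in blast)
    show "norm (G' y v) \<le> L * norm v" if y: "y \<in> ball x e" for y v
    proof -
      have lin: "linear (G' y)" using G' e'[OF y] has_derivative_linear by blast
      have "G' y v = G' y (\<Sum>b\<in>Basis. (v \<bullet> b) *\<^sub>R b)" by (simp add: euclidean_representation)
      also have "\<dots> = (\<Sum>b\<in>Basis. (v \<bullet> b) *\<^sub>R G' y b)"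
        by (simp add: linear_sum[OF lin] linear_cmul[OF lin])
      finally have "norm (G' y v) \<le> (\<Sum>b\<in>Basis. norm ((v \<bullet> b) *\<^sub>R G' y b))" using norm_sum by metis
      also have "\<dots> \<le> (\<Sum>b\<in>Basis. norm v * norm (G' y b))"
        by (intro sum_mono) (auto intro!: mult_right_mono Basis_le_norm)
      also have "\<dots> = norm v * (\<Sum>b\<in>Basis. norm (G' y b))" by (simp add: sum_distrib_left)
      also have "\<dots> \<le> norm v * L" using e'[OF y] by (intro mult_left_mono) auto
      finally show ?thesis by (simp add: mult.commute)
    qed
  qed
qed

lemma smooth_map_on_continuous:
  assumes "smooth_map_on S f"
  shows "continuous_on S f"
  unfolding continuous_on_eq_continuous_within
proof
  fix x assume x: "x \<in> S"
  obtain e G G' L where e: "e > 0" "\<And>y. y \<in> ball x e \<Longrightarrow> (G has_derivative G' y) (at y)"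
    "\<And>y. y \<in> ball x e \<inter> S \<Longrightarrow> G y = f y"
    using smooth_map_on_local_C1[OF assms x] by metis
  have "continuous (at x within S) G"
    using has_derivative_continuous[OF e(2)[of x]] e(1) by (simp add: continuous_at_imp_continuous_at_within)
  then show "continuous (at x within S) f"
    by (rule continuous_transform_within[OF _ e(1) x]) (auto simp: dist_commute intro!: e(3))
qed

section \<open>Charts\<close>

locale corner_atlas =
  fixes X :: "'a topology" and A :: "('a, 'n::finite) corner_chart set"
  assumes atlas: "smooth_atlas X A" and hausdorff: "Hausdorff_space X"
begin

abbreviation "Y \<equiv> mfd_interior A"

lemma is_chart: "c \<in> A \<Longrightarrow> is_chart X c"
  using atlas by (simp add: smooth_atlas_def)

end

lemma chart_homeo:
  assumes "is_chart X c"
  shows "homeomorphic_maps (subtopology X (chart_dom c)) (top_of_set (coord c ` chart_dom c)) (coord c) (chart_inv c)"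
    and "inj_on (coord c) (chart_dom c)" and "chart_dom c \<subseteq> topspace X"
proof -
  have op: "openin X (chart_dom c)" using assms by (simp add: is_chart_def)
  then show sub: "chart_dom c \<subseteq> topspace X" by (rule openin_subset)
  then have ts: "topspace (subtopology X (chart_dom c)) = chart_dom c" by auto
  have h: "homeomorphic_map (subtopology X (chart_dom c)) (top_of_set (coord c ` chart_dom c)) (coord c)"
    using assms by (simp add: is_chart_def)
  then show inj: "inj_on (coord c) (chart_dom c)"
    using homeomorphic_imp_injective_map ts by metis
  obtain k where k: "homeomorphic_maps (subtopology X (chart_dom c)) (top_of_set (coord c ` chart_dom c)) (coord c) k"
    using h homeomorphic_map_maps by blast
  have "k x = chart_inv c x" if "x \<in> coord c ` chart_dom c" for x
    using that k inj ts by (auto simp: homeomorphic_maps_def chart_inv_def the_inv_into_f_f)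
  then show "homeomorphic_maps (subtopology X (chart_dom c)) (top_of_set (coord c ` chart_dom c)) (coord c) (chart_inv c)"
    using k by (intro homeomorphic_maps_eq[OF k]) auto
qed

lemma chart_inv_coord: "is_chart X c \<Longrightarrow> q \<in> chart_dom c \<Longrightarrow> chart_inv c (coord c q) = q"
  by (metis chart_homeo(2) chart_inv_def the_inv_into_f_f)

lemma chart_inv_in_dom:
  assumes "is_chart X c" "x \<in> coord c ` chart_dom c"
  shows "chart_inv c x \<in> chart_dom c" "coord c (chart_inv c x) = x"
  using assms chart_inv_coord by fastforce+

lemma continuous_map_coord:
  "is_chart X c \<Longrightarrow> continuous_map (subtopology X (chart_dom c)) euclidean (coord c)"
  using chart_homeo(1) unfolding homeomorphic_maps_def continuous_map_in_subtopology by blast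

lemma continuous_map_chart_inv:
  "is_chart X c \<Longrightarrow> continuous_map (top_of_set (coord c ` chart_dom c)) X (chart_inv c)"
  using chart_homeo(1) unfolding homeomorphic_maps_def continuous_map_in_subtopology by blast

lemma openin_chart_preimage:
  assumes "is_chart X c" "open U"
  shows "openin X {q \<in> chart_dom c. coord c q \<in> U}"
proof -
  have op: "openin X (chart_dom c)" using assms by (simp add: is_chart_def)
  have "openin (subtopology X (chart_dom c)) {q \<in> topspace (subtopology X (chart_dom c)). coord c q \<in> U}"
    by (rule openin_continuous_map_preimage[OF continuous_map_coord[OF assms(1)]]) (simp add: assms(2))
  moreover have "{q \<in> topspace (subtopology X (chart_dom c)). coord c q \<in> U} = {q \<in> chart_dom c. coord c q \<in> U}"
    using openin_subset[OF op] by auto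
  ultimately show ?thesis using op openin_trans_full by fastforce
qed

lemma openin_coord_image:
  assumes c: "is_chart X c" and W: "openin X W" "W \<subseteq> chart_dom c"
  shows "openin (top_of_set (corner_model (corner c))) (coord c ` W)"
proof -
  have "openin (subtopology X (chart_dom c)) W"
    using W by (metis inf.absorb_iff1 inf.orderE openin_subtopology_Int)
  moreover have "open_map (subtopology X (chart_dom c)) (top_of_set (coord c ` chart_dom c)) (coord c)"
    using c unfolding is_chart_def by (meson homeomorphic_imp_open_map)
  ultimately have "openin (top_of_set (coord c ` chart_dom c)) (coord c ` W)"
    by (simp add: open_map_def)
  moreover have "openin (top_of_set (corner_model (corner c))) (coord c ` chart_dom c)"
    using c by (simp add: is_chart_def)
  ultimately show ?thesis using openin_trans by blast
qed

lemma coord_image_contains_ball: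
  assumes c: "is_chart X c" and W: "openin X W" "W \<subseteq> chart_dom c" and p: "p \<in> W"
  obtains e where "e > 0" "ball (coord c p) e \<inter> corner_model (corner c) \<subseteq> coord c ` W"
proof -
  obtain T where T: "open T" "coord c ` W = corner_model (corner c) \<inter> T"
    using openin_coord_image[OF c W] by (auto simp: openin_open)
  then obtain e where "e > 0" "ball (coord c p) e \<subseteq> T" using p open_contains_ball by blast
  then show thesis using T by (intro that[of e]) auto
qed

lemma coord_nonneg: "is_chart X c \<Longrightarrow> q \<in> chart_dom c \<Longrightarrow> j \<in> corner c \<Longrightarrow> 0 \<le> coord c q $ j"
  unfolding is_chart_def corner_model_def by (auto dest!: openin_imp_subset)

lemma open_positive: "open {x :: real ^ 'n. \<forall>j\<in>K. 0 < x $ j}"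
proof -
  have "{x :: real ^ 'n. \<forall>j\<in>K. 0 < x $ j} = (\<Inter>j\<in>K. {x. 0 < x $ j})" by auto
  then show ?thesis
    by (auto intro!: open_INT open_Collect_less continuous_intros)
qed

text \<open>Removing the walls turns a relatively open subset of the model into an open subset of
  the whole space; at interior points derivatives can then be taken without restriction to a
  subset.\<close>

lemma open_coord_image_positive:
  assumes c: "is_chart X c" and W: "openin X W" "W \<subseteq> chart_dom c"
  shows "open (coord c ` W \<inter> {x. \<forall>j\<in>corner c. 0 < x $ j})"
proof -
  obtain T where T: "open T" "coord c ` W = corner_model (corner c) \<inter> T"
    using openin_coord_image[OF c W] by (auto simp: openin_open)
  have eq: "coord c ` W \<inter> {x. \<forall>j\<in>corner c. 0 < x $ j} = T \<inter> {x. \<forall>j\<in>corner c. 0 < x $ j}"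
    using T by (auto simp: corner_model_def less_imp_le)
  then show ?thesis unfolding eq by (intro open_Int T(1) open_positive)
qed

abbreviation transition_deriv ::
    "('a, 'n::finite) corner_chart \<Rightarrow> ('a, 'n) corner_chart \<Rightarrow> 'a \<Rightarrow> real ^ 'n \<Rightarrow> real ^ 'n" where
  "transition_deriv c c' p \<equiv> frechet_derivative (transition c c')
     (at (coord c p) within coord c ` (chart_dom c \<inter> chart_dom c'))"

context corner_atlas
begin

text \<open>\<open>mfd_interior\<close> asks for some chart in which no corner coordinate vanishes.
  That every chart agrees is topological: the change of coordinates is injective and continuous on
  an open set, so by invariance of domain its image is open, and an open set inside the model avoids
  the walls.\<close>

lemma Y_iff:
  assumes c: "c \<in> A" and q: "q \<in> chart_dom c"
  shows "q \<in> Y \<longleftrightarrow> (\<forall>j\<in>corner c. 0 < coord c q $ j)"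
proof
  assume "\<forall>j\<in>corner c. 0 < coord c q $ j"
  then have "{j \<in> corner c. coord c q $ j = 0} = {}" by auto
  then show "q \<in> Y" using c q by (auto simp: mfd_interior_def depth_stratum_def intro!: bexI[of _ c])
next
  assume "q \<in> Y"
  then obtain c' where c': "c' \<in> A" "q \<in> chart_dom c'" "card {j \<in> corner c'. coord c' q $ j = 0} = 0"
    by (auto simp: mfd_interior_def depth_stratum_def)
  then have pos: "0 < coord c' q $ j" if "j \<in> corner c'" for j
    using that coord_nonneg[OF is_chart[OF c'(1)] c'(2) that] by (auto simp: less_le)
  define W where "W = chart_dom c \<inter> chart_dom c'"
  have W: "openin X W" using is_chart[OF c] is_chart[OF c'(1)] by (auto simp: W_def is_chart_def)
  define O' where "O' = coord c' ` W \<inter> {x. \<forall>j\<in>corner c'. 0 < x $ j}"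
  define f where "f = coord c \<circ> chart_inv c'"
  have "open O'" unfolding O'_def
    using is_chart[OF c'(1)] W by (intro open_coord_image_positive) (auto simp: W_def)
  moreover have inW: "chart_inv c' x \<in> W \<and> coord c' (chart_inv c' x) = x" if "x \<in> O'" for x
    using that is_chart[OF c'(1)] by (auto simp: O'_def W_def chart_inv_coord)
  have "continuous_on O' f"
  proof -
    have "continuous_map (top_of_set O') (subtopology X (chart_dom c)) (chart_inv c')"
      using continuous_map_chart_inv[OF is_chart[OF c'(1)]] inW
      by (auto simp: continuous_map_in_subtopology W_def O'_def
          intro: continuous_map_from_subtopology_mono)
    then have "continuous_map (top_of_set O') euclidean f"
      unfolding f_def using continuous_map_coord[OF is_chart[OF c]] by (rule continuous_map_compose)
    then show ?thesis by simp
  qed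
  moreover have "inj_on f O'"
  proof (rule inj_onI)
    fix x y assume xy: "x \<in> O'" "y \<in> O'" "f x = f y"
    then have "chart_inv c' x = chart_inv c' y"
      using inW chart_homeo(2)[OF is_chart[OF c]] by (auto simp: f_def W_def inj_on_def)
    then show "x = y" using inW xy by metis
  qed
  ultimately have "open (f ` O')" by (intro invariance_of_domain)
  have q': "coord c' q \<in> O'" using q c' pos by (auto simp: O'_def W_def)
  have fq: "f (coord c' q) = coord c q"
    using chart_inv_coord[OF is_chart[OF c'(1)] c'(2)] by (simp add: f_def)
  then obtain e where e: "e > 0" "ball (coord c q) e \<subseteq> f ` O'"
    using \<open>open (f ` O')\<close> q' open_contains_ball by (metis imageI)
  show "\<forall>j\<in>corner c. 0 < coord c q $ j"
  proof
    fix j assume j: "j \<in> corner c"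
    \<comment> \<open>A step of \<open>e / 2\<close> against the j-th axis stays in the open image,
      hence in the model, so the coordinate was at least \<open>e / 2\<close>.\<close>
    define y where "y = coord c q - (e / 2) *\<^sub>R axis j 1"
    have "y \<in> ball (coord c q) e" using e(1) by (simp add: y_def dist_norm)
    then obtain x where x: "x \<in> O'" "y = f x" using e(2) by auto
    have "0 \<le> y $ j"
      using inW[OF x(1)] coord_nonneg[OF is_chart[OF c] _ j] x(2) by (auto simp: f_def W_def)
    then show "0 < coord c q $ j" using e(1) by (simp add: y_def)
  qed
qed

lemma Y_subset: "Y \<subseteq> topspace X"
  using chart_homeo(3) is_chart by (fastforce simp: mfd_interior_def depth_stratum_def)

lemma chart_exists:
  assumes "p \<in> topspace X"
  obtains c where "c \<in> A" "p \<in> chart_dom c"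
  using assms atlas unfolding smooth_atlas_def by blast

text \<open>Near an interior point the coordinate image is a full neighbourhood, so the derivative
  within it is the ordinary one, and the chosen \<open>frechet_derivative\<close> really is the
  derivative.\<close>

lemma transition_has_derivative:
  assumes c: "c \<in> A" "c' \<in> A" and q: "q \<in> chart_dom c \<inter> chart_dom c'" "q \<in> Y"
  shows "(transition c c' has_derivative transition_deriv c c' q) (at (coord c q))"
proof -
  define W where "W = chart_dom c \<inter> chart_dom c'"
  have W: "openin X W" using is_chart c by (auto simp: W_def is_chart_def)
  define O' where "O' = coord c ` W \<inter> {x. \<forall>j\<in>corner c. 0 < x $ j}"
  have "open O'" unfolding O'_def using is_chart[OF c(1)] W by (intro open_coord_image_positive) (auto simp: W_def)
  have qO: "coord c q \<in> O'" using q Y_iff[OF c(1), of q] by (auto simp: O'_def W_def)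
  have eq: "at (coord c q) within coord c ` W = at (coord c q)"
    using \<open>open O'\<close> qO by (intro at_within_interior) (auto simp: O'_def interior_def)
  have "smooth_map_on (coord c ` W) (transition c c')"
    using atlas c by (auto simp: smooth_atlas_def smoothly_compatible_def W_def)
  then obtain e G G' L where G: "e > 0" "\<And>y. y \<in> ball (coord c q) e \<Longrightarrow> (G has_derivative G' y) (at y)"
    "\<And>y. y \<in> ball (coord c q) e \<inter> coord c ` W \<Longrightarrow> G y = transition c c' y"
    using smooth_map_on_local_C1[of "coord c ` W" "transition c c'" "coord c q"] q(1)
    by (metis W_def imageI)
  have "(G has_derivative G' (coord c q)) (at (coord c q))" using G by simp
  then have "(transition c c' has_derivative G' (coord c q)) (at (coord c q))"
    by (rule has_derivative_transform_within_open[of _ _ _ _ "ball (coord c q) e \<inter> O'"])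
       (use G(1,3) \<open>open O'\<close> qO in \<open>auto simp: O'_def\<close>)
  then have "transition c c' differentiable (at (coord c q))" by (auto simp: differentiable_def)
  then show ?thesis unfolding W_def[symmetric] eq by (simp add: frechet_derivative_works)
qed

end

section \<open>Curves\<close>

definition C1_piece :: "('a, 'n::finite) corner_chart set \<Rightarrow> (real \<Rightarrow> 'a) \<Rightarrow> real \<Rightarrow> real \<Rightarrow> bool" where
  "C1_piece A \<gamma> a b \<longleftrightarrow> (\<exists>c\<in>A. \<gamma> ` {a..b} \<subseteq> chart_dom c \<and>
     (\<exists>D. continuous_on {a..b} D \<and>
        (\<forall>t\<in>{a..b}. ((coord c \<circ> \<gamma>) has_vector_derivative D t) (at t within {a..b}))))"

text \<open>An inductive substitute for numbered subdivisions: concatenation is a constructor, and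
  facts about curves follow by induction without index arithmetic.\<close>

inductive pw_C1 :: "('a, 'n::finite) corner_chart set \<Rightarrow> (real \<Rightarrow> 'a) \<Rightarrow> real \<Rightarrow> real \<Rightarrow> bool"
  for A \<gamma> where
  piece: "a < b \<Longrightarrow> C1_piece A \<gamma> a b \<Longrightarrow> pw_C1 A \<gamma> a b"
| join: "pw_C1 A \<gamma> a b \<Longrightarrow> pw_C1 A \<gamma> b c \<Longrightarrow> pw_C1 A \<gamma> a c"

lemma pw_C1_imp_subdivision:
  assumes "pw_C1 A \<gamma> a b"
  shows "\<exists>k s. s 0 = a \<and> s k = b \<and> (\<forall>i<k. s i < s (Suc i) \<and> C1_piece A \<gamma> (s i) (s (Suc i)))"
  using assms
proof induction
  case (piece a b)
  then show ?case by (intro exI[of _ 1] exI[of _ "\<lambda>i. if i = 0 then a else b"]) auto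
next
  case (join a b c)
  then obtain k s k' s' where
    s: "s 0 = a" "s k = b" "\<And>i. i < k \<Longrightarrow> s i < s (Suc i) \<and> C1_piece A \<gamma> (s i) (s (Suc i))"
    and s': "s' 0 = b" "s' k' = c" "\<And>i. i < k' \<Longrightarrow> s' i < s' (Suc i) \<and> C1_piece A \<gamma> (s' i) (s' (Suc i))"
    by blast
  define u where "u i = (if i \<le> k then s i else s' (i - k))" for i
  have "u i < u (Suc i) \<and> C1_piece A \<gamma> (u i) (u (Suc i))" if "i < k + k'" for i
  proof (cases "i < k")
    case True
    then show ?thesis using s(3) by (simp add: u_def)
  next
    case False
    have "u i = s' (i - k)" using False s(2) s'(1) by (auto simp: u_def)
    moreover have "u (Suc i) = s' (Suc (i - k))" using False by (simp add: u_def Suc_diff_le)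
    ultimately show ?thesis using s'(3)[of "i - k"] that False by auto
  qed
  moreover have "u 0 = a" "u (k + k') = c" using s s' by (auto simp: u_def)
  ultimately show ?case by blast
qed

text \<open>The first alternative accounts for the empty subdivision \<open>k = 0\<close>; on
  \<open>{0..1}\<close> it is excluded by \<open>0 \<noteq> 1\<close>.\<close>

lemma subdivision_imp_pw_C1:
  assumes "\<And>i. i < k \<Longrightarrow> s i < s (Suc i) \<and> C1_piece A \<gamma> (s i) (s (Suc i))"
  shows "s 0 = s k \<or> pw_C1 A \<gamma> (s 0) (s k)"
  using assms
proof (induction k)
  case (Suc k)
  have "pw_C1 A \<gamma> (s k) (s (Suc k))" using Suc.prems[of k] by (auto intro: pw_C1.piece)
  moreover have "s 0 = s k \<or> pw_C1 A \<gamma> (s 0) (s k)" using Suc by auto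
  ultimately show ?case by (auto intro: pw_C1.join)
qed simp

lemma piecewise_C1_curve_iff:
  "piecewise_C1_curve X A Y \<gamma> \<longleftrightarrow> pathin (subtopology X Y) \<gamma> \<and> pw_C1 A \<gamma> 0 1"
proof -
  have "(\<exists>(k::nat) s. s 0 = 0 \<and> s k = 1 \<and> (\<forall>i<k. s i < s (Suc i) \<and> C1_piece A \<gamma> (s i) (s (Suc i)))) \<longleftrightarrow> pw_C1 A \<gamma> 0 1"
    using pw_C1_imp_subdivision[of A \<gamma> 0 1] subdivision_imp_pw_C1[of _ _ A \<gamma>]
    by (metis zero_neq_one)
  then show ?thesis by (simp add: piecewise_C1_curve_def C1_piece_def)
qed

lemma pw_C1_less: "pw_C1 A \<gamma> a b \<Longrightarrow> a < b"
  by (induction rule: pw_C1.induct) auto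

lemma C1_piece_affine:
  assumes C: "C1_piece A \<gamma> a b" and k: "k \<noteq> 0" and ab: "u \<le> w" "(\<lambda>t. r + k * t) ` {u..w} = {a..b}"
    and eq: "\<And>t. t \<in> {u..w} \<Longrightarrow> \<gamma>' t = \<gamma> (r + k * t)"
  shows "C1_piece A \<gamma>' u w"
proof -
  obtain c D where c: "c \<in> A" "\<gamma> ` {a..b} \<subseteq> chart_dom c" "continuous_on {a..b} D"
    "\<And>t. t \<in> {a..b} \<Longrightarrow> ((coord c \<circ> \<gamma>) has_vector_derivative D t) (at t within {a..b})"
    using C unfolding C1_piece_def by blast
  have img: "r + k * t \<in> {a..b}" if "t \<in> {u..w}" for t using ab(2) that by blast
  have "((coord c \<circ> \<gamma>') has_vector_derivative k *\<^sub>R D (r + k * t)) (at t within {u..w})" if t: "t \<in> {u..w}" for t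
  proof -
    have "((\<lambda>t. r + k * t) has_vector_derivative k) (at t within {u..w})"
      by (auto intro!: derivative_eq_intros simp flip: has_real_derivative_iff_has_vector_derivative)
    moreover have "((coord c \<circ> \<gamma>) has_vector_derivative D (r + k * t)) (at (r + k * t) within (\<lambda>t. r + k * t) ` {u..w})"
      using c(4)[OF img[OF t]] ab(2) by simp
    ultimately have "(((coord c \<circ> \<gamma>) \<circ> (\<lambda>t. r + k * t)) has_vector_derivative k *\<^sub>R D (r + k * t)) (at t within {u..w})"
      by (rule vector_diff_chain_within)
    then show ?thesis
      by (rule has_vector_derivative_transform[OF t, rotated]) (simp add: eq)
  qed
  moreover have "continuous_on {u..w} (\<lambda>t. k *\<^sub>R D (r + k * t))"
    by (intro continuous_intros continuous_on_compose2[OF c(3)]) (use img in auto)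
  moreover have "\<gamma>' ` {u..w} \<subseteq> chart_dom c" using c(2) img eq by (force simp: image_subset_iff)
  ultimately show ?thesis using c(1) unfolding C1_piece_def by blast
qed

lemma pw_C1_affine_pos:
  assumes "pw_C1 A \<gamma> a b" "k > 0" "\<And>t. a \<le> r + k * t \<Longrightarrow> r + k * t \<le> b \<Longrightarrow> \<gamma>' t = \<gamma> (r + k * t)"
  shows "pw_C1 A \<gamma>' ((a - r) / k) ((b - r) / k)"
  using assms(1,3)
proof induction
  case (piece a b)
  have "C1_piece A \<gamma>' ((a - r) / k) ((b - r) / k)"
  proof (rule C1_piece_affine[OF piece(2), where r = r and k = k])
    show "(\<lambda>t. r + k * t) ` {(a - r) / k..(b - r) / k} = {a..b}"
    proof (intro set_eqI iffI)
      fix x assume "x \<in> {a..b}"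
      then show "x \<in> (\<lambda>t. r + k * t) ` {(a - r) / k..(b - r) / k}"
        using \<open>k > 0\<close> by (intro image_eqI[of _ _ "(x - r) / k"]) (auto simp: divide_right_mono)
    qed (use \<open>k > 0\<close> in \<open>auto simp: field_simps\<close>)
  qed (use piece \<open>k > 0\<close> in \<open>auto simp: field_simps\<close>)
  then show ?case using piece \<open>k > 0\<close> by (intro pw_C1.piece) (auto simp: divide_strict_right_mono)
next
  case (join a b c)
  note less = pw_C1_less[OF join(1)] pw_C1_less[OF join(2)]
  show ?case
    by (rule pw_C1.join[OF join.IH(1) join.IH(2)]; rule join.prems) (use less in linarith)+
qed

text \<open>Negative k reverses the order of times, so the two parts of a \<open>join\<close> change
  places. This case provides the reversed curve for the symmetry of the distance.\<close>

lemma pw_C1_affine_neg: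
  assumes "pw_C1 A \<gamma> a b" "k < 0" "\<And>t. a \<le> r + k * t \<Longrightarrow> r + k * t \<le> b \<Longrightarrow> \<gamma>' t = \<gamma> (r + k * t)"
  shows "pw_C1 A \<gamma>' ((b - r) / k) ((a - r) / k)"
  using assms(1,3)
proof induction
  case (piece a b)
  have "C1_piece A \<gamma>' ((b - r) / k) ((a - r) / k)"
  proof (rule C1_piece_affine[OF piece(2), where r = r and k = k])
    show "(\<lambda>t. r + k * t) ` {(b - r) / k..(a - r) / k} = {a..b}"
    proof (intro set_eqI iffI)
      fix x assume "x \<in> {a..b}"
      then show "x \<in> (\<lambda>t. r + k * t) ` {(b - r) / k..(a - r) / k}"
        using \<open>k < 0\<close> by (intro image_eqI[of _ _ "(x - r) / k"]) (auto simp: divide_right_mono_neg)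
    qed (use \<open>k < 0\<close> in \<open>auto simp: field_simps\<close>)
  qed (use piece \<open>k < 0\<close> in \<open>auto simp: field_simps\<close>)
  then show ?case using piece \<open>k < 0\<close> by (intro pw_C1.piece) (auto simp: divide_strict_right_mono_neg)
next
  case (join a b c)
  note less = pw_C1_less[OF join(1)] pw_C1_less[OF join(2)]
  show ?case
    by (rule pw_C1.join[OF join.IH(2) join.IH(1)]; rule join.prems) (use less in linarith)+
qed

abbreviation chart_differentiable :: "('a, 'n::finite) corner_chart set \<Rightarrow> (real \<Rightarrow> 'a) \<Rightarrow> real \<Rightarrow> bool" where
  "chart_differentiable A \<gamma> t \<equiv>
     \<exists>c\<in>A. \<gamma> t \<in> chart_dom c \<and> (\<exists>v. ((coord c \<circ> \<gamma>) has_vector_derivative v) (at t))"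

lemma pw_C1_differentiable:
  assumes "pw_C1 A \<gamma> a b"
  shows "\<exists>S. finite S \<and> (\<forall>t\<in>{a..b} - S. a < t \<and> t < b \<and> chart_differentiable A \<gamma> t)"
  using assms
proof induction
  case (piece a b)
  then obtain c D where c: "c \<in> A" "\<gamma> ` {a..b} \<subseteq> chart_dom c"
    "\<And>t. t \<in> {a..b} \<Longrightarrow> ((coord c \<circ> \<gamma>) has_vector_derivative D t) (at t within {a..b})"
    unfolding C1_piece_def by blast
  have "a < t \<and> t < b \<and> \<gamma> t \<in> chart_dom c \<and> ((coord c \<circ> \<gamma>) has_vector_derivative D t) (at t)"
    if t: "t \<in> {a..b} - {a, b}" for t
  proof -
    have "a < t" "t < b" using t by auto
    then show ?thesis using c(2) c(3)[of t] by (auto simp: at_within_Icc_at)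
  qed
  moreover have "finite {a, b}" by simp
  ultimately show ?case using c(1) by blast
next
  case (join a b c)
  obtain S where S: "finite S"
    "\<forall>t\<in>{a..b} - S. a < t \<and> t < b \<and> chart_differentiable A \<gamma> t"
    using join.IH(1) by metis
  moreover obtain S' where S': "finite S'"
    "\<forall>t\<in>{b..c} - S'. b < t \<and> t < c \<and> chart_differentiable A \<gamma> t"
    using join.IH(2) by metis
  moreover have less: "a < b" "b < c" using join pw_C1_less by auto
  ultimately show ?case
  proof (intro exI[of _ "S \<union> S'"] conjI ballI)
    fix t assume t: "t \<in> {a..c} - (S \<union> S')"
    show "a < t" "t < c" "chart_differentiable A \<gamma> t"
      using S(2)[rule_format, of t] S'(2)[rule_format, of t] t less by (cases "t \<le> b"; force)+
  qed simp
qed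

section \<open>The Riemannian distance\<close>

lemma pathin_eventually:
  assumes "pathin (subtopology X Y) \<gamma>" "t \<in> {0<..<1}" "openin X W" "\<gamma> t \<in> W"
  shows "\<forall>\<^sub>F s in nhds t. \<gamma> s \<in> W"
proof -
  have "continuous_map (top_of_set {0..1}) X \<gamma>"
    using assms(1) by (simp add: pathin_def continuous_map_in_subtopology)
  then have "openin (top_of_set {0..1}) {s \<in> {0..1}. \<gamma> s \<in> W}"
    using openin_continuous_map_preimage[OF _ assms(3)] by fastforce
  then obtain T where T: "open T" "{s \<in> {0..1}. \<gamma> s \<in> W} = {0..1} \<inter> T" by (auto simp: openin_open)
  have "open (T \<inter> {0<..<1})" using T(1) by (simp add: open_Int)
  moreover have "t \<in> T \<inter> {0<..<1}" using T(2) assms by fastforce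
  moreover have "\<gamma> s \<in> W" if "s \<in> T \<inter> {0<..<1}" for s using T(2) that by fastforce
  ultimately show ?thesis unfolding eventually_nhds by blast
qed

lemma pathin_continuous_coord:
  assumes "pathin (subtopology X Y) \<gamma>" "is_chart X c" "{a..b} \<subseteq> {0..1}" "\<gamma> ` {a..b} \<subseteq> chart_dom c"
  shows "continuous_on {a..b} (coord c \<circ> \<gamma>)"
proof -
  have "continuous_map (top_of_set {0..1}) X \<gamma>"
    using assms(1) by (simp add: pathin_def continuous_map_in_subtopology)
  then have "continuous_map (top_of_set {a..b}) X \<gamma>"
    using assms(3) by (rule continuous_map_from_subtopology_mono)
  then have "continuous_map (top_of_set {a..b}) (subtopology X (chart_dom c)) \<gamma>"
    using assms(4) by (auto simp: continuous_map_in_subtopology)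
  then have "continuous_map (top_of_set {a..b}) euclidean (coord c \<circ> \<gamma>)"
    using continuous_map_coord[OF assms(2)] by (rule continuous_map_compose)
  then show ?thesis by simp
qed

text \<open>The product metric is singular at the boundary and in general no instance of
  \<open>riemannian_metric\<close>. The two properties kept here make lengths of interior curves
  independent of charts and homogeneous under reparametrization.\<close>

locale corner_tensor = corner_atlas X A
  for X :: "'a topology" and A :: "('a, 'n::finite) corner_chart set" +
  fixes g :: "('a, 'n) tensor2"
  assumes bilinear: "\<And>c p. c \<in> A \<Longrightarrow> p \<in> chart_dom c \<Longrightarrow> bilinear (g c p)"
    and invariant: "\<And>c c' p v. c \<in> A \<Longrightarrow> c' \<in> A \<Longrightarrow> p \<in> chart_dom c \<inter> chart_dom c' \<Longrightarrow> p \<in> Y \<Longrightarrow>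
      g c p v v = g c' p (transition_deriv c c' p v) (transition_deriv c c' p v)"
begin

abbreviation "d \<equiv> riemannian_dist X A Y g"

text \<open>The chain rule through the transition map. Continuity of \<gamma> at t is expressed by
  \<open>ev\<close>, so that the rule also applies to reparametrized pieces on intervals other than
  \<open>{0..1}\<close>.\<close>

lemma coord_has_vector_derivative_transition:
  assumes c: "c \<in> A" "c' \<in> A" and t: "\<gamma> t \<in> chart_dom c \<inter> chart_dom c'" "\<gamma> t \<in> Y"
    and ev: "\<And>W. openin X W \<Longrightarrow> \<gamma> t \<in> W \<Longrightarrow> \<forall>\<^sub>F s in nhds t. \<gamma> s \<in> W"
    and v: "((coord c \<circ> \<gamma>) has_vector_derivative v) (at t)"
  shows "((coord c' \<circ> \<gamma>) has_vector_derivative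
    transition_deriv c c' (\<gamma> t) v) (at t)"
proof -
  define D where "D = transition_deriv c c' (\<gamma> t)"
  have D: "(transition c c' has_derivative D) (at ((coord c \<circ> \<gamma>) t))"
    using transition_has_derivative[OF c t] by (simp add: D_def)
  have lin: "D (h *\<^sub>R v) = h *\<^sub>R D v" for h using has_derivative_linear[OF D] by (simp add: linear_cmul)
  have "((transition c c' \<circ> (coord c \<circ> \<gamma>)) has_derivative (D \<circ> (\<lambda>h. h *\<^sub>R v))) (at t)"
    using v D by (intro diff_chain_at) (auto simp: has_vector_derivative_def)
  then have "((transition c c' \<circ> (coord c \<circ> \<gamma>)) has_vector_derivative D v) (at t)"
    by (simp add: has_vector_derivative_def o_def lin)
  moreover have "\<forall>\<^sub>F s in nhds t. \<gamma> s \<in> chart_dom c"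
    using is_chart[OF c(1)] t(1) by (intro ev) (auto simp: is_chart_def)
  then have "\<forall>\<^sub>F s in nhds t. (transition c c' \<circ> (coord c \<circ> \<gamma>)) s = (coord c' \<circ> \<gamma>) s"
    by eventually_elim (simp add: transition_def chart_inv_coord[OF is_chart[OF c(1)]])
  ultimately show ?thesis unfolding D_def[symmetric]
    by (subst (asm) has_vector_derivative_cong_ev[where S = UNIV]) (auto elim: eventually_nhds_x_imp_x dest: eventually_nhds_x_imp_x)
qed

text \<open>Removes the choice operator of \<open>speed\<close>: the chart may jump with t, but the
  transformation law makes the value the same in every chart.\<close>

lemma speed_eq:
  assumes c: "c \<in> A" and t: "\<gamma> t \<in> chart_dom c" "\<gamma> t \<in> Y"
    and ev: "\<And>W. openin X W \<Longrightarrow> \<gamma> t \<in> W \<Longrightarrow> \<forall>\<^sub>F s in nhds t. \<gamma> s \<in> W"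
    and v: "((coord c \<circ> \<gamma>) has_vector_derivative v) (at t)"
  shows "speed A g \<gamma> t = sqrt (g c (\<gamma> t) v v)"
proof -
  define c' where "c' = (SOME c. c \<in> A \<and> \<gamma> t \<in> chart_dom c)"
  have c': "c' \<in> A \<and> \<gamma> t \<in> chart_dom c'" unfolding c'_def
    by (rule someI[of "\<lambda>c. c \<in> A \<and> \<gamma> t \<in> chart_dom c" c]) (simp add: c t)
  then have "vector_derivative (coord c' \<circ> \<gamma>) (at t) =
     transition_deriv c c' (\<gamma> t) v"
    using c t v ev by (intro vector_derivative_at coord_has_vector_derivative_transition) auto
  then show ?thesis
    using invariant[of c c' "\<gamma> t" v] c t c' by (simp add: speed_def c'_def[symmetric])
qed

abbreviation regular_at :: "('a, 'n) corner_chart \<Rightarrow> (real \<Rightarrow> 'a) \<Rightarrow> real \<Rightarrow> bool" where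
  "regular_at c \<gamma> t \<equiv> ((coord c \<circ> \<gamma>) has_vector_derivative vector_derivative (coord c \<circ> \<gamma>) (at t)) (at t) \<and>
      speed A g \<gamma> t = sqrt (g c (\<gamma> t) (vector_derivative (coord c \<circ> \<gamma>) (at t)) (vector_derivative (coord c \<circ> \<gamma>) (at t)))"

text \<open>One finite set of exceptional times serves for all charts simultaneously, since
  differentiability passes from one chart to any other around the same point.\<close>

lemma curve_differentiable:
  assumes "piecewise_C1_curve X A Y \<gamma>"
  obtains S where "finite S" "{0, 1} \<subseteq> S"
    and "\<And>t c. t \<in> {0..1} - S \<Longrightarrow> c \<in> A \<Longrightarrow> \<gamma> t \<in> chart_dom c \<Longrightarrow> regular_at c \<gamma> t"
proof -
  have path: "pathin (subtopology X Y) \<gamma>" and "pw_C1 A \<gamma> 0 1"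
    using assms by (auto simp: piecewise_C1_curve_iff)
  from pw_C1_differentiable[OF this(2)] obtain S where S: "finite S"
    "\<forall>t\<in>{0..1} - S. 0 < t \<and> t < 1 \<and> chart_differentiable A \<gamma> t"
    by metis
  show thesis
  proof
    show "finite (S \<union> {0, 1})" "{0, 1} \<subseteq> S \<union> {0, 1}" using S by auto
    fix t c assume t: "t \<in> {0..1} - (S \<union> {0, 1})" and c: "c \<in> A" "\<gamma> t \<in> chart_dom c"
    have t01: "t \<in> {0<..<1}" using t by auto
    then have tY: "\<gamma> t \<in> Y"
      using path by (auto simp: pathin_def continuous_map_in_subtopology)
    note ev = pathin_eventually[OF path t01]
    obtain c1 v where c1: "c1 \<in> A" "\<gamma> t \<in> chart_dom c1" "((coord c1 \<circ> \<gamma>) has_vector_derivative v) (at t)"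
      using S(2) t by blast
    have "\<exists>w. ((coord c \<circ> \<gamma>) has_vector_derivative w) (at t)"
      using coord_has_vector_derivative_transition[OF c1(1) c(1) _ tY ev c1(3)] c1 c by blast
    then have "((coord c \<circ> \<gamma>) has_vector_derivative vector_derivative (coord c \<circ> \<gamma>) (at t)) (at t)"
      by (metis vector_derivative_at)
    then show "regular_at c \<gamma> t"
      using speed_eq[OF c tY ev] by blast
  qed
qed

lemma curve_in_Y: "piecewise_C1_curve X A Y \<gamma> \<Longrightarrow> t \<in> {0..1} \<Longrightarrow> \<gamma> t \<in> Y"
  by (auto simp: piecewise_C1_curve_def pathin_def continuous_map_in_subtopology)

text \<open>The calibration principle: the derivative of \<Phi> along the curve is at most the
  speed, so integrating it bounds the length from below.\<close>

lemma curve_length_ge: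
  assumes \<gamma>: "piecewise_C1_curve X A Y \<gamma>" and ab: "0 \<le> a" "a \<le> b" "b \<le> 1"
    and c: "c \<in> A" "\<gamma> ` {a..b} \<subseteq> chart_dom c"
    and \<Phi>: "\<And>t. t \<in> {a..b} \<Longrightarrow> (\<Phi> has_derivative \<Phi>' t) (at (coord c (\<gamma> t)))"
    and le: "\<And>t v. t \<in> {a..b} \<Longrightarrow> \<bar>\<Phi>' t v\<bar> \<le> sqrt (g c (\<gamma> t) v v)"
  shows "ennreal \<bar>\<Phi> (coord c (\<gamma> b)) - \<Phi> (coord c (\<gamma> a))\<bar> \<le> curve_length A g \<gamma>"
proof -
  obtain S where S: "finite S" "\<And>t. t \<in> {0..1} - S \<Longrightarrow> \<gamma> t \<in> chart_dom c \<Longrightarrow> regular_at c \<gamma> t"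
    using curve_differentiable[OF \<gamma>] c(1) by metis
  define h where "h = \<Phi> \<circ> (coord c \<circ> \<gamma>)"
  define h' where "h' t = \<Phi>' t (vector_derivative (coord c \<circ> \<gamma>) (at t))" for t
  have cc: "continuous_on {a..b} (coord c \<circ> \<gamma>)"
    using \<gamma> ab c is_chart by (intro pathin_continuous_coord[where X = X and Y = Y]) (auto simp: piecewise_C1_curve_def)
  have "continuous_on {a..b} h"
    unfolding h_def continuous_on_eq_continuous_within
  proof
    fix t assume t: "t \<in> {a..b}"
    have "continuous (at ((coord c \<circ> \<gamma>) t) within (coord c \<circ> \<gamma>) ` {a..b}) \<Phi>"
      using has_derivative_continuous[OF \<Phi>[OF t]] by (simp add: continuous_at_imp_continuous_at_within)
    then show "continuous (at t within {a..b}) (\<Phi> \<circ> (coord c \<circ> \<gamma>))"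
      using cc[unfolded continuous_on_eq_continuous_within, rule_format, OF t]
      by (rule continuous_within_compose[rotated])
  qed
  moreover have "(h has_real_derivative h' t) (at t)" if t: "t \<in> {a<..<b} - S" for t
  proof -
    have v: "((coord c \<circ> \<gamma>) has_derivative (\<lambda>h. h *\<^sub>R vector_derivative (coord c \<circ> \<gamma>) (at t))) (at t)"
      using S(2)[of t] t ab c(2) by (auto simp: has_vector_derivative_def image_subset_iff)
    have \<Phi>t: "(\<Phi> has_derivative \<Phi>' t) (at ((coord c \<circ> \<gamma>) t))" using \<Phi>[of t] t by simp
    have "(h has_derivative (\<Phi>' t \<circ> (\<lambda>h. h *\<^sub>R vector_derivative (coord c \<circ> \<gamma>) (at t)))) (at t)"
      unfolding h_def using v \<Phi>t by (rule diff_chain_at)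
    moreover have "\<Phi>' t (s *\<^sub>R vector_derivative (coord c \<circ> \<gamma>) (at t)) = h' t * s" for s
      using has_derivative_linear[OF \<Phi>t] by (simp add: linear_cmul h'_def)
    ultimately show ?thesis by (simp add: has_field_derivative_def o_def)
  qed
  moreover have "\<bar>h' t\<bar> \<le> speed A g \<gamma> t" if t: "t \<in> {a<..<b} - S" for t
    using S(2)[of t] t ab c(2) le[of t] by (auto simp: h'_def image_subset_iff)
  ultimately have "ennreal \<bar>h b - h a\<bar> \<le> (\<integral>\<^sup>+t\<in>{a..b}. ennreal (speed A g \<gamma> t) \<partial>lborel)"
    using ab S(1) by (intro abs_diff_le_nn_integral_deriv_bound[where S = S and h' = h']) auto
  also have "\<dots> \<le> curve_length A g \<gamma>"
    unfolding curve_length_def using ab by (intro nn_integral_mono) (auto simp: indicator_def)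
  finally show ?thesis by (simp add: h_def)
qed

text \<open>The explicit curves behind the upper bounds are straight segments in coordinates; their
  velocity is the constant v, so only the base point of g varies in the integrand.\<close>

lemma dist_segment_le:
  assumes c: "c \<in> A"
    and seg: "\<And>t. t \<in> {0..1} \<Longrightarrow> x + t *\<^sub>R v \<in> coord c ` chart_dom c"
    and pos: "\<And>t j. t \<in> {0..1} \<Longrightarrow> j \<in> corner c \<Longrightarrow> 0 < (x + t *\<^sub>R v) $ j"
  shows "d (chart_inv c x) (chart_inv c (x + v)) \<le>
    (\<integral>\<^sup>+t\<in>{0..1}. ennreal (sqrt (g c (chart_inv c (x + t *\<^sub>R v)) v v)) \<partial>lborel)"
proof -
  note chart = is_chart[OF c]
  define \<gamma> where "\<gamma> t = chart_inv c (x + t *\<^sub>R v)" for t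
  have \<gamma>: "\<gamma> t \<in> chart_dom c" "coord c (\<gamma> t) = x + t *\<^sub>R v" if "t \<in> {0..1}" for t
    using chart_inv_in_dom[OF chart seg[OF that]] by (auto simp: \<gamma>_def)
  have \<gamma>Y: "\<gamma> t \<in> Y" if "t \<in> {0..1}" for t
    using Y_iff[OF c \<gamma>(1)[OF that]] pos[OF that] \<gamma>(2)[OF that] by auto
  have "continuous_map (top_of_set {0..1}) (top_of_set (coord c ` chart_dom c)) (\<lambda>t. x + t *\<^sub>R v)"
    using seg by (auto intro!: continuous_intros)
  then have "continuous_map (top_of_set {0..1}) X (chart_inv c \<circ> (\<lambda>t. x + t *\<^sub>R v))"
    using continuous_map_chart_inv[OF chart] by (rule continuous_map_compose)
  then have path: "pathin (subtopology X Y) \<gamma>"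
    using \<gamma>Y unfolding pathin_def continuous_map_in_subtopology
    by (auto simp: \<gamma>_def[abs_def] o_def)
  have lin: "((\<lambda>t. x + t *\<^sub>R v) has_vector_derivative v) (at t within T)" for t T
    by (auto intro!: derivative_eq_intros)
  have "((coord c \<circ> \<gamma>) has_vector_derivative v) (at t within {0..1})" if "t \<in> {0..1}" for t
    by (rule has_vector_derivative_transform[OF that _ lin]) (simp add: \<gamma>)
  then have "C1_piece A \<gamma> 0 1"
    unfolding C1_piece_def using c \<gamma>(1) by (intro bexI[of _ c] conjI exI[of _ "\<lambda>_. v"]) auto
  then have pw: "piecewise_C1_curve X A Y \<gamma>"
    using path by (auto simp: piecewise_C1_curve_iff intro: pw_C1.piece)
  have "curve_length A g \<gamma> = (\<integral>\<^sup>+t\<in>{0..1}. ennreal (sqrt (g c (\<gamma> t) v v)) \<partial>lborel)"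
    unfolding curve_length_def
  proof (rule nn_integral_cong_AE)
    \<comment> \<open>At the end points the two-sided derivative in \<open>speed\<close> is not
      determined by the segment, but two points have measure zero.\<close>
    have "AE t in lborel. t \<notin> {0, 1::real}" by (intro AE_not_in) (auto intro: finite_imp_null_set_lborel)
    then show "AE t in lborel. ennreal (speed A g \<gamma> t) * indicator {0..1} t = ennreal (sqrt (g c (\<gamma> t) v v)) * indicator {0..1} t"
    proof eventually_elim
      case (elim t)
      show ?case
      proof (cases "t \<in> {0..1}")
        case True
        then have t: "t \<in> {0<..<1}" using elim by auto
        have "((coord c \<circ> \<gamma>) has_vector_derivative v) (at t)"
          by (rule has_vector_derivative_transform_within_open[OF lin _ t]) (auto simp: \<gamma>)
        then have "speed A g \<gamma> t = sqrt (g c (\<gamma> t) v v)"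
          using True by (intro speed_eq c \<gamma> \<gamma>Y pathin_eventually[OF path t])
        then show ?thesis by simp
      qed simp
    qed
  qed
  moreover have "d (chart_inv c x) (chart_inv c (x + v)) \<le> curve_length A g \<gamma>"
    unfolding riemannian_dist_def using pw by (intro INF_lower) (auto simp: \<gamma>_def)
  ultimately show ?thesis by (simp add: \<gamma>_def)
qed

text \<open>The constant curve is the segment with \<open>v = 0\<close>.\<close>

lemma riemannian_dist_self:
  assumes "p \<in> Y"
  shows "d p p = 0"
proof -
  obtain c where c: "c \<in> A" "p \<in> chart_dom c" using chart_exists assms Y_subset by blast
  have "d (chart_inv c (coord c p)) (chart_inv c (coord c p + 0)) \<le>
    (\<integral>\<^sup>+t\<in>{0..1}. ennreal (sqrt (g c (chart_inv c (coord c p + t *\<^sub>R 0)) 0 0)) \<partial>lborel)"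
    using c Y_iff[OF c] assms by (intro dist_segment_le) auto
  moreover have "g c p 0 0 = 0" using bilinear[OF c] by (simp add: bilinear_lzero)
  ultimately show ?thesis by (simp add: chart_inv_coord[OF is_chart[OF c(1)] c(2)])
qed

text \<open>An affine change of parameter multiplies the speed by \<open>\<bar>k\<bar>\<close>. The
  interval \<open>{u..w}\<close> is free because the rule serves the reversed curve, with
  \<open>k = -1\<close>, and the two halves of a concatenation, with \<open>k = 2\<close>.\<close>

lemma length_reparametrization_le:
  assumes \<gamma>: "piecewise_C1_curve X A Y \<gamma>" and k: "k \<noteq> 0" and "u < w"
    and img: "\<And>t. t \<in> {u..w} \<Longrightarrow> r + k * t \<in> {0..1} \<and> \<gamma>' t = \<gamma> (r + k * t)"
  shows "(\<integral>\<^sup>+t\<in>{u..w}. ennreal (speed A g \<gamma>' t) \<partial>lborel) \<le> curve_length A g \<gamma>"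
proof -
  obtain S where S: "finite S" "{0, 1} \<subseteq> S" "\<And>t c. t \<in> {0..1} - S \<Longrightarrow> c \<in> A \<Longrightarrow> \<gamma> t \<in> chart_dom c \<Longrightarrow> regular_at c \<gamma> t"
    using curve_differentiable[OF \<gamma>] by metis
  have path: "pathin (subtopology X Y) \<gamma>" using \<gamma> by (simp add: piecewise_C1_curve_def)
  \<comment> \<open>End points and the parameters sent to exceptional times of \<gamma>: a finite,
    hence null, set.\<close>
  define E where "E = {u, w} \<union> (\<lambda>s. (s - r) / k) ` S"
  have "finite E" using S(1) by (simp add: E_def)
  have speed: "speed A g \<gamma>' t = \<bar>k\<bar> * speed A g \<gamma> (r + k * t)" if t: "t \<in> {u..w} - E" for t
  proof -
    define s where "s = r + k * t"
    have s: "s \<in> {0..1} - S" using img[of t] t k by (force simp: E_def s_def image_iff)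
    then have s01: "s \<in> {0<..<1}" using S(2) by (cases "s = 0"; cases "s = 1") auto
    have sY: "\<gamma> s \<in> Y" using curve_in_Y[OF \<gamma>] s by auto
    then obtain c where c: "c \<in> A" "\<gamma> s \<in> chart_dom c" using chart_exists Y_subset by blast
    define v where "v = vector_derivative (coord c \<circ> \<gamma>) (at s)"
    have v: "((coord c \<circ> \<gamma>) has_vector_derivative v) (at s)" and sp: "speed A g \<gamma> s = sqrt (g c (\<gamma> s) v v)"
      using S(3)[OF s c] by (auto simp: v_def)
    have t': "t \<in> {u<..<w}" using t by (auto simp: E_def)
    have "((\<lambda>t. r + k * t) has_vector_derivative k) (at t)"
      by (auto intro!: derivative_eq_intros simp flip: has_real_derivative_iff_has_vector_derivative)
    then have "(((coord c \<circ> \<gamma>) \<circ> (\<lambda>t. r + k * t)) has_vector_derivative k *\<^sub>R v) (at t)"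
      using v by (intro vector_diff_chain_at) (auto simp: s_def)
    then have v': "((coord c \<circ> \<gamma>') has_vector_derivative k *\<^sub>R v) (at t)"
      by (rule has_vector_derivative_transform_within_open[OF _ _ t']) (auto simp: img)
    have gt: "\<gamma>' t = \<gamma> s" using img[of t] t by (simp add: s_def)
    have "\<forall>\<^sub>F t in nhds t. \<gamma>' t \<in> W" if W: "openin X W" "\<gamma>' t \<in> W" for W
    proof -
      have "\<forall>\<^sub>F s in nhds s. \<gamma> s \<in> W" using pathin_eventually[OF path s01 W(1)] W(2) gt by simp
      moreover have "filterlim (\<lambda>t. r + k * t) (nhds s) (nhds t)"
        unfolding s_def by (intro tendsto_intros filterlim_ident)
      ultimately have "\<forall>\<^sub>F t in nhds t. \<gamma> (r + k * t) \<in> W"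
        by (rule eventually_compose_filterlim)
      moreover have "\<forall>\<^sub>F t in nhds t. t \<in> {u<..<w}"
        using t' by (intro eventually_nhds_in_open) auto
      ultimately show ?thesis by eventually_elim (simp add: img)
    qed
    then have "speed A g \<gamma>' t = sqrt (g c (\<gamma>' t) (k *\<^sub>R v) (k *\<^sub>R v))"
      using c sY gt v' by (intro speed_eq) auto
    also have "g c (\<gamma>' t) (k *\<^sub>R v) (k *\<^sub>R v) = k\<^sup>2 * g c (\<gamma> s) v v"
      using bilinear[OF c] by (simp add: gt bilinear_lmul bilinear_rmul power2_eq_square)
    finally show ?thesis unfolding s_def[symmetric] sp by (simp add: real_sqrt_mult)
  qed
  have "(\<integral>\<^sup>+t\<in>{u..w}. ennreal (speed A g \<gamma>' t) \<partial>lborel) \<le>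
     (\<integral>\<^sup>+t. ennreal \<bar>k\<bar> * (ennreal (speed A g \<gamma> (r + k * t)) * indicator {0..1} (r + k * t)) \<partial>lborel)"
  proof (rule nn_integral_mono_AE)
    have "AE t in lborel. t \<notin> E" using \<open>finite E\<close> by (intro AE_not_in) (auto intro: finite_imp_null_set_lborel)
    then show "AE t in lborel. ennreal (speed A g \<gamma>' t) * indicator {u..w} t \<le>
      ennreal \<bar>k\<bar> * (ennreal (speed A g \<gamma> (r + k * t)) * indicator {0..1} (r + k * t))"
      by eventually_elim (use img speed in \<open>auto simp: indicator_def ennreal_mult'\<close>)
  qed
  also have "\<dots> \<le> ennreal \<bar>k\<bar> * (\<integral>\<^sup>+t. ennreal (speed A g \<gamma> (r + k * t)) * indicator {0..1} (r + k * t) \<partial>lborel)"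
    using k by (intro nn_integral_cmult_le) simp
  also have "\<dots> = curve_length A g \<gamma>"
    unfolding curve_length_def by (rule nn_integral_affine_any[OF k, symmetric])
  finally show ?thesis .
qed

lemma riemannian_dist_le_sym: "d q p \<le> d p q"
  unfolding riemannian_dist_def[of X A Y g p q]
proof (rule INF_greatest, clarify)
  fix \<gamma> assume \<gamma>: "piecewise_C1_curve X A Y \<gamma>" "p = \<gamma> 0" "q = \<gamma> 1"
  define \<gamma>' where "\<gamma>' t = \<gamma> (1 - t)" for t
  have "continuous_map (top_of_set {0..1}) (top_of_set {0..1}) (\<lambda>t::real. 1 - t)"
    by (auto intro!: continuous_intros)
  moreover have "continuous_map (top_of_set {0..1}) (subtopology X Y) \<gamma>"
    using \<gamma>(1) by (simp add: pathin_def piecewise_C1_curve_iff)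
  ultimately have "pathin (subtopology X Y) (\<gamma> \<circ> (\<lambda>t. 1 - t))"
    unfolding pathin_def by (rule continuous_map_compose)
  then have path: "pathin (subtopology X Y) \<gamma>'" by (simp add: \<gamma>'_def[abs_def] o_def)
  have "pw_C1 A \<gamma>' ((1 - 1) / (-1)) ((0 - 1) / (-1))"
    using \<gamma>(1) by (intro pw_C1_affine_neg[where \<gamma> = \<gamma>]) (auto simp: piecewise_C1_curve_iff \<gamma>'_def)
  then have pw: "piecewise_C1_curve X A Y \<gamma>'" using path by (simp add: piecewise_C1_curve_iff)
  have "d q p \<le> curve_length A g \<gamma>'"
    unfolding riemannian_dist_def using pw by (intro INF_lower) (auto simp: \<gamma>'_def \<gamma>)
  also have "\<dots> \<le> curve_length A g \<gamma>"
    unfolding curve_length_def[of A g \<gamma>']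
    by (rule length_reparametrization_le[OF \<gamma>(1), where k = "-1" and r = 1]) (auto simp: \<gamma>'_def)
  finally show "d (\<gamma> 1) (\<gamma> 0) \<le> curve_length A g \<gamma>" by (simp add: \<gamma>)
qed

lemma riemannian_dist_sym: "d p q = d q p"
  using riemannian_dist_le_sym by (simp add: antisym)

lemma riemannian_dist_concat:
  assumes 1: "piecewise_C1_curve X A Y \<gamma>1" and 2: "piecewise_C1_curve X A Y \<gamma>2" and eq: "\<gamma>1 1 = \<gamma>2 0"
  shows "d (\<gamma>1 0) (\<gamma>2 1) \<le> curve_length A g \<gamma>1 + curve_length A g \<gamma>2"
proof -
  define \<gamma> where "\<gamma> t = (if t \<le> 1/2 then \<gamma>1 (2 * t) else \<gamma>2 (2 * t - 1))" for t
  have \<gamma>2: "\<gamma> t = \<gamma>2 (2 * t - 1)" if "t \<ge> 1/2" for t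
  proof (cases "t = 1/2")
    case True
    show ?thesis unfolding True \<gamma>_def using eq by simp
  qed (use that in \<open>simp add: \<gamma>_def\<close>)
  have c1: "continuous_map (top_of_set {0..1}) (subtopology X Y) \<gamma>1"
    and c2: "continuous_map (top_of_set {0..1}) (subtopology X Y) \<gamma>2"
    using 1 2 by (auto simp: piecewise_C1_curve_def pathin_def)
  have sub: "subtopology (top_of_set {0..1::real}) {t \<in> topspace (top_of_set {0..1}). P t} = top_of_set ({0..1} \<inter> {t. P t})" for P
    unfolding subtopology_subtopology by (rule arg_cong[where f = top_of_set]) auto
  have path: "pathin (subtopology X Y) \<gamma>"
    unfolding pathin_def \<gamma>_def
  proof (rule continuous_map_cases_le)
    show "continuous_map (top_of_set {0..1}) euclideanreal (\<lambda>t. t)" "continuous_map (top_of_set {0..1}) euclideanreal (\<lambda>t. 1/2)"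
      by auto
    have "continuous_map (top_of_set ({0..1} \<inter> {t. t \<le> 1/2})) (top_of_set {0..1}) (\<lambda>t::real. 2 * t)"
      by (auto intro!: continuous_intros)
    from continuous_map_compose[OF this c1]
    show "continuous_map (subtopology (top_of_set {0..1}) {t \<in> topspace (top_of_set {0..1}). t \<le> 1/2}) (subtopology X Y) (\<lambda>t. \<gamma>1 (2 * t))"
      unfolding sub by (simp add: o_def)
    have "continuous_map (top_of_set ({0..1} \<inter> {t. 1/2 \<le> t})) (top_of_set {0..1}) (\<lambda>t::real. 2 * t - 1)"
      by (auto intro!: continuous_intros)
    from continuous_map_compose[OF this c2]
    show "continuous_map (subtopology (top_of_set {0..1}) {t \<in> topspace (top_of_set {0..1}). 1/2 \<le> t}) (subtopology X Y) (\<lambda>t. \<gamma>2 (2 * t - 1))"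
      unfolding sub by (simp add: o_def)
    show "\<gamma>1 (2 * t) = \<gamma>2 (2 * t - 1)" if "t = 1/2" for t unfolding that using eq by simp
  qed
  have "pw_C1 A \<gamma> ((0 - 0) / 2) ((1 - 0) / 2)"
    using 1 by (intro pw_C1_affine_pos[where \<gamma> = \<gamma>1]) (auto simp: piecewise_C1_curve_iff \<gamma>_def)
  moreover have "pw_C1 A \<gamma> ((0 - (-1)) / 2) ((1 - (-1)) / 2)"
    using 2 by (intro pw_C1_affine_pos[where \<gamma> = \<gamma>2]) (auto simp: piecewise_C1_curve_iff \<gamma>2)
  ultimately have "pw_C1 A \<gamma> 0 1" by (auto intro: pw_C1.join)
  then have pw: "piecewise_C1_curve X A Y \<gamma>" using path by (simp add: piecewise_C1_curve_iff)
  have "d (\<gamma>1 0) (\<gamma>2 1) \<le> curve_length A g \<gamma>"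
    unfolding riemannian_dist_def using pw by (intro INF_lower) (auto simp: \<gamma>_def)
  \<comment> \<open>Speeds need not be measurable, so the length is split by subadditivity over the
    two closed halves, which share the time 1/2.\<close>
  also have "\<dots> = (\<integral>\<^sup>+t\<in>{0..1/2} \<union> {1/2..1}. ennreal (speed A g \<gamma> t) \<partial>lborel)"
    unfolding curve_length_def by (simp add: ivl_disj_un_two_touch)
  also have "\<dots> \<le> (\<integral>\<^sup>+t\<in>{0..1/2}. ennreal (speed A g \<gamma> t) \<partial>lborel) + (\<integral>\<^sup>+t\<in>{1/2..1}. ennreal (speed A g \<gamma> t) \<partial>lborel)"
    by (rule nn_integral_Un_le) auto
  also have "\<dots> \<le> curve_length A g \<gamma>1 + curve_length A g \<gamma>2"
  proof (rule add_mono)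
    show "(\<integral>\<^sup>+t\<in>{0..1/2}. ennreal (speed A g \<gamma> t) \<partial>lborel) \<le> curve_length A g \<gamma>1"
      by (rule length_reparametrization_le[OF 1, where k = 2 and r = 0]) (auto simp: \<gamma>_def)
    show "(\<integral>\<^sup>+t\<in>{1/2..1}. ennreal (speed A g \<gamma> t) \<partial>lborel) \<le> curve_length A g \<gamma>2"
      by (rule length_reparametrization_le[OF 2, where k = 2 and r = "-1"]) (auto simp: \<gamma>2)
  qed
  finally show ?thesis .
qed

lemma riemannian_dist_triangle: "d p r \<le> d p q + d q r"
proof (rule ennreal_le_epsilon)
  fix e :: real assume fin: "d p q + d q r < top" and "e > 0"
  have "d p q < d p q + ennreal (e/2)" "d q r < d q r + ennreal (e/2)"
    using fin \<open>e > 0\<close> ennreal_add_left_cancel_less[of _ 0] by (auto simp: less_top)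
  then obtain \<gamma>1 \<gamma>2 where
    1: "piecewise_C1_curve X A Y \<gamma>1" "\<gamma>1 0 = p" "\<gamma>1 1 = q" "curve_length A g \<gamma>1 < d p q + ennreal (e/2)"
    and 2: "piecewise_C1_curve X A Y \<gamma>2" "\<gamma>2 0 = q" "\<gamma>2 1 = r" "curve_length A g \<gamma>2 < d q r + ennreal (e/2)"
    unfolding riemannian_dist_def[of X A Y g p q] riemannian_dist_def[of X A Y g q r] INF_less_iff by blast
  have "d p r \<le> curve_length A g \<gamma>1 + curve_length A g \<gamma>2"
    using riemannian_dist_concat[OF 1(1) 2(1)] 1 2 by simp
  also have "\<dots> \<le> (d p q + ennreal (e/2)) + (d q r + ennreal (e/2))"
    using 1(4) 2(4) by (intro add_mono) auto
  also have "\<dots> = d p q + d q r + ennreal e"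
    using \<open>e > 0\<close> by (simp add: ac_simps flip: ennreal_plus)
  finally show "d p r \<le> d p q + d q r + ennreal e" .
qed

end

section \<open>Completion\<close>

text \<open>Values may be infinite, for instance between components, so finiteness has to be carried
  along wherever distances are subtracted or turned into reals.\<close>

locale ext_pseudometric =
  fixes Y :: "'a set" and d :: "'a \<Rightarrow> 'a \<Rightarrow> ennreal"
  assumes self: "\<And>p. p \<in> Y \<Longrightarrow> d p p = 0"
    and sym: "\<And>p q. d p q = d q p"
    and triangle: "\<And>p q r. d p r \<le> d p q + d q r"
begin

lemma tendsto_0_triangle:
  assumes "(\<lambda>n::nat. d (x n) (y n)) \<longlonglongrightarrow> 0" "(\<lambda>n. d (y n) (z n)) \<longlonglongrightarrow> 0"
  shows "(\<lambda>n. d (x n) (z n)) \<longlonglongrightarrow> 0"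
proof (rule tendsto_sandwich[OF _ _ tendsto_const])
  show "(\<lambda>n. d (x n) (y n) + d (y n) (z n)) \<longlonglongrightarrow> 0"
    using tendsto_add[OF assms] by simp
qed (auto simp: triangle)

lemma equiv_cauchy_equiv: "equiv (cauchy_seqs Y d) (cauchy_equiv Y d)"
proof (rule equivI)
  show "cauchy_equiv Y d \<subseteq> cauchy_seqs Y d \<times> cauchy_seqs Y d"
    by (auto simp: cauchy_equiv_def)
  show "refl_on (cauchy_seqs Y d) (cauchy_equiv Y d)"
    by (rule refl_onI) (auto simp: cauchy_equiv_def cauchy_seqs_def self range_subsetD)
  show "sym (cauchy_equiv Y d)" by (rule symI) (auto simp: cauchy_equiv_def sym)
  show "trans (cauchy_equiv Y d)"
    by (rule transI) (auto simp: cauchy_equiv_def intro: tendsto_0_triangle)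
qed

text \<open>Two classes sharing the element x coincide, which gives the uniqueness that the definite
  description demands.\<close>

lemma completion_point_eq:
  assumes x: "range x \<subseteq> Y" "limitin X x z sequentially"
    and eqv: "\<And>x'. range x' \<subseteq> Y \<Longrightarrow> limitin X x' z sequentially \<Longrightarrow> (x, x') \<in> cauchy_equiv Y d"
  shows "completion_point X Y d z = cauchy_equiv Y d `` {x}"
  unfolding completion_point_def
proof (rule the_equality)
  have "x \<in> cauchy_seqs Y d" using eqv[OF x] by (simp add: cauchy_equiv_def)
  then show "cauchy_equiv Y d `` {x} \<in> completion_points Y d \<and>
    (\<forall>x'. range x' \<subseteq> Y \<and> limitin X x' z sequentially \<longrightarrow> x' \<in> cauchy_equiv Y d `` {x})"
    using eqv by (auto simp: completion_points_def intro: quotientI)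
  fix P assume P: "P \<in> completion_points Y d \<and> (\<forall>x'. range x' \<subseteq> Y \<and> limitin X x' z sequentially \<longrightarrow> x' \<in> P)"
  then obtain u where u: "u \<in> cauchy_seqs Y d" "P = cauchy_equiv Y d `` {u}"
    unfolding completion_points_def by (auto elim: quotientE)
  have "x \<in> P" using P x by blast
  then have "(u, x) \<in> cauchy_equiv Y d" using u by simp
  then show "P = cauchy_equiv Y d `` {x}"
    using equiv_class_eq[OF equiv_cauchy_equiv] u(2) by blast
qed

text \<open>The distances along the two pairs differ by at most \<open>\<epsilon> n\<close>, the sum
  of the two gaps, which tends to 0. Finiteness of r lets the subtraction in \<open>ennreal\<close>
  pass to the limit.\<close>

lemma tendsto_equivalent:
  assumes x: "(x, x') \<in> cauchy_equiv Y d" and y: "(y, y') \<in> cauchy_equiv Y d"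
    and lim: "(\<lambda>n. d (x n) (y n)) \<longlonglongrightarrow> r" and "r \<noteq> \<infinity>"
  shows "(\<lambda>n. d (x' n) (y' n)) \<longlonglongrightarrow> r"
proof -
  define \<epsilon> where "\<epsilon> n = d (x n) (x' n) + d (y n) (y' n)" for n
  have \<epsilon>: "\<epsilon> \<longlonglongrightarrow> 0"
    unfolding \<epsilon>_def using x y tendsto_add[of "\<lambda>n. d (x n) (x' n)" 0 sequentially "\<lambda>n. d (y n) (y' n)" 0]
    by (auto simp: cauchy_equiv_def)
  have upper: "d (x' n) (y' n) \<le> d (x n) (y n) + \<epsilon> n" for n
  proof -
    have "d (x' n) (y' n) \<le> d (x' n) (x n) + (d (x n) (y n) + d (y n) (y' n))"
      by (meson add_left_mono order_trans triangle)
    then show ?thesis by (simp add: \<epsilon>_def sym[of "x' n"] ac_simps)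
  qed
  have lower: "d (x n) (y n) - \<epsilon> n \<le> d (x' n) (y' n)" if "\<epsilon> n < \<infinity>" for n
  proof -
    have "d (x n) (y n) \<le> d (x n) (x' n) + (d (x' n) (y' n) + d (y' n) (y n))"
      by (meson add_left_mono order_trans triangle)
    then have "d (x n) (y n) \<le> d (x' n) (y' n) + \<epsilon> n" by (simp add: \<epsilon>_def sym[of "y' n"] ac_simps)
    then show ?thesis using that by (auto simp: ennreal_minus_le_iff add.commute)
  qed
  have lim_upper: "(\<lambda>n. d (x n) (y n) + \<epsilon> n) \<longlonglongrightarrow> r" using tendsto_add[OF lim \<epsilon>] by simp
  have lim_lower: "(\<lambda>n. d (x n) (y n) - \<epsilon> n) \<longlonglongrightarrow> r"
    using tendsto_diff_ennreal[OF lim \<epsilon>] \<open>r \<noteq> \<infinity>\<close> by simp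
  have "\<forall>\<^sub>F n in sequentially. \<epsilon> n < \<infinity>" using order_tendstoD(2)[OF \<epsilon>, of \<infinity>] by simp
  then have "\<forall>\<^sub>F n in sequentially. d (x n) (y n) - \<epsilon> n \<le> d (x' n) (y' n)"
    by eventually_elim (rule lower)
  then show ?thesis
    by (rule tendsto_sandwich[OF _ always_eventually lim_lower lim_upper]) (simp add: upper)
qed

text \<open>By the triangle inequality, \<open>d (x m) (y m)\<close> exceeds
  \<open>d (x n) (y n)\<close> by at most \<open>d (x m) (x n) + d (y n) (y m)\<close>, and m and n
  may be exchanged. Being eventually finite, the distances form a real Cauchy sequence.\<close>

lemma cauchy_dist_convergent:
  assumes x: "x \<in> cauchy_seqs Y d" and y: "y \<in> cauchy_seqs Y d"
    and fin: "\<forall>\<^sub>F n in sequentially. d (x n) (y n) < \<infinity>"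
  obtains r where "r \<noteq> \<infinity>" "(\<lambda>n. d (x n) (y n)) \<longlonglongrightarrow> r"
proof -
  define u where "u n = enn2real (d (x n) (y n))" for n
  obtain M0 where M0: "\<And>n. n \<ge> M0 \<Longrightarrow> d (x n) (y n) = ennreal (u n)"
    using fin unfolding eventually_sequentially u_def by (metis ennreal_enn2real infinity_ennreal_def)
  have u0: "0 \<le> u n" for n by (simp add: u_def)
  have "Cauchy u"
  proof (rule metric_CauchyI)
    fix e :: real assume "e > 0"
    then have e4: "ennreal (e/4) > 0" by simp
    obtain M1 where M1: "\<And>m n. m \<ge> M1 \<Longrightarrow> n \<ge> M1 \<Longrightarrow> d (x m) (x n) < ennreal (e/4)"
      using x e4 unfolding cauchy_seqs_def mem_Collect_eq by metis
    obtain M2 where M2: "\<And>m n. m \<ge> M2 \<Longrightarrow> n \<ge> M2 \<Longrightarrow> d (y m) (y n) < ennreal (e/4)"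
      using y e4 unfolding cauchy_seqs_def mem_Collect_eq by metis
    have le: "u m \<le> u n + e/2" if "m \<ge> M0 + M1 + M2" "n \<ge> M0 + M1 + M2" for m n
    proof -
      have "d (x m) (y m) \<le> d (x m) (x n) + (d (x n) (y n) + d (y n) (y m))"
        by (meson add_left_mono order_trans triangle)
      also have "\<dots> \<le> ennreal (e/4) + (d (x n) (y n) + ennreal (e/4))"
        using M1[of m n] M2[of n m] that by (intro add_mono) auto
      also have "\<dots> = ennreal (u n + e/2)"
        using M0[of n] that \<open>e > 0\<close> u0[of n] by (simp flip: ennreal_plus)
      finally show ?thesis using M0[of m] that u0[of n] \<open>e > 0\<close> by (simp add: ennreal_le_iff del: ennreal_plus)
    qed
    show "\<exists>M. \<forall>m\<ge>M. \<forall>n\<ge>M. dist (u m) (u n) < e"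
    proof (intro exI allI impI)
      fix m n assume "m \<ge> M0 + M1 + M2" "n \<ge> M0 + M1 + M2"
      then show "dist (u m) (u n) < e" using le[of m n] le[of n m] \<open>e > 0\<close> by (auto simp: dist_real_def)
    qed
  qed
  then obtain l where "u \<longlonglongrightarrow> l" using Cauchy_convergent convergent_def by blast
  then have "(\<lambda>n. ennreal (u n)) \<longlonglongrightarrow> ennreal l" by (rule tendsto_ennrealI)
  then have "(\<lambda>n. d (x n) (y n)) \<longlonglongrightarrow> ennreal l"
    by (rule Lim_transform_eventually) (auto simp: eventually_sequentially M0 intro!: exI[of _ M0])
  then show thesis by (intro that[of "ennreal l"]) auto
qed

text \<open>Disposes of the definite descriptions inside \<open>boundary_dist\<close>: once it is a
  limit of distances between interior points, estimates in the interior carry over to it.\<close>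

lemma boundary_dist_tendsto:
  assumes eqv: "\<And>x'. range x' \<subseteq> Y \<Longrightarrow> limitin X x' z sequentially \<Longrightarrow> (x, x') \<in> cauchy_equiv Y d"
      "\<And>y'. range y' \<subseteq> Y \<Longrightarrow> limitin X y' z' sequentially \<Longrightarrow> (y, y') \<in> cauchy_equiv Y d"
    and x: "range x \<subseteq> Y" "limitin X x z sequentially"
    and y: "range y \<subseteq> Y" "limitin X y z' sequentially"
    and fin: "\<forall>\<^sub>F n in sequentially. d (x n) (y n) < \<infinity>"
  shows "(\<lambda>n. d (x n) (y n)) \<longlonglongrightarrow> boundary_dist X Y d z z'"
proof -
  have xx: "(x, x) \<in> cauchy_equiv Y d" and yy: "(y, y) \<in> cauchy_equiv Y d" using eqv x y by auto
  then obtain r where r: "r \<noteq> \<infinity>" "(\<lambda>n. d (x n) (y n)) \<longlonglongrightarrow> r"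
    using cauchy_dist_convergent[OF _ _ fin] by (auto simp: cauchy_equiv_def)
  have "completion_point X Y d z = cauchy_equiv Y d `` {x}" "completion_point X Y d z' = cauchy_equiv Y d `` {y}"
    using completion_point_eq x y eqv by blast+
  moreover have "completion_dist d (cauchy_equiv Y d `` {x}) (cauchy_equiv Y d `` {y}) = r"
    unfolding completion_dist_def
  proof (rule the_equality)
    show "\<forall>x'\<in>cauchy_equiv Y d `` {x}. \<forall>y'\<in>cauchy_equiv Y d `` {y}. (\<lambda>n. d (x' n) (y' n)) \<longlonglongrightarrow> r"
      using tendsto_equivalent[OF _ _ r(2,1)] by blast
    fix r' assume "\<forall>x'\<in>cauchy_equiv Y d `` {x}. \<forall>y'\<in>cauchy_equiv Y d `` {y}. (\<lambda>n. d (x' n) (y' n)) \<longlonglongrightarrow> r'"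
    then have "(\<lambda>n. d (x n) (y n)) \<longlonglongrightarrow> r'" using xx yy by blast
    then show "r' = r" using r(2) LIMSEQ_unique by blast
  qed
  ultimately show ?thesis using r(2) by (simp add: boundary_dist_def)
qed

end

section \<open>Boundary defining functions near a point\<close>

text \<open>The diagonal of the corner at x: unit steps away from exactly the walls through x. At an
  interior point it is 0, which is used to show that the \<open>\<rho> i\<close> are positive
  there.\<close>

definition inward :: "'n::finite set \<Rightarrow> real ^ 'n \<Rightarrow> real ^ 'n" where
  "inward K x = (\<chi> j. if j \<in> K \<and> x $ j = 0 then 1 else 0)"

text \<open>The model is polyhedral, so a vector of the tangent cone at x moves x along an actual
  short segment inside the model. Walls that miss x impose no condition on v, since their
  coordinates stay positive for small t.\<close>

lemma eventually_at_right_ray_in_model: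
  fixes x v :: "real ^ 'n::finite"
  assumes x: "x \<in> corner_model K" and v: "\<And>j. j \<in> K \<Longrightarrow> x $ j = 0 \<Longrightarrow> 0 \<le> v $ j" and e: "e > 0"
  obtains \<tau> where "\<tau> > 0" "\<And>t. 0 \<le> t \<Longrightarrow> t \<le> \<tau> \<Longrightarrow> x + t *\<^sub>R v \<in> ball x e \<inter> corner_model K"
proof -
  have lim: "((\<lambda>t. x + t *\<^sub>R v) \<longlongrightarrow> x + 0 *\<^sub>R v) (at_right 0)" by (intro tendsto_intros)
  then have "\<forall>\<^sub>F t in at_right 0. x + t *\<^sub>R v \<in> ball x e"
    using e by (intro topological_tendstoD) auto
  moreover have "\<forall>\<^sub>F t in at_right 0. \<forall>j\<in>K. 0 \<le> (x + t *\<^sub>R v) $ j"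
  proof (intro eventually_ball_finite ballI)
    fix j assume j: "j \<in> K"
    show "\<forall>\<^sub>F t in at_right 0. 0 \<le> (x + t *\<^sub>R v) $ j"
    proof (cases "x $ j = 0")
      case True
      then show ?thesis using v[OF j] by (auto simp: eventually_at_right_less intro!: eventually_mono[OF eventually_at_right_less])
    next
      case False
      then have "0 < x $ j" using x j by (auto simp: corner_model_def less_le)
      moreover have "((\<lambda>t. (x + t *\<^sub>R v) $ j) \<longlongrightarrow> x $ j) (at_right 0)"
        using tendsto_vec_nth[OF lim, of j] by simp
      ultimately have "\<forall>\<^sub>F t in at_right 0. 0 < (x + t *\<^sub>R v) $ j" by (rule order_tendstoD(1)[rotated])
      then show ?thesis by eventually_elim simp
    qed
  qed simp
  ultimately have "\<forall>\<^sub>F t in at_right 0. x + t *\<^sub>R v \<in> ball x e \<inter> corner_model K"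
    by eventually_elim (auto simp: corner_model_def)
  then obtain b where b: "b > 0" "\<And>t. 0 < t \<Longrightarrow> t < b \<Longrightarrow> x + t *\<^sub>R v \<in> ball x e \<inter> corner_model K"
    unfolding eventually_at_right_field by blast
  have "x + t *\<^sub>R v \<in> ball x e \<inter> corner_model K" if "0 \<le> t" "t \<le> b / 2" for t
    using b(2)[of t] b(1) that x e by (cases "t = 0") auto
  then show thesis using b(1) by (intro that[of "b/2"]) auto
qed

text \<open>On the tangent cone the derivative is nonnegative, and there it does not depend on the extension
  \<open>G\<close>. Hence it is a nonnegative combination of the coordinates in \<open>K\<close> that vanish at \<open>x\<close>.\<close>

lemma inward_derivative_pos:
  fixes x :: "real ^ 'n::finite" and f G :: "real ^ 'n \<Rightarrow> real"
  assumes x: "x \<in> corner_model K" and e: "e > 0" "ball x e \<inter> corner_model K \<subseteq> S"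
    and f: "f x = 0" "\<And>y. y \<in> S \<Longrightarrow> 0 \<le> f y"
    and nz: "frechet_derivative f (at x within S) \<noteq> (\<lambda>_. 0)"
    and G: "(G has_derivative D) (at x)" "\<And>y. y \<in> ball x e \<inter> S \<Longrightarrow> G y = f y"
  shows "0 < D (inward K x)"
proof -
  define L where "L = frechet_derivative f (at x within S)"
  have xS: "x \<in> S" using x e by auto
  have DS: "(f has_derivative D) (at x within S)"
    by (rule has_derivative_transform_within[OF has_derivative_at_withinI[OF G(1)] e(1) xS])
       (use G(2) in \<open>auto simp: dist_commute\<close>)
  then have LS: "(f has_derivative L) (at x within S)"
    unfolding L_def using frechet_derivative_works differentiable_def by blast
  have linD: "linear D" and linL: "linear L" using DS LS has_derivative_linear by blast+
  \<comment> \<open>Along a ray in S from x both L and D give the one-sided derivative of f, so they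
    agree; f has a minimum at x, so this derivative is nonnegative.\<close>
  have cone: "L v = D v \<and> 0 \<le> D v" if v: "\<And>j. j \<in> K \<Longrightarrow> x $ j = 0 \<Longrightarrow> 0 \<le> v $ j" for v
  proof -
    obtain \<tau> where \<tau>: "\<tau> > 0" "\<And>t. 0 \<le> t \<Longrightarrow> t \<le> \<tau> \<Longrightarrow> x + t *\<^sub>R v \<in> ball x e \<inter> corner_model K"
      using eventually_at_right_ray_in_model[OF x v e(1)] by metis
    have line: "((\<lambda>t. x + t *\<^sub>R v) has_derivative (\<lambda>h. h *\<^sub>R v)) (at 0 within {0..\<tau>})"
      by (auto intro!: derivative_eq_intros)
    have img: "(\<lambda>t. x + t *\<^sub>R v) ` {0..\<tau>} \<subseteq> S" using \<tau>(2) e(2) by fastforce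
    have along: "((\<lambda>t. f (x + t *\<^sub>R v)) has_vector_derivative M v) (at 0 within {0..\<tau>})"
      if M: "(f has_derivative M) (at x within S)" for M
    proof -
      have "(f has_derivative M) (at (x + 0 *\<^sub>R v) within (\<lambda>t. x + t *\<^sub>R v) ` {0..\<tau>})"
        using has_derivative_subset[OF M img] by simp
      from diff_chain_within[OF line this]
      show ?thesis
        using has_derivative_linear[OF M] by (simp add: has_vector_derivative_def o_def linear_cmul)
    qed
    have "at (0::real) within {0..\<tau>} \<noteq> bot" using \<tau>(1) by (simp add: trivial_limit_within islimpt_Icc)
    then have "L v = D v"
      using along[OF LS] along[OF DS] vector_derivative_unique_within by blast
    moreover have "0 \<le> D v"
    proof (rule ccontr)
      assume neg: "\<not> 0 \<le> D v"
      have "((\<lambda>t. f (x + t *\<^sub>R v)) has_real_derivative D v) (at 0 within {0..\<tau>})"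
        using along[OF DS] by (simp add: has_real_derivative_iff_has_vector_derivative)
      then obtain s where s: "s > 0" "\<And>h. 0 < h \<Longrightarrow> 0 + h \<in> {0..\<tau>} \<Longrightarrow> h < s \<Longrightarrow> f (x + (0 + h) *\<^sub>R v) < f (x + 0 *\<^sub>R v)"
        using has_real_derivative_neg_dec_right[of "\<lambda>t. f (x + t *\<^sub>R v)" "D v" 0 "{0..\<tau>}"] neg by force
      define h where "h = min \<tau> (s / 2)"
      have h: "0 < h" "h \<le> \<tau>" "h < s" using \<tau>(1) s(1) by (auto simp: h_def)
      then have "f (x + h *\<^sub>R v) < 0" using s(2)[of h] f(1) by simp
      moreover have "x + h *\<^sub>R v \<in> S" using \<tau>(2)[of h] h e(2) by auto
      ultimately show False using f(2) by fastforce
    qed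
    ultimately show ?thesis by simp
  qed
  have nonneg: "0 \<le> D (axis j 1)" and eq: "L (axis j 1) = D (axis j 1)" for j
    using cone[of "axis j 1"] by (auto simp: axis_def)
  \<comment> \<open>For an axis that is not the normal of a wall through x, both signs lie in the
    tangent cone.\<close>
  have zero: "D (axis j 1) = 0" if "\<not> (j \<in> K \<and> x $ j = 0)" for j
  proof -
    have "0 \<le> (- axis j 1 :: real ^ 'n) $ i" if "i \<in> K" "x $ i = 0" for i
      using that \<open>\<not> (j \<in> K \<and> x $ j = 0)\<close> by (cases "i = j") (auto simp: axis_def)
    then have "0 \<le> D (- axis j 1)" using cone by blast
    then show ?thesis using nonneg[of j] linear_neg[OF linD] by simp
  qed
  have inw: "inward K x = (\<Sum>j\<in>{j \<in> K. x $ j = 0}. axis j 1)"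
    by (simp add: inward_def vec_eq_iff axis_def sum.delta if_distrib cong: if_cong)
  have D: "D (inward K x) = (\<Sum>j\<in>{j \<in> K. x $ j = 0}. D (axis j 1))"
    unfolding inw by (rule linear_sum[OF linD])
  then have ge: "0 \<le> D (inward K x)" by (simp add: sum_nonneg nonneg)
  moreover have "D (inward K x) \<noteq> 0"
  \<comment> \<open>A vanishing sum of nonnegative terms has only zero terms; then L kills every
    axis, against the nondegeneracy of the derivative.\<close>
  proof
    assume "D (inward K x) = 0"
    then have "D (axis j 1) = 0" if "j \<in> K" "x $ j = 0" for j
      using that nonneg D by (simp add: sum_nonneg_eq_0_iff)
    then have all: "L (axis j 1) = 0" for j using zero eq by (metis)
    have "L v = 0" for v
    proof -
      have "L v = L (\<Sum>j\<in>UNIV. (v $ j) *\<^sub>R axis j 1)" using basis_expansion[of v] by (simp add: scalar_mult_eq_scaleR)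
      also have "\<dots> = 0" by (simp add: linear_sum[OF linL] linear_cmul[OF linL] all)
      finally show ?thesis .
    qed
    then show False using nz unfolding L_def by auto
  qed
  ultimately show ?thesis by simp
qed

section \<open>Bounds for a continuous family of inner products\<close>

lemma bilinear_expand:
  fixes B :: "real ^ 'n \<Rightarrow> real ^ 'n \<Rightarrow> real"
  assumes "bilinear B"
  shows "B v v = (\<Sum>i\<in>UNIV. \<Sum>j\<in>UNIV. v $ i * v $ j * B (axis i 1) (axis j 1))"
proof -
  have "B v v = B (\<Sum>i\<in>UNIV. (v $ i) *\<^sub>R axis i 1) (\<Sum>j\<in>UNIV. (v $ j) *\<^sub>R axis j 1)"
    using basis_expansion[of v] by (simp add: scalar_mult_eq_scaleR)
  then show ?thesis
    using assms by (simp add: bilinear_sum sum.cartesian_product bilinear_lmul bilinear_rmul mult.assoc)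
qed

text \<open>At \<open>x0\<close> the bounds are the extrema over the unit sphere. Nearby, the form
  changes by at most \<open>h x * (norm v)\<^sup>2\<close>, with h the sum of the changes of its
  coefficients, and \<open>h x < \<nu> / 2\<close> preserves half of the lower bound.\<close>

lemma inner_product_family_bounds:
  fixes B :: "real ^ 'n::finite \<Rightarrow> real ^ 'n \<Rightarrow> real ^ 'n \<Rightarrow> real"
  assumes bil: "\<And>x. x \<in> S \<Longrightarrow> bilinear (B x)" and x0: "x0 \<in> S"
    and pos: "\<And>v. v \<noteq> 0 \<Longrightarrow> 0 < B x0 v v"
    and cont: "\<And>v w. continuous_on S (\<lambda>x. B x v w)"
  obtains \<kappa> M where "0 < \<kappa>" "0 < M"
    "\<forall>\<^sub>F x in nhds x0. x \<in> S \<longrightarrow> (\<forall>v. \<kappa> * (norm v)\<^sup>2 \<le> B x v v \<and> B x v v \<le> M * (norm v)\<^sup>2)"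
proof -
  let ?S = "sphere (0::real^'n) 1"
  have "bounded_bilinear (B x0)" using bil[OF x0] bilinear_conv_bounded_bilinear by blast
  then have cB: "continuous_on ?S (\<lambda>v. B x0 v v)"
    by (rule bounded_bilinear.continuous_on[OF _ continuous_on_id continuous_on_id])
  have ne: "?S \<noteq> {}" by simp
  obtain u where u: "u \<in> ?S" "\<And>v. v \<in> ?S \<Longrightarrow> B x0 u u \<le> B x0 v v"
    using continuous_attains_inf[OF compact_sphere ne cB] by blast
  obtain u' where u': "u' \<in> ?S" "\<And>v. v \<in> ?S \<Longrightarrow> B x0 v v \<le> B x0 u' u'"
    using continuous_attains_sup[OF compact_sphere ne cB] by blast
  define \<nu> where "\<nu> = B x0 u u"
  define \<mu> where "\<mu> = B x0 u' u'"
  have "\<nu> > 0" using u(1) pos[of u] by (force simp: \<nu>_def)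
  have "\<mu> > 0" using u'(1) pos[of u'] by (force simp: \<mu>_def)
  have B0: "\<nu> * (norm v)\<^sup>2 \<le> B x0 v v \<and> B x0 v v \<le> \<mu> * (norm v)\<^sup>2" for v
  proof (cases "v = 0")
    case True
    then show ?thesis using bil[OF x0] by (simp add: bilinear_lzero)
  next
    case False
    define w where "w = (1 / norm v) *\<^sub>R v"
    have w: "w \<in> ?S" "v = norm v *\<^sub>R w" using False by (auto simp: w_def)
    have "B x0 v v = (norm v)\<^sup>2 * B x0 w w"
      using bil[OF x0] by (subst (1 2) w(2)) (simp add: bilinear_lmul bilinear_rmul power2_eq_square)
    then show ?thesis
      using u(2)[OF w(1)] u'(2)[OF w(1)] by (simp add: \<nu>_def \<mu>_def mult.commute mult_left_mono mult_right_mono)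
  qed
  define h where "h x = (\<Sum>i\<in>UNIV. \<Sum>j\<in>UNIV. \<bar>B x (axis i 1) (axis j 1) - B x0 (axis i 1) (axis j 1)\<bar>)" for x
  have "continuous_on S h" unfolding h_def by (intro continuous_intros cont)
  then have "(h \<longlongrightarrow> h x0) (at x0 within S)" using x0 by (simp add: continuous_on_def)
  then have "\<forall>\<^sub>F x in at x0 within S. h x < \<nu> / 2"
    by (rule order_tendstoD) (use \<open>\<nu> > 0\<close> in \<open>simp add: h_def\<close>)
  then have "\<forall>\<^sub>F x in nhds x0. x \<in> S \<longrightarrow> h x < \<nu> / 2"
    unfolding eventually_at_filter using \<open>\<nu> > 0\<close> by (auto elim!: eventually_mono simp: h_def)
  moreover have "\<nu> / 2 * (norm v)\<^sup>2 \<le> B x v v \<and> B x v v \<le> (\<mu> + \<nu> / 2) * (norm v)\<^sup>2"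
    if x: "x \<in> S" "h x < \<nu> / 2" for x v
  proof -
    have "\<bar>B x v v - B x0 v v\<bar> = \<bar>\<Sum>i\<in>UNIV. \<Sum>j\<in>UNIV. v $ i * v $ j * (B x (axis i 1) (axis j 1) - B x0 (axis i 1) (axis j 1))\<bar>"
      unfolding bilinear_expand[OF bil[OF x(1)], of v] bilinear_expand[OF bil[OF x0], of v]
      by (simp add: sum_subtractf right_diff_distrib)
    also have "\<dots> \<le> (\<Sum>i\<in>UNIV. \<Sum>j\<in>UNIV. \<bar>v $ i * v $ j * (B x (axis i 1) (axis j 1) - B x0 (axis i 1) (axis j 1))\<bar>)"
      by (intro order_trans[OF sum_abs] sum_mono sum_abs)
    also have "\<dots> \<le> (\<Sum>i\<in>UNIV. \<Sum>j\<in>UNIV. norm v * norm v * \<bar>B x (axis i 1) (axis j 1) - B x0 (axis i 1) (axis j 1)\<bar>)"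
      unfolding abs_mult by (intro sum_mono mult_right_mono mult_mono component_le_norm_cart) auto
    also have "\<dots> = (norm v)\<^sup>2 * h x" by (simp add: h_def sum_distrib_left power2_eq_square)
    also have "\<dots> \<le> (norm v)\<^sup>2 * (\<nu> / 2)" using x(2) by (intro mult_left_mono) auto
    finally have "\<bar>B x v v - B x0 v v\<bar> \<le> \<nu> / 2 * (norm v)\<^sup>2" by (simp add: mult.commute)
    moreover have "\<nu> * (norm v)\<^sup>2 = \<nu> / 2 * (norm v)\<^sup>2 + \<nu> / 2 * (norm v)\<^sup>2" by (simp add: field_simps)
    ultimately show ?thesis unfolding distrib_right using B0[of v] by linarith
  qed
  ultimately have "\<forall>\<^sub>F x in nhds x0. x \<in> S \<longrightarrow> (\<forall>v. \<nu> / 2 * (norm v)\<^sup>2 \<le> B x v v \<and> B x v v \<le> (\<mu> + \<nu> / 2) * (norm v)\<^sup>2)"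
    by (auto elim!: eventually_mono)
  then show thesis using \<open>\<nu> > 0\<close> \<open>\<mu> > 0\<close> by (intro that[of "\<nu>/2" "\<mu> + \<nu>/2"]) auto
qed

text \<open>Isolates the singular factor of the weight: indices in I contribute one power with
  exponent \<open>- A_I\<close>, the others a separate factor. It is used with
  \<open>y = r x\<close> for the lower and \<open>y = a * s\<close> for the upper bound on the
  metric.\<close>

lemma prod_powr_split:
  fixes y :: real and N :: nat
  assumes "I \<subseteq> {1..N}" "y > 0"
  shows "(\<Prod>i=1..N. if i \<in> I then y powr - \<alpha> i else m i) = y powr - (\<Sum>i\<in>I. \<alpha> i) * (\<Prod>i\<in>{1..N} - I. m i)"
proof -
  have "(\<Prod>i\<in>I. y powr - \<alpha> i) = y powr - (\<Sum>i\<in>I. \<alpha> i)"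
    using assms powr_sum[of y "\<lambda>i. - \<alpha> i" I] finite_subset[OF assms(1)] by (simp add: sum_negf)
  moreover have "{1..N} \<inter> I = I" "{1..N} \<inter> - I = {1..N} - I" using assms(1) by auto
  ultimately show ?thesis by (simp add: prod.If_cases)
qed

section \<open>Distance estimates near a face\<close>

text \<open>The cost of a radial leg, finite because \<open>b < 1\<close>; its value is the factor
  \<open>1 / (1 - b)\<close> in \<open>upper_const\<close>.\<close>

lemma nn_integral_powr_01:
  assumes "0 \<le> b" "b < 1"
  shows "(\<integral>\<^sup>+t\<in>{0..1::real}. ennreal (t powr - b) \<partial>lborel) = ennreal (1 / (1 - b))"
proof -
  have "((\<lambda>t. t powr - b) has_integral (1 / (1 - b))) {0..1::real}"
    using has_integral_powr_from_0[of "- b" 1] assms by simp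
  then have "((\<lambda>t. if t \<in> {0..1} then t powr - b else 0) has_integral (1 / (1 - b))) UNIV"
    by (simp only: has_integral_restrict_UNIV)
  then have "(\<integral>\<^sup>+t. ennreal (if t \<in> {0..1} then t powr - b else 0) \<partial>lborel) = ennreal (1 / (1 - b))"
    by (intro nn_integral_has_integral_lborel) auto
  moreover have "(\<integral>\<^sup>+t\<in>{0..1::real}. ennreal (t powr - b) \<partial>lborel) = (\<integral>\<^sup>+t. ennreal (if t \<in> {0..1} then t powr - b else 0) \<partial>lborel)"
    by (intro nn_integral_cong) (auto simp: indicator_def)
  ultimately show ?thesis by simp
qed

text \<open>In the application \<open>b = A\<^sub>I / 2\<close>, \<open>r\<close> extends \<open>\<Sum>i\<in>I. \<rho> i\<close>, and \<open>e0\<close> is the inward diagonal at \<open>x0\<close>.\<close>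

locale near_face = corner_tensor X A g
  for X :: "'a topology" and A :: "('a, 'n::finite) corner_chart set" and g +
  fixes c :: "('a, 'n) corner_chart" and x0 e0 :: "real ^ 'n" and \<epsilon> :: real
    and r :: "real ^ 'n \<Rightarrow> real" and r' :: "real ^ 'n \<Rightarrow> real ^ 'n \<Rightarrow> real" and b c2 C2 \<Lambda> :: real
  assumes cA: "c \<in> A" and const_pos: "\<epsilon> > 0" "c2 > 0" "C2 > 0" "\<Lambda> > 0" "b \<ge> 0"
    and ball_sub: "ball x0 \<epsilon> \<inter> corner_model (corner c) \<subseteq> coord c ` chart_dom c"
    and r_deriv: "\<And>x. x \<in> ball x0 \<epsilon> \<Longrightarrow> (r has_derivative r' x) (at x)"
    and r'_bound: "\<And>x v. x \<in> ball x0 \<epsilon> \<Longrightarrow> \<bar>r' x v\<bar> \<le> \<Lambda> * norm v"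
    and r_less_1: "\<And>x. x \<in> ball x0 \<epsilon> \<Longrightarrow> r x < 1"
    and r_pos: "\<And>x. x \<in> ball x0 \<epsilon> \<Longrightarrow> (\<And>j. j \<in> corner c \<Longrightarrow> 0 < x $ j) \<Longrightarrow> 0 < r x"
    and g_lower: "\<And>x v. x \<in> ball x0 \<epsilon> \<Longrightarrow> (\<And>j. j \<in> corner c \<Longrightarrow> 0 < x $ j) \<Longrightarrow>
      c2 * r x powr - b * norm v \<le> sqrt (g c (chart_inv c x) v v)"
    and g_upper: "\<And>x s v. x \<in> ball x0 \<epsilon> \<inter> corner_model (corner c) \<Longrightarrow> s > 0 \<Longrightarrow> x + s *\<^sub>R e0 \<in> ball x0 \<epsilon> \<Longrightarrow>
      sqrt (g c (chart_inv c (x + s *\<^sub>R e0)) v v) \<le> C2 * s powr - b * norm v"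
    and e0_nonneg: "\<And>j. 0 \<le> e0 $ j"
    and inward_pos: "\<And>x s j. x \<in> ball x0 \<epsilon> \<inter> corner_model (corner c) \<Longrightarrow> s > 0 \<Longrightarrow> j \<in> corner c \<Longrightarrow> 0 < (x + s *\<^sub>R e0) $ j"
begin

section \<open>Radius and constants of the local estimates\<close>

abbreviation nhd :: "real \<Rightarrow> 'a set" where
  "nhd \<delta> \<equiv> {q \<in> chart_dom c. coord c q \<in> ball x0 \<delta>}"

text \<open>Two points of this ball are at distance \<open>L \<le> 2 * radius\<close>; pushed by L
  times \<open>e0\<close> they stay in the ball of radius \<epsilon>, since
  \<open>radius + 2 * radius * norm e0 \<le> \<epsilon>\<close>. The summand 4 also gives
  \<open>radius \<le> \<epsilon> / 4\<close>, as the lower estimate requires.\<close>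

definition radius :: real where
  "radius = \<epsilon> / (2 * norm e0 + 4)"

text \<open>Two radial legs and one crossing, in units of \<open>L powr (1 - b)\<close>.\<close>

definition upper_const :: real where
  "upper_const = 2 * (C2 * norm e0 / (1 - b)) + C2"

text \<open>The worse of the two alternatives for a stopped curve: moving across where r is small,
  or climbing in r.\<close>

definition lower_const :: real where
  "lower_const = min c2 (c2 / (\<Lambda> * (1 - b)))"

lemma radius_bounds: "radius * (2 * norm e0 + 4) = \<epsilon>" "0 < radius" "radius \<le> \<epsilon> / 4" "radius < \<epsilon>"
proof -
  have e0: "0 < 2 * norm e0 + 4" by (simp add: add_nonneg_pos)
  then show "radius * (2 * norm e0 + 4) = \<epsilon>" "0 < radius" using const_pos(1) by (auto simp: radius_def)
  show "radius \<le> \<epsilon> / 4" unfolding radius_def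
    by (rule divide_left_mono) (use const_pos(1) e0 in auto)
  then show "radius < \<epsilon>" using const_pos(1) by linarith
qed

lemma pos_in_image:
  assumes "x \<in> ball x0 \<epsilon>" "\<And>j. j \<in> corner c \<Longrightarrow> 0 < x $ j"
  shows "x \<in> coord c ` chart_dom c"
proof -
  have "x \<in> corner_model (corner c)" using assms(2) by (simp add: corner_model_def less_imp_le)
  then show ?thesis using assms(1) ball_sub by blast
qed

section \<open>Upper estimate by three segments\<close>

lemma dist_inward_le:
  assumes b: "b < 1" and u: "u \<in> ball x0 \<epsilon>" "\<And>j. j \<in> corner c \<Longrightarrow> 0 < u $ j" and h: "h > 0"
    and uh: "u + h *\<^sub>R e0 \<in> ball x0 \<epsilon>"
  shows "d (chart_inv c u) (chart_inv c (u + h *\<^sub>R e0)) \<le> ennreal (C2 * norm e0 / (1 - b) * h powr (1 - b))"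
proof -
  have seg: "u + t *\<^sub>R (h *\<^sub>R e0) \<in> ball x0 \<epsilon>" if "t \<in> {0..1}" for t
  proof -
    have "(1 - t) *\<^sub>R u + t *\<^sub>R (u + h *\<^sub>R e0) \<in> ball x0 \<epsilon>"
      using convexD[OF convex_ball u(1) uh, of "1 - t" t] that by simp
    then show ?thesis by (simp add: algebra_simps)
  qed
  have pos: "0 < (u + t *\<^sub>R (h *\<^sub>R e0)) $ j" if "t \<in> {0..1}" "j \<in> corner c" for t j
    using u(2)[OF that(2)] e0_nonneg[of j] that(1) h by (simp add: add_pos_nonneg)
  have um: "u \<in> ball x0 \<epsilon> \<inter> corner_model (corner c)" using u by (simp add: corner_model_def less_imp_le)
  have "d (chart_inv c u) (chart_inv c (u + h *\<^sub>R e0)) \<le>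
    (\<integral>\<^sup>+t\<in>{0..1}. ennreal (sqrt (g c (chart_inv c (u + t *\<^sub>R (h *\<^sub>R e0))) (h *\<^sub>R e0) (h *\<^sub>R e0))) \<partial>lborel)"
    by (rule dist_segment_le[OF cA]) (use seg pos pos_in_image in blast)+
  also have "\<dots> \<le> (\<integral>\<^sup>+t. ennreal (C2 * norm e0 * h powr (1 - b)) * (ennreal (t powr - b) * indicator {0..1} t) \<partial>lborel)"
  proof (rule nn_integral_mono_AE)
    have "AE t in lborel. t \<notin> {0::real}" by (intro AE_not_in) (auto intro: finite_imp_null_set_lborel)
    then show "AE t in lborel. ennreal (sqrt (g c (chart_inv c (u + t *\<^sub>R (h *\<^sub>R e0))) (h *\<^sub>R e0) (h *\<^sub>R e0))) * indicator {0..1} t \<le>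
      ennreal (C2 * norm e0 * h powr (1 - b)) * (ennreal (t powr - b) * indicator {0..1} t)"
    proof eventually_elim
      case (elim t)
      show ?case
      proof (cases "t \<in> {0..1}")
        case True
        then have t: "t > 0" "t \<le> 1" using elim by auto
        \<comment> \<open>The height is measured from u, so \<open>g_upper\<close> gives
          \<open>(t * h) powr - b\<close> whatever the value of r at u; this keeps the bound uniform
          up to the face.\<close>
        have "sqrt (g c (chart_inv c (u + (t * h) *\<^sub>R e0)) (h *\<^sub>R e0) (h *\<^sub>R e0)) \<le> C2 * (t * h) powr - b * norm (h *\<^sub>R e0)"
          using seg[OF True] t h by (intro g_upper um) auto
        also have "\<dots> = C2 * (t powr - b * h powr - b) * (h * norm e0)"
          using t h by (simp add: powr_mult)
        also have "\<dots> = C2 * norm e0 * h powr (1 - b) * t powr - b"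
          using h by (simp add: powr_diff powr_minus field_simps)
        finally have "ennreal (sqrt (g c (chart_inv c (u + (t * h) *\<^sub>R e0)) (h *\<^sub>R e0) (h *\<^sub>R e0)))
            \<le> ennreal (C2 * norm e0 * h powr (1 - b) * t powr - b)" by (rule ennreal_leI)
        then show ?thesis using True const_pos by (simp add: ennreal_mult'')
      qed simp
    qed
  qed
  also have "\<dots> = ennreal (C2 * norm e0 * h powr (1 - b)) * ennreal (1 / (1 - b))"
    by (subst nn_integral_cmult) (auto simp: nn_integral_powr_01 const_pos b)
  also have "\<dots> = ennreal (C2 * norm e0 / (1 - b) * h powr (1 - b))"
    using b const_pos by (subst ennreal_mult[symmetric]) auto
  finally show ?thesis .
qed

lemma dist_upper:
  assumes b: "b < 1" and x: "x \<in> Y \<inter> nhd radius" and y: "y \<in> Y \<inter> nhd radius"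
  shows "d x y \<le> ennreal (upper_const * norm (coord c x - coord c y) powr (1 - b))"
proof (cases "coord c x = coord c y")
  case True
  then have "x = y" using x y chart_homeo(2)[OF is_chart[OF cA]] by (simp add: inj_on_def)
  then show ?thesis using riemannian_dist_self x by simp
next
  case False
  define u w where "u = coord c x" and "w = coord c y"
  define L where "L = norm (u - w)"
  have L: "L > 0" using False by (simp add: L_def u_def w_def)
  have uw: "dist x0 u < radius" "dist x0 w < radius" using x y by (auto simp: u_def w_def)
  have pos: "0 < u $ j" "0 < w $ j" if "j \<in> corner c" for j
    using x y that Y_iff[OF cA] by (auto simp: u_def w_def)
  have "dist u w < 2 * radius" using uw dist_triangle3[of u w x0] by linarith
  then have "L \<le> 2 * radius" by (simp add: L_def dist_norm)
  then have Ln: "L * norm e0 \<le> 2 * radius * norm e0" by (intro mult_right_mono) auto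
  have in_ball: "z + L *\<^sub>R e0 \<in> ball x0 \<epsilon>" if "dist x0 z < radius" for z
  proof -
    have "dist x0 (z + L *\<^sub>R e0) \<le> dist x0 z + dist z (z + L *\<^sub>R e0)" by (rule dist_triangle)
    also have "dist z (z + L *\<^sub>R e0) = L * norm e0" using L by (simp add: dist_norm)
    also have "dist x0 z + L * norm e0 < radius + 2 * radius * norm e0" using that Ln by simp
    also have "\<dots> \<le> \<epsilon>" using radius_bounds(1,2) by (simp add: algebra_simps)
    finally show ?thesis by simp
  qed
  have ub: "u \<in> ball x0 \<epsilon>" "w \<in> ball x0 \<epsilon>" using uw radius_bounds(4) by auto
  have model: "z \<in> ball x0 \<epsilon> \<inter> corner_model (corner c)" if "z \<in> ball x0 \<epsilon>" "\<And>j. j \<in> corner c \<Longrightarrow> 0 < z $ j" for z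
    using that by (simp add: corner_model_def less_imp_le)
  have inv: "chart_inv c u = x" "chart_inv c w = y"
    using x y chart_inv_coord[OF is_chart[OF cA]] by (auto simp: u_def w_def)
  let ?leg = "ennreal (C2 * norm e0 / (1 - b) * L powr (1 - b))"
  have 1: "d x (chart_inv c (u + L *\<^sub>R e0)) \<le> ?leg"
    using dist_inward_le[OF b ub(1) pos(1) L in_ball[OF uw(1)]] by (simp add: inv)
  have 2: "d y (chart_inv c (w + L *\<^sub>R e0)) \<le> ?leg"
    using dist_inward_le[OF b ub(2) pos(2) L in_ball[OF uw(2)]] by (simp add: inv)
  define v where "v = w - u"
  have conv: "u + t *\<^sub>R v = (1 - t) *\<^sub>R u + t *\<^sub>R w" for t by (simp add: algebra_simps v_def)
  have uv: "dist x0 (u + t *\<^sub>R v) < radius" if "t \<in> {0..1}" for t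
    using convexD[OF convex_ball, of u x0 radius w "1 - t" t] uw that by (simp add: conv)
  have uvp: "0 < (u + t *\<^sub>R v) $ j" if "t \<in> {0..1}" "j \<in> corner c" for t j
  proof -
    have "0 < (1 - t) * u $ j + t * w $ j"
    proof (cases "t = 0")
      case False
      then have "0 < t * w $ j" "0 \<le> (1 - t) * u $ j" using pos[OF that(2)] that(1) by auto
      then show ?thesis by simp
    qed (use pos[OF that(2)] in simp)
    then show ?thesis by (simp add: conv)
  qed
  \<comment> \<open>Each point of the crossing segment is a point of the model moved by L times
    \<open>e0\<close>, the form in which \<open>g_upper\<close> applies with
    \<open>s = L\<close>.\<close>
  have eq: "u + L *\<^sub>R e0 + t *\<^sub>R v = (u + t *\<^sub>R v) + L *\<^sub>R e0" for t by simp
  have uvm: "u + t *\<^sub>R v \<in> ball x0 \<epsilon> \<inter> corner_model (corner c)" if "t \<in> {0..1}" for t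
    using uv[OF that] uvp[OF that] radius_bounds(4) by (intro model) auto
  have "d (chart_inv c (u + L *\<^sub>R e0)) (chart_inv c (u + L *\<^sub>R e0 + v)) \<le>
    (\<integral>\<^sup>+t\<in>{0..1}. ennreal (sqrt (g c (chart_inv c (u + L *\<^sub>R e0 + t *\<^sub>R v)) v v)) \<partial>lborel)"
  proof (rule dist_segment_le[OF cA])
    fix t :: real assume t: "t \<in> {0..1}"
    show p: "0 < (u + L *\<^sub>R e0 + t *\<^sub>R v) $ j" if "j \<in> corner c" for j
      using inward_pos[OF uvm[OF t] L that] unfolding eq .
    show "u + L *\<^sub>R e0 + t *\<^sub>R v \<in> coord c ` chart_dom c"
      by (rule pos_in_image[OF _ p]) (unfold eq, rule in_ball[OF uv[OF t]])
  qed
  also have "\<dots> \<le> (\<integral>\<^sup>+t. ennreal (C2 * L powr (1 - b)) * indicator {0..1::real} t \<partial>lborel)"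
  proof (intro nn_integral_mono)
    fix t :: real
    have "sqrt (g c (chart_inv c (u + L *\<^sub>R e0 + t *\<^sub>R v)) v v) \<le> C2 * L powr (1 - b)" if t: "t \<in> {0..1}"
    proof -
      have "sqrt (g c (chart_inv c (u + L *\<^sub>R e0 + t *\<^sub>R v)) v v) \<le> C2 * L powr - b * norm v"
        unfolding eq by (rule g_upper[OF uvm[OF t] L in_ball[OF uv[OF t]]])
      also have "norm v = L" by (simp add: v_def L_def norm_minus_commute)
      finally show ?thesis using L by (simp add: powr_diff powr_minus field_simps)
    qed
    then show "ennreal (sqrt (g c (chart_inv c (u + L *\<^sub>R e0 + t *\<^sub>R v)) v v)) * indicator {0..1} t
      \<le> ennreal (C2 * L powr (1 - b)) * indicator {0..1} t"
      by (cases "t \<in> {0..1}") (auto intro!: ennreal_leI)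
  qed
  also have "\<dots> = ennreal (C2 * L powr (1 - b))" by (subst nn_integral_cmult_indicator) auto
  also have "u + L *\<^sub>R e0 + v = w + L *\<^sub>R e0" by (simp add: v_def)
  finally have 3: "d (chart_inv c (u + L *\<^sub>R e0)) (chart_inv c (w + L *\<^sub>R e0)) \<le> ennreal (C2 * L powr (1 - b))" .
  have "d x y \<le> d x (chart_inv c (u + L *\<^sub>R e0)) + (d (chart_inv c (u + L *\<^sub>R e0)) (chart_inv c (w + L *\<^sub>R e0)) + d (chart_inv c (w + L *\<^sub>R e0)) y)"
    by (meson add_left_mono order_trans riemannian_dist_triangle)
  also have "\<dots> \<le> ?leg + (ennreal (C2 * L powr (1 - b)) + ?leg)"
    using 1 2 3 by (intro add_mono) (auto simp: riemannian_dist_sym[of _ y])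
  also have "\<dots> = ennreal (C2 * norm e0 / (1 - b) * L powr (1 - b) + (C2 * L powr (1 - b) + C2 * norm e0 / (1 - b) * L powr (1 - b)))"
  proof -
    have "0 \<le> C2 * norm e0 / (1 - b) * L powr (1 - b)" "0 \<le> C2 * L powr (1 - b)" using b const_pos by auto
    then show ?thesis by (simp only: ennreal_plus add_nonneg_nonneg)
  qed
  also have "C2 * norm e0 / (1 - b) * L powr (1 - b) + (C2 * L powr (1 - b) + C2 * norm e0 / (1 - b) * L powr (1 - b))
      = upper_const * L powr (1 - b)"
    by (simp add: upper_const_def distrib_right)
  finally show ?thesis by (simp add: L_def u_def w_def)
qed

section \<open>Lower estimates by stopping and calibration\<close>

text \<open>Stops the curve at its first exit from the open coordinate ball. The closed ball
  corresponds to a compact, hence closed, subset of the Hausdorff space X; otherwise the curve might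
  leave the chart domain without ever meeting the coordinate sphere.\<close>

lemma curve_escape:
  assumes \<gamma>: "piecewise_C1_curve X A Y \<gamma>" and 0: "\<gamma> 0 \<in> chart_dom c" and "\<delta> > 0"
    and sub: "cball (coord c (\<gamma> 0)) \<delta> \<inter> corner_model (corner c) \<subseteq> coord c ` chart_dom c"
  obtains (stay) "\<gamma> ` {0..1} \<subseteq> chart_dom c" "\<And>t. t \<in> {0..1} \<Longrightarrow> dist (coord c (\<gamma> 0)) (coord c (\<gamma> t)) < \<delta>"
  | (escape) T where "0 \<le> T" "T \<le> 1" "\<gamma> ` {0..T} \<subseteq> chart_dom c"
      "\<And>t. t \<in> {0..T} \<Longrightarrow> dist (coord c (\<gamma> 0)) (coord c (\<gamma> t)) \<le> \<delta>"
      "dist (coord c (\<gamma> 0)) (coord c (\<gamma> T)) = \<delta>"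
proof -
  note chart = is_chart[OF cA]
  define u where "u = coord c (\<gamma> 0)"
  define V where "V = {q \<in> chart_dom c. coord c q \<in> ball u \<delta>}"
  define V' where "V' = {q \<in> chart_dom c. coord c q \<in> cball u \<delta>}"
  have V: "openin X V" unfolding V_def by (rule openin_chart_preimage[OF chart]) simp
  have V': "closedin X V'"
  proof -
    have "closed (corner_model (corner c))"
    proof -
      have "corner_model (corner c) = (\<Inter>j\<in>corner c. {x. 0 \<le> x $ j})" by (auto simp: corner_model_def)
      then show ?thesis by (auto intro!: closed_INT closed_Collect_le continuous_intros)
    qed
    then have "compact (cball u \<delta> \<inter> corner_model (corner c))" by (simp add: compact_Int_closed)
    then have "compactin (top_of_set (coord c ` chart_dom c)) (cball u \<delta> \<inter> corner_model (corner c))"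
      using sub by (simp add: compactin_subtopology u_def)
    then have "compactin X (chart_inv c ` (cball u \<delta> \<inter> corner_model (corner c)))"
      using continuous_map_chart_inv[OF chart] by (rule image_compactin)
    moreover have "chart_inv c ` (cball u \<delta> \<inter> corner_model (corner c)) = V'"
    proof
      show "chart_inv c ` (cball u \<delta> \<inter> corner_model (corner c)) \<subseteq> V'"
      proof
        fix q assume "q \<in> chart_inv c ` (cball u \<delta> \<inter> corner_model (corner c))"
        then obtain x where x: "x \<in> cball u \<delta>" "x \<in> coord c ` chart_dom c" "q = chart_inv c x"
          using sub by (auto simp: u_def)
        then show "q \<in> V'" using chart_inv_in_dom[OF chart x(2)] by (simp add: V'_def)
      qed
      show "V' \<subseteq> chart_inv c ` (cball u \<delta> \<inter> corner_model (corner c))"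
      proof
        fix q assume q: "q \<in> V'"
        then have "q = chart_inv c (coord c q)" "coord c q \<in> cball u \<delta> \<inter> corner_model (corner c)"
          using chart_inv_coord[OF chart] coord_nonneg[OF chart] by (auto simp: V'_def corner_model_def)
        then show "q \<in> chart_inv c ` (cball u \<delta> \<inter> corner_model (corner c))" by (rule image_eqI)
      qed
    qed
    ultimately show ?thesis using hausdorff compactin_imp_closedin by metis
  qed
  have cont: "continuous_map (top_of_set {0..1}) X \<gamma>"
    using \<gamma> by (simp add: piecewise_C1_curve_def pathin_def continuous_map_in_subtopology)
  show thesis
  proof (cases "\<forall>t\<in>{0..1}. \<gamma> t \<in> V")
    case True
    show thesis by (rule stay) (use True in \<open>auto simp: V_def u_def\<close>)
  next
    case False
    define E where "E = {t \<in> {0..1}. \<gamma> t \<notin> V}"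
    have "openin (top_of_set {0..1}) {t \<in> topspace (top_of_set {0..1}). \<gamma> t \<in> V}"
      by (rule openin_continuous_map_preimage[OF cont V])
    then obtain W where W: "open W" "{t \<in> {0..1}. \<gamma> t \<in> V} = {0..1} \<inter> W" by (auto simp: openin_open)
    have "t \<in> W \<longleftrightarrow> \<gamma> t \<in> V" if "t \<in> {0..1}" for t using W(2) that by blast
    then have "E = {0..1} - W" unfolding E_def by blast
    then have "closed E" using W(1) by (simp add: closed_Diff)
    have ne: "E \<noteq> {}" "bdd_below E" using False by (auto simp: E_def intro!: bdd_belowI[of _ 0])
    \<comment> \<open>The set \<open>E\<close> of times outside \<open>V\<close> is closed, because
      \<open>V\<close> is open, so the exit time itself belongs to \<open>E\<close>.\<close>
    define T where "T = Inf E"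
    have TE: "T \<in> E" unfolding T_def by (rule closed_contains_Inf[OF ne \<open>closed E\<close>])
    have before: "\<gamma> t \<in> V" if "0 \<le> t" "t < T" for t
    proof (rule ccontr)
      assume "\<gamma> t \<notin> V"
      then have "t \<in> E" using that TE by (auto simp: E_def)
      then have "T \<le> t" unfolding T_def using ne(2) by (rule cInf_lower)
      then show False using that by simp
    qed
    have "\<gamma> 0 \<in> V" using 0 \<open>\<delta> > 0\<close> by (simp add: V_def u_def)
    then have "T \<noteq> 0" using TE by (auto simp: E_def)
    then have T: "0 < T" "T \<le> 1" using TE by (auto simp: E_def)
    have "closedin (top_of_set {0..1}) {t \<in> topspace (top_of_set {0..1}). \<gamma> t \<in> V'}"
      by (rule closedin_continuous_map_preimage[OF cont V'])
    then obtain W' where W': "closed W'" "{t \<in> {0..1}. \<gamma> t \<in> V'} = {0..1} \<inter> W'" by (auto simp: closedin_closed)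
    have "t \<in> W'" if "t \<in> {0<..<T}" for t
    proof -
      have "\<gamma> t \<in> V'" using before[of t] that by (auto simp: V_def V'_def)
      then have "t \<in> {t \<in> {0..1}. \<gamma> t \<in> V'}" using that T by auto
      then show ?thesis unfolding W'(2) by simp
    qed
    \<comment> \<open>All earlier times are sent into the closed set \<open>V'\<close>, so T is as
      well; being outside \<open>V\<close>, its image has coordinates on the sphere.\<close>
    then have "closure {0<..<T} \<subseteq> W'" using W'(1) by (intro closure_minimal) auto
    then have "T \<in> W'" using T by (auto simp: closure_greaterThanLessThan)
    then have "T \<in> {t \<in> {0..1}. \<gamma> t \<in> V'}" unfolding W'(2) using T by simp
    then have TV': "\<gamma> T \<in> V'" by simp
    then have all: "\<gamma> t \<in> V'" if "t \<in> {0..T}" for t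
      using before[of t] that by (cases "t = T") (auto simp: V_def V'_def)
    show thesis
    proof (rule escape)
      show "0 \<le> T" "T \<le> 1" using T by auto
      show "\<gamma> ` {0..T} \<subseteq> chart_dom c" using all by (auto simp: V'_def)
      show "dist (coord c (\<gamma> 0)) (coord c (\<gamma> t)) \<le> \<delta>" if "t \<in> {0..T}" for t
        using all[OF that] by (simp add: V'_def u_def)
      show "dist (coord c (\<gamma> 0)) (coord c (\<gamma> T)) = \<delta>"
        using TV' TE by (auto simp: V'_def V_def u_def E_def)
    qed
  qed
qed

text \<open>Calibration by \<open>\<psi> \<circ> r\<close>: the differential of r has norm at most
  \<Lambda>, while the norm of g is at least \<open>c2 * r powr - b\<close> times the Euclidean one.
  The profiles used are multiples of \<open>s powr (1 - b)\<close> for \<open>b < 1\<close> and of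
  \<open>ln s\<close> for \<open>b \<ge> 1\<close>.\<close>

lemma curve_length_ge_radial:
  assumes \<gamma>: "piecewise_C1_curve X A Y \<gamma>" and T: "0 \<le> T" "T \<le> 1"
    and sub: "\<gamma> ` {0..T} \<subseteq> chart_dom c" "\<And>t. t \<in> {0..T} \<Longrightarrow> coord c (\<gamma> t) \<in> ball x0 \<epsilon>"
    and \<psi>: "\<And>s. 0 < s \<Longrightarrow> s < 1 \<Longrightarrow> (\<psi> has_real_derivative \<psi>' s) (at s)"
    and le: "\<And>s. 0 < s \<Longrightarrow> s < 1 \<Longrightarrow> \<Lambda> * \<bar>\<psi>' s\<bar> \<le> c2 * s powr - b"
  shows "ennreal \<bar>\<psi> (r (coord c (\<gamma> T))) - \<psi> (r (coord c (\<gamma> 0)))\<bar> \<le> curve_length A g \<gamma>"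
proof -
  have dom: "\<gamma> t \<in> chart_dom c" if "t \<in> {0..T}" for t using sub(1) that by blast
  have pos: "0 < coord c (\<gamma> t) $ j" if "t \<in> {0..T}" "j \<in> corner c" for t j
    using curve_in_Y[OF \<gamma>, of t] Y_iff[OF cA dom[OF that(1)]] that T by auto
  have r01: "0 < r (coord c (\<gamma> t))" "r (coord c (\<gamma> t)) < 1" if "t \<in> {0..T}" for t
    using r_pos[OF sub(2)[OF that] pos[OF that]] r_less_1[OF sub(2)[OF that]] by blast+
  have inv: "chart_inv c (coord c (\<gamma> t)) = \<gamma> t" if "t \<in> {0..T}" for t
    by (rule chart_inv_coord[OF is_chart[OF cA] dom[OF that]])
  have "ennreal \<bar>(\<psi> \<circ> r) (coord c (\<gamma> T)) - (\<psi> \<circ> r) (coord c (\<gamma> 0))\<bar> \<le> curve_length A g \<gamma>"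
  proof (rule curve_length_ge[OF \<gamma> _ T(1,2) cA sub(1)])
    fix t assume t: "t \<in> {0..T}"
    let ?x = "coord c (\<gamma> t)"
    have "(\<psi> has_derivative (\<lambda>h. \<psi>' (r ?x) * h)) (at (r ?x))"
      using \<psi>[OF r01[OF t]] by (simp add: has_field_derivative_def)
    then show "((\<psi> \<circ> r) has_derivative (\<lambda>v. \<psi>' (r ?x) * r' ?x v)) (at ?x)"
      using diff_chain_at[OF r_deriv[OF sub(2)[OF t]]] by (simp add: o_def)
    fix v
    have "\<bar>\<psi>' (r ?x) * r' ?x v\<bar> \<le> \<bar>\<psi>' (r ?x)\<bar> * (\<Lambda> * norm v)"
      unfolding abs_mult using r'_bound[OF sub(2)[OF t]] by (intro mult_left_mono) auto
    also have "\<dots> \<le> c2 * r ?x powr - b * norm v"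
      using mult_right_mono[OF le[OF r01[OF t]], of "norm v"] by (simp add: ac_simps)
    also have "\<dots> \<le> sqrt (g c (\<gamma> t) v v)"
      using g_lower[OF sub(2)[OF t] pos[OF t], of v] inv[OF t] by simp
    finally show "\<bar>\<psi>' (r ?x) * r' ?x v\<bar> \<le> sqrt (g c (\<gamma> t) v v)" .
  qed simp
  then show ?thesis by simp
qed

text \<open>Calibration by the linear function in the direction of the total displacement. Where
  \<open>r \<le> R\<close>, the factor \<open>r powr - b\<close> is at least
  \<open>R powr - b\<close>, because \<open>b \<ge> 0\<close>.\<close>

lemma curve_length_ge_linear:
  assumes \<gamma>: "piecewise_C1_curve X A Y \<gamma>" and T: "0 \<le> T" "T \<le> 1"
    and sub: "\<gamma> ` {0..T} \<subseteq> chart_dom c" "\<And>t. t \<in> {0..T} \<Longrightarrow> coord c (\<gamma> t) \<in> ball x0 \<epsilon>"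
    and R: "\<And>t. t \<in> {0..T} \<Longrightarrow> r (coord c (\<gamma> t)) \<le> R"
  shows "ennreal (c2 * R powr - b * dist (coord c (\<gamma> 0)) (coord c (\<gamma> T))) \<le> curve_length A g \<gamma>"
proof -
  have dom: "\<gamma> t \<in> chart_dom c" if "t \<in> {0..T}" for t using sub(1) that by blast
  have pos: "0 < coord c (\<gamma> t) $ j" if "t \<in> {0..T}" "j \<in> corner c" for t j
    using curve_in_Y[OF \<gamma>, of t] Y_iff[OF cA dom[OF that(1)]] that T by auto
  have inv: "chart_inv c (coord c (\<gamma> t)) = \<gamma> t" if "t \<in> {0..T}" for t
    by (rule chart_inv_coord[OF is_chart[OF cA] dom[OF that]])
  define w where "w = coord c (\<gamma> T) - coord c (\<gamma> 0)"
  define m where "m = sgn w"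
  have nm: "norm m \<le> 1" by (simp add: m_def norm_sgn)
  define k where "k = c2 * R powr - b"
  have k: "k \<ge> 0" using const_pos by (simp add: k_def)
  have "ennreal \<bar>k * (m \<bullet> coord c (\<gamma> T)) - k * (m \<bullet> coord c (\<gamma> 0))\<bar> \<le> curve_length A g \<gamma>"
  proof (rule curve_length_ge[OF \<gamma> _ T(1,2) cA sub(1)])
    fix t assume t: "t \<in> {0..T}"
    show "((\<lambda>x. k * (m \<bullet> x)) has_derivative (\<lambda>v. k * (m \<bullet> v))) (at (coord c (\<gamma> t)))"
      by (auto intro!: derivative_eq_intros)
    fix v
    have "\<bar>m \<bullet> v\<bar> \<le> norm m * norm v" by (rule Cauchy_Schwarz_ineq2)
    also have "\<dots> \<le> norm v" using nm mult_right_mono[OF nm norm_ge_zero[of v]] by simp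
    finally have "\<bar>k * (m \<bullet> v)\<bar> \<le> k * norm v" using k by (simp add: abs_mult mult_left_mono)
    also have "\<dots> \<le> c2 * r (coord c (\<gamma> t)) powr - b * norm v"
      unfolding k_def using R[OF t] r_pos[OF sub(2)[OF t] pos[OF t]] const_pos
      by (intro mult_right_mono mult_left_mono powr_mono2') auto
    also have "\<dots> \<le> sqrt (g c (\<gamma> t) v v)"
      using g_lower[OF sub(2)[OF t] pos[OF t], of v] inv[OF t] by simp
    finally show "\<bar>k * (m \<bullet> v)\<bar> \<le> sqrt (g c (\<gamma> t) v v)" .
  qed simp
  moreover have "k * (m \<bullet> coord c (\<gamma> T)) - k * (m \<bullet> coord c (\<gamma> 0)) = k * (m \<bullet> w)"
    by (simp add: w_def inner_diff_right right_diff_distrib)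
  moreover have "m \<bullet> w = norm w"
    by (cases "w = 0") (simp_all add: m_def sgn_div_norm dot_square_norm power2_eq_square)
  ultimately show ?thesis using k by (simp add: w_def k_def dist_norm norm_minus_commute)
qed

lemma ball_sub_cball:
  assumes "u \<in> ball x0 (\<epsilon> / 4)" "\<delta> \<le> \<epsilon> / 2"
  shows "cball u \<delta> \<subseteq> ball x0 \<epsilon>"
proof
  fix z assume "z \<in> cball u \<delta>"
  then have "dist x0 z \<le> dist x0 u + \<delta>" using dist_triangle[of x0 z u] by simp
  then show "z \<in> ball x0 \<epsilon>" using assms const_pos by simp
qed

text \<open>Stop the curve when it is at distance \<open>\<delta> = dist (coord c x) (coord c y)\<close> from its start: either it
  has stayed where \<open>r \<le> \<delta>\<close>, or \<open>r\<close> has grown to \<open>\<delta>\<close>.\<close>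

lemma dist_lower:
  assumes b: "b < 1" and x: "x \<in> Y \<inter> nhd (\<epsilon> / 4)" and y: "y \<in> Y \<inter> nhd (\<epsilon> / 4)"
  shows "ennreal (lower_const * (norm (coord c x - coord c y) powr (1 - b) - r (coord c x) powr (1 - b))) \<le> d x y"
  unfolding riemannian_dist_def
proof (rule INF_greatest, clarify)
  fix \<gamma> assume \<gamma>: "piecewise_C1_curve X A Y \<gamma>" "x = \<gamma> 0" "y = \<gamma> 1"
  define u where "u = coord c (\<gamma> 0)"
  define \<delta> where "\<delta> = dist u (coord c (\<gamma> 1))"
  define m where "m = min c2 (c2 / (\<Lambda> * (1 - b)))"
  have m: "0 \<le> m" "m \<le> c2" "m \<le> c2 / (\<Lambda> * (1 - b))" using const_pos b by (auto simp: m_def)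
  have "ennreal (m * (\<delta> powr (1 - b) - r u powr (1 - b))) \<le> curve_length A g \<gamma>"
  proof (cases "\<delta> = 0")
    case True
    \<comment> \<open>The left side is then nonpositive, and \<open>ennreal\<close> sends it to
      0.\<close>
    then have "m * (\<delta> powr (1 - b) - r u powr (1 - b)) \<le> 0" using m(1) by (intro mult_nonneg_nonpos) auto
    then show ?thesis by (simp add: ennreal_neg)
  next
    case False
    then have \<delta>: "\<delta> > 0" by (simp add: \<delta>_def)
    have uB: "u \<in> ball x0 (\<epsilon> / 4)" "coord c (\<gamma> 1) \<in> ball x0 (\<epsilon> / 4)" using x y \<gamma> by (auto simp: u_def)
    then have "\<delta> \<le> \<epsilon> / 2" unfolding \<delta>_def using dist_triangle3[of u "coord c (\<gamma> 1)" x0] by simp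
    then have cb: "cball u \<delta> \<subseteq> ball x0 \<epsilon>" using ball_sub_cball uB by blast
    then have sub: "cball (coord c (\<gamma> 0)) \<delta> \<inter> corner_model (corner c) \<subseteq> coord c ` chart_dom c"
      using ball_sub by (auto simp: u_def)
    have 0: "\<gamma> 0 \<in> chart_dom c" using x \<gamma> by auto
    show ?thesis
    proof (rule curve_escape[OF \<gamma>(1) 0 \<delta> sub])
      assume stay: "\<gamma> ` {0..1} \<subseteq> chart_dom c" "\<And>t. t \<in> {0..1} \<Longrightarrow> dist (coord c (\<gamma> 0)) (coord c (\<gamma> t)) < \<delta>"
      \<comment> \<open>Impossible: the end point of the curve is at distance \<delta> from its
        start.\<close>
      then show ?thesis using stay(2)[of 1] by (simp add: \<delta>_def u_def)
    next
      fix T assume escape: "0 \<le> T" "T \<le> 1" "\<gamma> ` {0..T} \<subseteq> chart_dom c"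
        "\<And>t. t \<in> {0..T} \<Longrightarrow> dist (coord c (\<gamma> 0)) (coord c (\<gamma> t)) \<le> \<delta>"
        "dist (coord c (\<gamma> 0)) (coord c (\<gamma> T)) = \<delta>"
      have in_ball: "coord c (\<gamma> t) \<in> ball x0 \<epsilon>" if "t \<in> {0..T}" for t
        using escape(4)[OF that] cb by (auto simp: u_def)
      show ?thesis
      proof (cases "\<forall>t\<in>{0..T}. r (coord c (\<gamma> t)) \<le> \<delta>")
        case True
        have "m * (\<delta> powr (1 - b) - r u powr (1 - b)) \<le> m * \<delta> powr (1 - b)"
          using m(1) by (intro mult_left_mono) auto
        also have "\<dots> \<le> c2 * \<delta> powr (1 - b)" using m(2) by (intro mult_right_mono) auto
        also have "\<dots> = c2 * \<delta> powr - b * dist (coord c (\<gamma> 0)) (coord c (\<gamma> T))"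
          using \<delta> by (simp add: escape(5) powr_diff powr_minus field_simps)
        finally have "ennreal (m * (\<delta> powr (1 - b) - r u powr (1 - b))) \<le> ennreal (c2 * \<delta> powr - b * dist (coord c (\<gamma> 0)) (coord c (\<gamma> T)))"
          by (rule ennreal_leI)
        also have "\<dots> \<le> curve_length A g \<gamma>"
          by (rule curve_length_ge_linear[OF \<gamma>(1) escape(1-3) in_ball True[rule_format]])
        finally show ?thesis .
      next
        case False
        then obtain t where t: "t \<in> {0..T}" "\<delta> < r (coord c (\<gamma> t))" by force
        have st: "{0..t} \<subseteq> {0..T}" using t by auto
        \<comment> \<open>Its derivative is \<open>c2 / \<Lambda> * s powr - b\<close>, the largest
          slope that the calibration permits.\<close>
        define \<psi> where "\<psi> s = c2 / (\<Lambda> * (1 - b)) * s powr (1 - b)" for s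
        have "m * (\<delta> powr (1 - b) - r u powr (1 - b)) \<le> \<bar>\<psi> (r (coord c (\<gamma> t))) - \<psi> (r (coord c (\<gamma> 0)))\<bar>"
        proof (cases "\<delta> powr (1 - b) \<le> r u powr (1 - b)")
          case True
          then have "m * (\<delta> powr (1 - b) - r u powr (1 - b)) \<le> 0" using m(1) by (intro mult_nonneg_nonpos) auto
          then show ?thesis by linarith
        next
          case False
          have "m * (\<delta> powr (1 - b) - r u powr (1 - b)) \<le> c2 / (\<Lambda> * (1 - b)) * (\<delta> powr (1 - b) - r u powr (1 - b))"
            using False m(3) by (intro mult_right_mono) auto
          also have "\<dots> \<le> c2 / (\<Lambda> * (1 - b)) * (r (coord c (\<gamma> t)) powr (1 - b) - r u powr (1 - b))"
            using t(2) \<delta> b const_pos by (intro mult_left_mono diff_right_mono powr_mono2) auto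
          also have "\<dots> = \<psi> (r (coord c (\<gamma> t))) - \<psi> (r (coord c (\<gamma> 0)))"
            unfolding \<psi>_def u_def by (rule right_diff_distrib)
          finally show ?thesis by linarith
        qed
        then have "ennreal (m * (\<delta> powr (1 - b) - r u powr (1 - b))) \<le> ennreal \<bar>\<psi> (r (coord c (\<gamma> t))) - \<psi> (r (coord c (\<gamma> 0)))\<bar>"
          by (rule ennreal_leI)
        also have "\<dots> \<le> curve_length A g \<gamma>"
        proof (rule curve_length_ge_radial[OF \<gamma>(1)])
          show "0 \<le> t" "t \<le> 1" using t escape(2) by auto
          show "\<gamma> ` {0..t} \<subseteq> chart_dom c" using escape(3) st by blast
          show "coord c (\<gamma> s) \<in> ball x0 \<epsilon>" if "s \<in> {0..t}" for s using in_ball that st by blast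
          show "(\<psi> has_real_derivative c2 / \<Lambda> * s powr - b) (at s)" if "0 < s" for s
            unfolding \<psi>_def using that b const_pos by (auto intro!: derivative_eq_intros)
          show "\<Lambda> * \<bar>c2 / \<Lambda> * s powr - b\<bar> \<le> c2 * s powr - b" if "0 < s" for s
            using const_pos by (simp add: abs_mult)
        qed
        finally show ?thesis .
      qed
    qed
  qed
  then show "ennreal (lower_const * (norm (coord c (\<gamma> 0) - coord c (\<gamma> 1)) powr (1 - b) - r (coord c (\<gamma> 0)) powr (1 - b))) \<le> curve_length A g \<gamma>"
    by (simp add: m_def lower_const_def \<delta>_def u_def dist_norm)
qed

text \<open>For \<open>b \<ge> 1\<close> and \<open>r < 1\<close> the factor
  \<open>r powr - b\<close> dominates \<open>1 / r\<close>, so a multiple of \<open>ln r\<close>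
  calibrates. The other entry of the minimum is the price of leaving the coordinate ball of radius
  \<open>\<epsilon> / 2\<close>.\<close>

lemma dist_lower_log:
  assumes b: "b \<ge> 1" and x: "x \<in> Y \<inter> nhd (\<epsilon> / 4)" and y: "y \<in> Y \<inter> nhd (\<epsilon> / 4)"
  shows "ennreal (min (c2 * (\<epsilon> / 2)) (c2 / \<Lambda> * \<bar>ln (r (coord c y)) - ln (r (coord c x))\<bar>)) \<le> d x y"
  unfolding riemannian_dist_def
proof (rule INF_greatest, clarify)
  fix \<gamma> assume \<gamma>: "piecewise_C1_curve X A Y \<gamma>" "x = \<gamma> 0" "y = \<gamma> 1"
  define u where "u = coord c (\<gamma> 0)"
  have uB: "u \<in> ball x0 (\<epsilon> / 4)" using x \<gamma> by (auto simp: u_def)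
  then have cb: "cball u (\<epsilon> / 2) \<subseteq> ball x0 \<epsilon>" using ball_sub_cball by blast
  then have sub: "cball (coord c (\<gamma> 0)) (\<epsilon> / 2) \<inter> corner_model (corner c) \<subseteq> coord c ` chart_dom c"
    using ball_sub by (auto simp: u_def)
  have 0: "\<gamma> 0 \<in> chart_dom c" and \<delta>: "\<epsilon> / 2 > 0" using x \<gamma> const_pos by auto
  let ?k = "min (c2 * (\<epsilon> / 2)) (c2 / \<Lambda> * \<bar>ln (r (coord c (\<gamma> 1))) - ln (r (coord c (\<gamma> 0)))\<bar>)"
  show "ennreal ?k \<le> curve_length A g \<gamma>"
  proof (rule curve_escape[OF \<gamma>(1) 0 \<delta> sub])
    assume stay: "\<gamma> ` {0..1} \<subseteq> chart_dom c" "\<And>t. t \<in> {0..1} \<Longrightarrow> dist (coord c (\<gamma> 0)) (coord c (\<gamma> t)) < \<epsilon> / 2"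
    define \<psi> where "\<psi> s = c2 / \<Lambda> * ln s" for s
    have "\<bar>\<psi> (r (coord c (\<gamma> 1))) - \<psi> (r (coord c (\<gamma> 0)))\<bar> = c2 / \<Lambda> * \<bar>ln (r (coord c (\<gamma> 1))) - ln (r (coord c (\<gamma> 0)))\<bar>"
      unfolding \<psi>_def right_diff_distrib[symmetric] abs_mult using const_pos by simp
    then have "ennreal ?k \<le> ennreal \<bar>\<psi> (r (coord c (\<gamma> 1))) - \<psi> (r (coord c (\<gamma> 0)))\<bar>"
      by (intro ennreal_leI) linarith
    also have "\<dots> \<le> curve_length A g \<gamma>"
    proof (rule curve_length_ge_radial[OF \<gamma>(1)])
      show "\<gamma> ` {0..1} \<subseteq> chart_dom c" by (rule stay(1))
      show "coord c (\<gamma> s) \<in> ball x0 \<epsilon>" if "s \<in> {0..1}" for s using stay(2)[OF that] by (intro subsetD[OF cb]) (simp add: u_def less_imp_le)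
      show "(\<psi> has_real_derivative c2 / \<Lambda> * (1 / s)) (at s)" if "0 < s" for s
        unfolding \<psi>_def using that const_pos by (auto intro!: derivative_eq_intros)
      show "\<Lambda> * \<bar>c2 / \<Lambda> * (1 / s)\<bar> \<le> c2 * s powr - b" if s: "0 < s" "s < 1" for s
      proof -
        have "s powr - 1 \<le> s powr - b" using s b by (intro powr_mono') auto
        then have "c2 * (1 / s) \<le> c2 * s powr - b"
          using const_pos s by (intro mult_left_mono) (auto simp: powr_minus divide_inverse)
        moreover have "\<Lambda> * \<bar>c2 / \<Lambda> * (1 / s)\<bar> = c2 * (1 / s)"
          using const_pos s by (simp add: abs_mult)
        ultimately show ?thesis by linarith
      qed
    qed auto
    finally show "ennreal ?k \<le> curve_length A g \<gamma>" .
  next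
    fix T assume escape: "0 \<le> T" "T \<le> 1" "\<gamma> ` {0..T} \<subseteq> chart_dom c"
      "\<And>t. t \<in> {0..T} \<Longrightarrow> dist (coord c (\<gamma> 0)) (coord c (\<gamma> t)) \<le> \<epsilon> / 2"
      "dist (coord c (\<gamma> 0)) (coord c (\<gamma> T)) = \<epsilon> / 2"
    have in_ball: "coord c (\<gamma> t) \<in> ball x0 \<epsilon>" if "t \<in> {0..T}" for t
      using escape(4)[OF that] cb by (auto simp: u_def)
    \<comment> \<open>On the ball \<open>r < 1\<close>, so the linear calibration holds with
      \<open>R = 1\<close>.\<close>
    have "ennreal ?k \<le> ennreal (c2 * 1 powr - b * dist (coord c (\<gamma> 0)) (coord c (\<gamma> T)))"
      unfolding escape(5) powr_one_eq_one mult_1_right by (intro ennreal_leI min.cobounded1)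
    also have "\<dots> \<le> curve_length A g \<gamma>"
      by (rule curve_length_ge_linear[OF \<gamma>(1) escape(1-3) in_ball less_imp_le[OF r_less_1[OF in_ball]]])
    finally show ?thesis .
  qed
qed

end

lemma isCont_eventually_nhds:
  fixes f :: "'a::t2_space \<Rightarrow> real"
  assumes "isCont f x"
  shows "a < f x \<Longrightarrow> \<forall>\<^sub>F y in nhds x. a < f y" "f x < a \<Longrightarrow> \<forall>\<^sub>F y in nhds x. f y < a"
proof -
  have "(f \<longlongrightarrow> f x) (nhds x)" using assms by (simp add: isCont_def tendsto_at_iff_tendsto_nhds)
  then show "a < f x \<Longrightarrow> \<forall>\<^sub>F y in nhds x. a < f y" "f x < a \<Longrightarrow> \<forall>\<^sub>F y in nhds x. f y < a"
    by (auto simp: order_tendsto_iff)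
qed

section \<open>Product metrics\<close>

text \<open>Each hypersurface is encoded as the zero set of its \<open>\<rho> i\<close>;
  boundary-defining then means smooth, nonnegative, and with nonvanishing derivative at the
  zeros.\<close>

locale singular_product = corner_atlas X A
  for X :: "'a topology" and A :: "('a, 'n::finite) corner_chart set" +
  fixes N :: nat and \<rho> :: "nat \<Rightarrow> 'a \<Rightarrow> real" and \<alpha> :: "nat \<Rightarrow> real" and g0 :: "('a, 'n) tensor2"
  assumes smooth: "\<And>i. i \<in> {1..N} \<Longrightarrow> smooth_function A (\<rho> i)"
    and nonneg: "\<And>i p. i \<in> {1..N} \<Longrightarrow> p \<in> topspace X \<Longrightarrow> 0 \<le> \<rho> i p"
    and nondegenerate: "\<And>i p c. i \<in> {1..N} \<Longrightarrow> p \<in> topspace X \<Longrightarrow> \<rho> i p = 0 \<Longrightarrow> c \<in> A \<Longrightarrow> p \<in> chart_dom c \<Longrightarrow>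
      frechet_derivative (\<rho> i \<circ> chart_inv c) (at (coord c p) within coord c ` chart_dom c) \<noteq> (\<lambda>_. 0)"
    and metric: "riemannian_metric A g0"
    and exponents: "\<And>i. i \<in> {1..N} \<Longrightarrow> 0 \<le> \<alpha> i"
begin

sublocale corner_tensor X A "product_metric N \<rho> \<alpha> g0"
proof
  fix c p assume "c \<in> A" "p \<in> chart_dom c"
  then have "bilinear (g0 c p)" using metric unfolding riemannian_metric_def by blast
  then show "bilinear (product_metric N \<rho> \<alpha> g0 c p)"
    by (simp add: product_metric_def bilinear_def linear_iff algebra_simps)
next
  fix c c' p and v :: "real ^ 'n" assume *: "c \<in> A" "c' \<in> A" "p \<in> chart_dom c \<inter> chart_dom c'" "p \<in> Y"
  then have "\<forall>v w. g0 c p v w = g0 c' p (transition_deriv c c' p v) (transition_deriv c c' p w)"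
    using metric unfolding riemannian_metric_def Let_def by blast
  then show "product_metric N \<rho> \<alpha> g0 c p v v = product_metric N \<rho> \<alpha> g0 c' p (transition_deriv c c' p v) (transition_deriv c c' p v)"
    by (simp add: product_metric_def)
qed

lemma coord_in_model: "c \<in> A \<Longrightarrow> p \<in> chart_dom c \<Longrightarrow> coord c p \<in> corner_model (corner c)"
  by (simp add: corner_model_def coord_nonneg[OF is_chart])

text \<open>Bundled into one predicate so that a single choice over i yields radius, extension,
  differential and bound together.\<close>

definition local_ext :: "nat \<Rightarrow> ('a, 'n) corner_chart \<Rightarrow> 'a \<Rightarrow> real \<Rightarrow> (real ^ 'n \<Rightarrow> real) \<Rightarrow>
    (real ^ 'n \<Rightarrow> real ^ 'n \<Rightarrow> real) \<Rightarrow> real \<Rightarrow> bool" where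
  "local_ext i c p e G G' L \<longleftrightarrow> e > 0 \<and> L > 0 \<and>
     ball (coord c p) e \<inter> corner_model (corner c) \<subseteq> coord c ` chart_dom c \<and>
     (\<forall>y\<in>ball (coord c p) e. (G has_derivative G' y) (at y)) \<and>
     (\<forall>y\<in>ball (coord c p) e. \<forall>v. \<bar>G' y v\<bar> \<le> L * norm v) \<and>
     (\<forall>v. continuous_on (ball (coord c p) e) (\<lambda>y. G' y v)) \<and>
     (\<forall>y\<in>ball (coord c p) e \<inter> coord c ` chart_dom c. G y = \<rho> i (chart_inv c y)) \<and>
     (\<rho> i p = 0 \<longrightarrow> 0 < G' (coord c p) (inward (corner c) (coord c p)))"

lemma local_extension:
  assumes i: "i \<in> {1..N}" and c: "c \<in> A" "p \<in> chart_dom c"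
  shows "\<exists>e G G' L. local_ext i c p e G G' L"
proof -
  let ?S = "coord c ` chart_dom c" and ?x = "coord c p" and ?f = "\<rho> i \<circ> chart_inv c"
  note chart = is_chart[OF c(1)]
  have sm: "smooth_map_on ?S ?f" using smooth[OF i] c(1) by (simp add: smooth_function_def)
  have xS: "?x \<in> ?S" using c(2) by (rule imageI)
  show ?thesis
  proof (rule smooth_map_on_local_C1[OF sm xS])
    fix e1 L :: real and G :: "real ^ 'n \<Rightarrow> real" and G'
    assume G: "e1 > 0" "L > 0" "\<And>y. y \<in> ball ?x e1 \<Longrightarrow> (G has_derivative G' y) (at y)"
      "\<And>y v. y \<in> ball ?x e1 \<Longrightarrow> norm (G' y v) \<le> L * norm v"
      "\<And>v. continuous_on (ball ?x e1) (\<lambda>y. G' y v)" "\<And>y. y \<in> ball ?x e1 \<inter> ?S \<Longrightarrow> G y = ?f y"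
    have "openin X (chart_dom c)" using chart by (simp add: is_chart_def)
    from coord_image_contains_ball[OF chart this order_refl c(2)]
    obtain e2 where e2: "e2 > 0" "ball ?x e2 \<inter> corner_model (corner c) \<subseteq> ?S"
      by metis
    define e where "e = min e1 e2"
    have e: "e > 0" "ball ?x e \<subseteq> ball ?x e1" "ball ?x e \<subseteq> ball ?x e2" using G(1) e2(1) by (auto simp: e_def)
    have inw: "0 < G' ?x (inward (corner c) ?x)" if zero: "\<rho> i p = 0"
    proof (rule inward_derivative_pos[of ?x "corner c" e ?S ?f G])
      show "ball ?x e \<inter> corner_model (corner c) \<subseteq> ?S" "e > 0" using e2(2) e by auto
      show "?x \<in> corner_model (corner c)" using coord_in_model c by blast
      show "?f ?x = 0" using zero chart_inv_coord[OF chart c(2)] by simp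
      show "0 \<le> ?f y" if "y \<in> ?S" for y
        using nonneg[OF i] chart_inv_in_dom(1)[OF chart that] chart_homeo(3)[OF chart] by auto
      show "frechet_derivative ?f (at ?x within ?S) \<noteq> (\<lambda>_. 0)"
        using nondegenerate[OF i _ zero c] c(2) chart_homeo(3)[OF chart] by blast
      show "(G has_derivative G' ?x) (at ?x)" using G(1,3) by simp
      show "G y = ?f y" if "y \<in> ball ?x e \<inter> ?S" for y using G(6) e(2) that by blast
    qed
    show "\<exists>e G G' L. local_ext i c p e G G' L"
      unfolding local_ext_def
    proof (rule exI[of _ e], rule exI[of _ G], rule exI[of _ G'], rule exI[of _ L], intro conjI ballI allI)
      show "ball ?x e \<inter> corner_model (corner c) \<subseteq> ?S" using e2(2) e(3) by blast
      show "continuous_on (ball ?x e) (\<lambda>y. G' y v)" for v by (rule continuous_on_subset[OF G(5) e(2)])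
      show "(G has_derivative G' y) (at y)" if "y \<in> ball ?x e" for y
        using G(3)[OF subsetD[OF e(2) that]] .
      show "\<bar>G' y v\<bar> \<le> L * norm v" if "y \<in> ball ?x e" for y v
        using G(4)[OF subsetD[OF e(2) that]] by simp
      show "G y = \<rho> i (chart_inv c y)" if "y \<in> ball ?x e \<inter> ?S" for y
        using G(6)[of y] subsetD[OF e(2), of y] that by auto
    qed (use e(1) G(2) inw in auto)
  qed
qed

text \<open>At an interior point the inward vector is 0, while a zero of \<open>\<rho> i\<close>
  would force a positive derivative along it.\<close>

lemma \<rho>_pos:
  assumes i: "i \<in> {1..N}" and p: "p \<in> Y"
  shows "0 < \<rho> i p"
proof -
  obtain c where c: "c \<in> A" "p \<in> chart_dom c" using chart_exists p Y_subset by blast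
  have "inward (corner c) (coord c p) = 0"
    using Y_iff[OF c] p by (auto simp: inward_def vec_eq_iff)
  moreover obtain G G' where G: "(G has_derivative G') (at (coord c p))"
    "\<rho> i p = 0 \<longrightarrow> 0 < (G' (inward (corner c) (coord c p)) :: real)"
    using local_extension[OF i c] unfolding local_ext_def by (meson centre_in_ball)
  ultimately have "\<rho> i p \<noteq> 0" using linear_0[OF has_derivative_linear[OF G(1)]] by auto
  then show ?thesis using nonneg[OF i, of p] p Y_subset by (auto simp: less_le)
qed

text \<open>The function r is the sum of the local extensions \<open>G i\<close> over I. The
  constants collect the bounds of the smooth metric, the weights of the indices outside I, and the
  growth rate a of the \<open>\<rho> i\<close> along the inward diagonal.\<close>

lemma near_face_exists:
  assumes c: "c \<in> A" "p \<in> chart_dom c" and I: "I = {i \<in> {1..N}. \<rho> i p = 0}" "I \<noteq> {}"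
  shows "\<exists>\<epsilon> r r' c2 C2 \<Lambda>. near_face X A (product_metric N \<rho> \<alpha> g0) c (coord c p) (inward (corner c) (coord c p))
      \<epsilon> r r' ((\<Sum>i\<in>I. \<alpha> i) / 2) c2 C2 \<Lambda> \<and>
    (\<forall>x\<in>ball (coord c p) \<epsilon> \<inter> corner_model (corner c). r x = (\<Sum>i\<in>I. \<rho> i (chart_inv c x)))"
proof -
  define x0 e0 K S where "x0 = coord c p" and "e0 = inward (corner c) (coord c p)"
    and "K = corner c" and "S = coord c ` chart_dom c"
  note chart = is_chart[OF c(1)]
  have IN: "I \<subseteq> {1..N}" "finite I" using I by auto
  have \<rho>p: "0 < \<rho> i p" if "i \<in> {1..N} - I" for i
    using nonneg[of i p] that I chart_homeo(3)[OF chart] c(2) by (auto simp: less_le)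
  have x0S: "x0 \<in> S" and inv0: "chart_inv c x0 = p"
    using c(2) chart_inv_coord[OF chart] by (auto simp: x0_def S_def)
  have "\<forall>i. \<exists>e G G' L. i \<in> {1..N} \<longrightarrow> local_ext i c p e G G' L" using local_extension c by blast
  then obtain e G G' L where ext: "\<And>i. i \<in> {1..N} \<Longrightarrow> local_ext i c p (e i) (G i) (G' i) (L i)"
    by metis
  have e: "e i > 0" "L i > 0" and sub: "ball x0 (e i) \<inter> corner_model K \<subseteq> S"
    and deriv: "\<And>y. y \<in> ball x0 (e i) \<Longrightarrow> (G i has_derivative G' i y) (at y)"
    and bound: "\<And>y v. y \<in> ball x0 (e i) \<Longrightarrow> \<bar>G' i y v\<bar> \<le> L i * norm v"
    and cont: "\<And>v. continuous_on (ball x0 (e i)) (\<lambda>y. G' i y v)"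
    and G_eq: "\<And>y. y \<in> ball x0 (e i) \<Longrightarrow> y \<in> S \<Longrightarrow> G i y = \<rho> i (chart_inv c y)"
    and inw: "\<rho> i p = 0 \<Longrightarrow> 0 < G' i x0 e0" if "i \<in> {1..N}" for i
    using ext[OF that] unfolding local_ext_def x0_def e0_def K_def S_def by auto
  have Gx0: "G i x0 = \<rho> i p" if "i \<in> {1..N}" for i
    using G_eq[OF that _ x0S] e[OF that] inv0 by simp
  have contG: "isCont (G i) x0" if "i \<in> {1..N}" for i
    using deriv[OF that, of x0] e[OF that] has_derivative_continuous by auto
  define r where "r x = (\<Sum>i\<in>I. G i x)" for x
  define r' where "r' x v = (\<Sum>i\<in>I. G' i x v)" for x v
  \<comment> \<open>Half the least inward derivative, so that the strict bound persists near
    \<open>x0\<close>.\<close>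
  define a where "a = Min ((\<lambda>i. G' i x0 e0 / 2) ` I)"
  have Gpos: "0 < G' i x0 e0" if "i \<in> I" for i using inw[of i] that I(1) by simp
  then have a: "0 < a" using IN(2) I(2) by (simp add: a_def)
  have a_less: "a < G' i x0 e0" if "i \<in> I" for i
  proof -
    have "a \<le> G' i x0 e0 / 2" unfolding a_def using IN(2) that by (intro Min_le) auto
    then show ?thesis using Gpos[OF that] by simp
  qed
  obtain \<kappa> M where \<kappa>: "0 < \<kappa>" "0 < M"
    "\<forall>\<^sub>F x in nhds x0. x \<in> S \<longrightarrow> (\<forall>v. \<kappa> * (norm v)\<^sup>2 \<le> g0 c (chart_inv c x) v v \<and> g0 c (chart_inv c x) v v \<le> M * (norm v)\<^sup>2)"
  proof (rule inner_product_family_bounds[of S "\<lambda>x. g0 c (chart_inv c x)" x0])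
    fix x assume "x \<in> S"
    then show "bilinear (g0 c (chart_inv c x))"
      using metric c(1) chart_inv_in_dom(1)[OF chart, of x] unfolding riemannian_metric_def S_def by blast
  next
    fix v :: "real ^ 'n" assume "v \<noteq> 0"
    then show "0 < g0 c (chart_inv c x0) v v"
      using metric c unfolding riemannian_metric_def inv0 by blast
  next
    fix v w
    show "continuous_on S (\<lambda>x. g0 c (chart_inv c x) v w)"
      using metric c(1) unfolding riemannian_metric_def S_def by (intro smooth_map_on_continuous) blast
  qed (use x0S in auto)
  have "\<forall>\<^sub>F x in nhds x0. \<forall>i\<in>{1..N}. x \<in> ball x0 (e i)"
    using e by (intro eventually_ball_finite ballI eventually_nhds_in_open) auto
  moreover have "\<forall>\<^sub>F x in nhds x0. \<forall>i\<in>I. a < G' i x e0"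
  proof (intro eventually_ball_finite ballI IN(2))
    fix i assume i: "i \<in> I"
    then have i': "i \<in> {1..N}" using IN by blast
    have "isCont (\<lambda>y. G' i y e0) x0"
      using cont[OF i'] e(1)[OF i'] by (simp add: continuous_on_eq_continuous_at)
    then show "\<forall>\<^sub>F x in nhds x0. a < G' i x e0" by (rule isCont_eventually_nhds(1)) (rule a_less[OF i])
  qed
  moreover have "\<forall>\<^sub>F x in nhds x0. \<forall>i\<in>{1..N} - I. \<rho> i p / 2 < G i x"
    using contG \<rho>p Gx0 by (intro eventually_ball_finite ballI isCont_eventually_nhds(1)) auto
  moreover have "\<forall>\<^sub>F x in nhds x0. \<forall>i\<in>{1..N} - I. G i x < 2 * \<rho> i p"
    using contG \<rho>p Gx0 by (intro eventually_ball_finite ballI isCont_eventually_nhds(2)) auto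
  moreover have "\<forall>\<^sub>F x in nhds x0. r x < 1"
  proof (rule isCont_eventually_nhds(2))
    show "isCont r x0" unfolding r_def using contG IN by (intro continuous_intros) auto
    show "r x0 < 1" using Gx0 I(1) by (simp add: r_def)
  qed
  moreover have "\<forall>\<^sub>F x in nhds x0. \<forall>j\<in>{j\<in>K. x0 $ j \<noteq> 0}. 0 < x $ j"
  proof (intro eventually_ball_finite ballI)
    fix j assume "j \<in> {j\<in>K. x0 $ j \<noteq> 0}"
    then have "0 < x0 $ j" using coord_nonneg[OF chart c(2), of j] by (simp add: x0_def K_def less_le)
    moreover have "isCont (\<lambda>x. x $ j) x0" by (intro continuous_intros)
    ultimately show "\<forall>\<^sub>F x in nhds x0. 0 < x $ j" by (rule isCont_eventually_nhds(1)[rotated])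
  qed simp
  moreover note \<kappa>(3)
  ultimately have "\<forall>\<^sub>F x in nhds x0. (\<forall>i\<in>{1..N}. x \<in> ball x0 (e i)) \<and> (\<forall>i\<in>I. a < G' i x e0) \<and>
      (\<forall>i\<in>{1..N} - I. \<rho> i p / 2 < G i x) \<and> (\<forall>i\<in>{1..N} - I. G i x < 2 * \<rho> i p) \<and> r x < 1 \<and>
      (\<forall>j\<in>{j\<in>K. x0 $ j \<noteq> 0}. 0 < x $ j) \<and>
      (x \<in> S \<longrightarrow> (\<forall>v. \<kappa> * (norm v)\<^sup>2 \<le> g0 c (chart_inv c x) v v \<and> g0 c (chart_inv c x) v v \<le> M * (norm v)\<^sup>2))" (is "\<forall>\<^sub>F x in _. ?near x")
    by (intro eventually_conj)
  then obtain \<epsilon> where \<epsilon>: "\<epsilon> > 0" and near: "\<And>x. dist x x0 < \<epsilon> \<Longrightarrow> ?near x"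
    unfolding eventually_nhds_metric by auto
  have nb: "\<And>i. i \<in> {1..N} \<Longrightarrow> x \<in> ball x0 (e i)" "\<And>i. i \<in> I \<Longrightarrow> a \<le> G' i x e0"
      "\<And>i. i \<in> {1..N} - I \<Longrightarrow> \<rho> i p / 2 \<le> G i x" "\<And>i. i \<in> {1..N} - I \<Longrightarrow> G i x \<le> 2 * \<rho> i p" "r x < 1"
      "\<And>j. j \<in> K \<Longrightarrow> x0 $ j \<noteq> 0 \<Longrightarrow> 0 < x $ j"
      "\<And>v. x \<in> S \<Longrightarrow> \<kappa> * (norm v)\<^sup>2 \<le> g0 c (chart_inv c x) v v"
      "\<And>v. x \<in> S \<Longrightarrow> g0 c (chart_inv c x) v v \<le> M * (norm v)\<^sup>2" if "x \<in> ball x0 \<epsilon>" for x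
    using near[of x] that by (auto simp: dist_commute less_imp_le)
  obtain i0 where i0: "i0 \<in> I" using I(2) by blast
  then have i0': "i0 \<in> {1..N}" using IN by blast
  have ball_S: "ball x0 \<epsilon> \<inter> corner_model K \<subseteq> S" using nb(1)[OF _ i0'] sub[OF i0'] by blast
  have G_\<rho>: "G i x = \<rho> i (chart_inv c x)" if "x \<in> ball x0 \<epsilon>" "x \<in> corner_model K" "i \<in> {1..N}" for i x
    using G_eq[OF that(3) nb(1)[OF that(1,3)]] ball_S that by blast
  have G_nonneg: "0 \<le> G i x" if "x \<in> ball x0 \<epsilon>" "x \<in> corner_model K" "i \<in> {1..N}" for i x
  proof -
    have "x \<in> coord c ` chart_dom c" using ball_S that by (auto simp: S_def)
    then have "chart_inv c x \<in> topspace X" using chart_inv_in_dom(1)[OF chart] chart_homeo(3)[OF chart] by blast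
    then show ?thesis using G_\<rho>[OF that] nonneg[OF that(3)] by simp
  qed
  have pos_model: "x \<in> corner_model K" if "\<And>j. j \<in> K \<Longrightarrow> 0 < x $ j" for x
    using that by (simp add: corner_model_def less_imp_le)
  have G_pos: "0 < G i x" if "x \<in> ball x0 \<epsilon>" "\<And>j. j \<in> K \<Longrightarrow> 0 < x $ j" "i \<in> {1..N}" for i x
  proof -
    have xS: "x \<in> S" using ball_S that(1) pos_model[OF that(2)] by blast
    then have "chart_inv c x \<in> Y"
      using Y_iff[OF c(1), of "chart_inv c x"] chart_inv_in_dom[OF chart, of x] that(2) by (simp add: S_def K_def)
    then show ?thesis using \<rho>_pos[OF that(3)] G_\<rho>[OF that(1) pos_model[OF that(2)] that(3)] by simp
  qed
  define AI where "AI = (\<Sum>i\<in>I. \<alpha> i)"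
  \<comment> \<open>Near p the \<open>\<rho> i\<close> with i outside I lie between half and twice
    their value at p. Exponents are nonpositive, so twice the value serves for the lower bound and
    half of it for the upper.\<close>
  define P1 P2 where "P1 = (\<Prod>i\<in>{1..N} - I. (2 * \<rho> i p) powr - \<alpha> i)"
    and "P2 = (\<Prod>i\<in>{1..N} - I. (\<rho> i p / 2) powr - \<alpha> i)"
  have P: "P1 > 0" "P2 > 0" unfolding P1_def P2_def using less_imp_neq[OF \<rho>p] by (auto intro!: prod_pos)
  have half: "(y powr - (AI / 2))\<^sup>2 = y powr - AI" for y :: real
    by (simp add: power2_eq_square flip: powr_add)
  \<comment> \<open>Coordinates of walls through \<open>x0\<close> are raised by s; the remaining
    corner coordinates are positive on the whole ball.\<close>
  have inw_pos: "0 < (x + s *\<^sub>R e0) $ j" if "x \<in> ball x0 \<epsilon> \<inter> corner_model K" "s > 0" "j \<in> K" for x s j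
  proof (cases "x0 $ j = 0")
    case True
    then have "e0 $ j = 1" using that(3) by (simp add: e0_def inward_def x0_def K_def)
    moreover have "0 \<le> x $ j" using that by (simp add: corner_model_def)
    ultimately show ?thesis using that(2) by simp
  next
    case False
    then have "e0 $ j = 0" by (simp add: e0_def inward_def x0_def)
    then show ?thesis using nb(6)[of x j] that False by simp
  qed
  \<comment> \<open>The derivative of \<open>G i\<close> along the inward diagonal is at least a,
    and the segment starts where \<open>G i\<close> is nonnegative. So every \<open>\<rho> i\<close>
    with i in I is at least \<open>a * s\<close> after a step s.\<close>
  have increase: "a * s \<le> G i (x + s *\<^sub>R e0)"
    if x: "x \<in> ball x0 \<epsilon> \<inter> corner_model K" and s: "s > 0" "x + s *\<^sub>R e0 \<in> ball x0 \<epsilon>" and i: "i \<in> I" for x s i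
  proof -
    have i': "i \<in> {1..N}" using i IN by blast
    have seg: "x + t *\<^sub>R e0 \<in> ball x0 \<epsilon>" if "0 \<le> t" "t \<le> s" for t
    proof -
      have "(1 - t / s) *\<^sub>R x + (t / s) *\<^sub>R (x + s *\<^sub>R e0) \<in> ball x0 \<epsilon>"
        using convexD[OF convex_ball, of x x0 \<epsilon> "x + s *\<^sub>R e0" "1 - t / s" "t / s"] x s that by simp
      moreover have "(1 - t / s) *\<^sub>R x + (t / s) *\<^sub>R (x + s *\<^sub>R e0) = x + t *\<^sub>R e0"
        using s(1) by (simp add: scaleR_left_diff_distrib scaleR_right_distrib)
      ultimately show ?thesis by simp
    qed
    have "(\<lambda>t. G i (x + t *\<^sub>R e0) - a * t) 0 \<le> (\<lambda>t. G i (x + t *\<^sub>R e0) - a * t) s"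
    proof (rule DERIV_nonneg_imp_nondecreasing[where f = "\<lambda>t. G i (x + t *\<^sub>R e0) - a * t"])
      fix t assume t: "0 \<le> t" "t \<le> s"
      have line: "((\<lambda>t. x + t *\<^sub>R e0) has_derivative (\<lambda>h. h *\<^sub>R e0)) (at t)"
        by (auto intro!: derivative_eq_intros)
      have D: "(G i has_derivative G' i (x + t *\<^sub>R e0)) (at (x + t *\<^sub>R e0))"
        by (rule deriv[OF i' nb(1)[OF seg[OF t] i']])
      have "((\<lambda>t. G i (x + t *\<^sub>R e0)) has_derivative (\<lambda>h. h * G' i (x + t *\<^sub>R e0) e0)) (at t)"
        using diff_chain_at[OF line D] has_derivative_linear[OF D] by (simp add: o_def linear_cmul)
      then have "((\<lambda>t. G i (x + t *\<^sub>R e0)) has_real_derivative G' i (x + t *\<^sub>R e0) e0) (at t)"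
        by (simp add: has_field_derivative_def mult.commute[of _ "G' i (x + t *\<^sub>R e0) e0"])
      then have "((\<lambda>t. G i (x + t *\<^sub>R e0) - a * t) has_real_derivative G' i (x + t *\<^sub>R e0) e0 - a) (at t)"
        by (auto intro!: derivative_eq_intros)
      moreover have "0 \<le> G' i (x + t *\<^sub>R e0) e0 - a" using nb(2)[OF seg[OF t] i] by simp
      ultimately show "\<exists>y. ((\<lambda>t. G i (x + t *\<^sub>R e0) - a * t) has_real_derivative y) (at t) \<and> 0 \<le> y" by blast
    qed (use s in simp)
    then show ?thesis using G_nonneg[of x i] x i' by simp
  qed
  have "near_face X A (product_metric N \<rho> \<alpha> g0) c x0 e0 \<epsilon> r r' (AI / 2) (sqrt (\<kappa> * P1)) (sqrt (M * a powr - AI * P2)) (\<Sum>i\<in>I. L i)"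
  proof (intro near_face.intro[OF corner_tensor_axioms] near_face_axioms.intro)
    show "c \<in> A" "\<epsilon> > 0" by fact+
    show "sqrt (\<kappa> * P1) > 0" "sqrt (M * a powr - AI * P2) > 0" using \<kappa> P a by auto
    show "(\<Sum>i\<in>I. L i) > 0" using e(2) IN I(2) by (intro sum_pos) auto
    show "AI / 2 \<ge> 0" unfolding AI_def using exponents IN by (intro divide_nonneg_nonneg sum_nonneg) auto
    show "ball x0 \<epsilon> \<inter> corner_model (corner c) \<subseteq> coord c ` chart_dom c" using ball_S by (simp add: K_def S_def)
    show "(r has_derivative r' x) (at x)" if "x \<in> ball x0 \<epsilon>" for x
      unfolding r_def r'_def using deriv nb(1)[OF that] IN(1) by (intro has_derivative_sum) blast
    show "\<bar>r' x v\<bar> \<le> (\<Sum>i\<in>I. L i) * norm v" if "x \<in> ball x0 \<epsilon>" for x v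
    proof -
      have "\<bar>r' x v\<bar> \<le> (\<Sum>i\<in>I. \<bar>G' i x v\<bar>)" unfolding r'_def by (rule sum_abs)
      also have "\<dots> \<le> (\<Sum>i\<in>I. L i * norm v)" using bound nb(1)[OF that] IN(1) by (intro sum_mono) blast
      finally show ?thesis by (simp add: sum_distrib_right)
    qed
    show "r x < 1" if "x \<in> ball x0 \<epsilon>" for x by (rule nb(5)[OF that])
    show "0 \<le> e0 $ j" for j by (simp add: e0_def inward_def)
    show "0 < (x + s *\<^sub>R e0) $ j" if "x \<in> ball x0 \<epsilon> \<inter> corner_model (corner c)" "s > 0" "j \<in> corner c" for x s j
      using inw_pos that by (simp add: K_def)
    have r_ge: "0 < r x" "\<And>i. i \<in> I \<Longrightarrow> G i x \<le> r x" if "x \<in> ball x0 \<epsilon>" "\<And>j. j \<in> corner c \<Longrightarrow> 0 < x $ j" for x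
    proof -
      have Gx: "0 < G i x" if "i \<in> I" for i using G_pos[of x i] \<open>x \<in> ball x0 \<epsilon>\<close> \<open>\<And>j. j \<in> corner c \<Longrightarrow> 0 < x $ j\<close> that IN by (auto simp: K_def)
      show "0 < r x" unfolding r_def using Gx IN I(2) by (intro sum_pos) auto
      show "G i x \<le> r x" if "i \<in> I" for i
        unfolding r_def using Gx IN that by (intro member_le_sum) (auto intro: less_imp_le)
    qed
    show "0 < r x" if "x \<in> ball x0 \<epsilon>" "\<And>j. j \<in> corner c \<Longrightarrow> 0 < x $ j" for x by (rule r_ge(1)[OF that])
    \<comment> \<open>Each \<open>\<rho> i\<close> with i in I is at most the sum r, and exponents
      are nonpositive, so the weight is at least \<open>r powr - A_I\<close> times
      \<open>P1\<close>. The square root halves the exponent.\<close>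
    show "sqrt (\<kappa> * P1) * r x powr - (AI / 2) * norm v \<le> sqrt (product_metric N \<rho> \<alpha> g0 c (chart_inv c x) v v)"
      if x: "x \<in> ball x0 \<epsilon>" "\<And>j. j \<in> corner c \<Longrightarrow> 0 < x $ j" for x v
    proof (rule real_le_rsqrt)
      have xm: "x \<in> corner_model K" using pos_model x(2) by (simp add: K_def)
      then have xS: "x \<in> S" using ball_S x(1) by blast
      have "(sqrt (\<kappa> * P1) * r x powr - (AI / 2) * norm v)\<^sup>2 = (r x powr - AI * P1) * (\<kappa> * (norm v)\<^sup>2)"
        using \<kappa> P by (simp add: power_mult_distrib half)
      also have "\<dots> \<le> (\<Prod>i=1..N. \<rho> i (chart_inv c x) powr - \<alpha> i) * g0 c (chart_inv c x) v v"
      proof (rule mult_mono)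
        have "r x powr - AI * P1 = (\<Prod>i=1..N. if i \<in> I then r x powr - \<alpha> i else (2 * \<rho> i p) powr - \<alpha> i)"
          unfolding AI_def P1_def by (rule prod_powr_split[symmetric, OF IN(1) r_ge(1)[OF x]])
        also have "\<dots> \<le> (\<Prod>i=1..N. \<rho> i (chart_inv c x) powr - \<alpha> i)"
        proof (rule prod_mono, rule conjI)
          fix i assume i: "i \<in> {1..N}"
          have Gi: "0 < \<rho> i (chart_inv c x)" using G_pos[OF x(1) _ i] x(2) G_\<rho>[OF x(1) xm i] by (simp add: K_def)
          show "(if i \<in> I then r x powr - \<alpha> i else (2 * \<rho> i p) powr - \<alpha> i) \<le> \<rho> i (chart_inv c x) powr - \<alpha> i"
            using exponents[OF i] r_ge(2)[OF x, of i] nb(4)[OF x(1), of i] i Gi G_\<rho>[OF x(1) xm i]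
            by (auto intro!: powr_mono2')
        qed simp
        finally show "r x powr - AI * P1 \<le> (\<Prod>i=1..N. \<rho> i (chart_inv c x) powr - \<alpha> i)" .
        show "\<kappa> * (norm v)\<^sup>2 \<le> g0 c (chart_inv c x) v v" by (rule nb(7)[OF x(1) xS])
      qed (use \<kappa> in \<open>auto intro: prod_nonneg\<close>)
      finally show "(sqrt (\<kappa> * P1) * r x powr - (AI / 2) * norm v)\<^sup>2 \<le> product_metric N \<rho> \<alpha> g0 c (chart_inv c x) v v"
        by (simp add: product_metric_def)
    qed
    show "sqrt (product_metric N \<rho> \<alpha> g0 c (chart_inv c (x + s *\<^sub>R e0)) v v) \<le> sqrt (M * a powr - AI * P2) * s powr - (AI / 2) * norm v"
      if x: "x \<in> ball x0 \<epsilon> \<inter> corner_model (corner c)" and s: "s > 0" and xs: "x + s *\<^sub>R e0 \<in> ball x0 \<epsilon>" for x s v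
    proof (rule real_le_lsqrt)
      let ?y = "x + s *\<^sub>R e0"
      have ym: "?y \<in> corner_model K" using pos_model inw_pos[of x s] x s by (simp add: K_def)
      then have yS: "?y \<in> S" using ball_S xs by blast
      have as: "0 < a * s" using a s by simp
      have "product_metric N \<rho> \<alpha> g0 c (chart_inv c ?y) v v = (\<Prod>i=1..N. \<rho> i (chart_inv c ?y) powr - \<alpha> i) * g0 c (chart_inv c ?y) v v"
        by (simp add: product_metric_def)
      also have "\<dots> \<le> ((a * s) powr - AI * P2) * (M * (norm v)\<^sup>2)"
      proof (rule mult_mono)
        have "(\<Prod>i=1..N. \<rho> i (chart_inv c ?y) powr - \<alpha> i) \<le> (\<Prod>i=1..N. if i \<in> I then (a * s) powr - \<alpha> i else (\<rho> i p / 2) powr - \<alpha> i)"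
        proof (rule prod_mono, rule conjI)
          fix i assume i: "i \<in> {1..N}"
          show "\<rho> i (chart_inv c ?y) powr - \<alpha> i \<le> (if i \<in> I then (a * s) powr - \<alpha> i else (\<rho> i p / 2) powr - \<alpha> i)"
            using exponents[OF i] increase[of x s i] x s xs nb(3)[OF xs, of i] i as \<rho>p[of i] G_\<rho>[OF xs ym i]
            by (auto intro!: powr_mono2' simp: K_def)
        qed simp
        also have "\<dots> = (a * s) powr - AI * P2"
          unfolding AI_def P2_def by (rule prod_powr_split[OF IN(1) as])
        finally show "(\<Prod>i=1..N. \<rho> i (chart_inv c ?y) powr - \<alpha> i) \<le> (a * s) powr - AI * P2" .
        show "g0 c (chart_inv c ?y) v v \<le> M * (norm v)\<^sup>2" by (rule nb(8)[OF xs yS])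
        show "0 \<le> g0 c (chart_inv c ?y) v v"
          using nb(7)[OF xs yS, of v] \<kappa>(1) by (meson less_imp_le mult_nonneg_nonneg order_trans zero_le_power2)
      qed (use P in auto)
      also have "\<dots> = (sqrt (M * a powr - AI * P2) * s powr - (AI / 2) * norm v)\<^sup>2"
        using \<kappa> P a s by (simp add: power_mult_distrib half powr_mult)
      finally show "product_metric N \<rho> \<alpha> g0 c (chart_inv c ?y) v v \<le> (sqrt (M * a powr - AI * P2) * s powr - (AI / 2) * norm v)\<^sup>2" .
    qed (use \<kappa> P in auto)
  qed
  moreover have "\<forall>x\<in>ball x0 \<epsilon> \<inter> corner_model (corner c). r x = (\<Sum>i\<in>I. \<rho> i (chart_inv c x))"
    unfolding r_def using G_\<rho> IN(1) by (auto simp: K_def intro!: sum.cong)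
  ultimately show ?thesis unfolding x0_def e0_def AI_def by blast
qed

end

section \<open>The boundary distance near a face\<close>

text \<open>The mean value estimate is made for the extension on the convex ball, as S itself may
  fail to be convex.\<close>

lemma smooth_map_on_Lipschitz_near:
  assumes "smooth_map_on S f" "x \<in> S"
  obtains e L where "e > 0" "L > 0"
    "\<And>y y'. y \<in> ball x e \<inter> S \<Longrightarrow> y' \<in> ball x e \<inter> S \<Longrightarrow> norm (f y - f y') \<le> L * norm (y - y')"
proof (rule smooth_map_on_local_C1[OF assms])
  fix e L :: real and G G'
  assume eL: "e > 0" "L > 0" and G: "\<And>y. y \<in> ball x e \<Longrightarrow> (G has_derivative G' y) (at y)"
    and bound: "\<And>y v. y \<in> ball x e \<Longrightarrow> norm (G' y v) \<le> L * norm v"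
    and eq: "\<And>y. y \<in> ball x e \<inter> S \<Longrightarrow> G y = f y"
  have "norm (f y - f y') \<le> L * norm (y - y')" if y: "y \<in> ball x e \<inter> S" "y' \<in> ball x e \<inter> S" for y y'
  proof -
    have "norm (G y - G y') \<le> L * norm (y - y')"
    proof (rule differentiable_bound[OF convex_ball])
      show "(G has_derivative G' z) (at z within ball x e)" if "z \<in> ball x e" for z
        using G[OF that] by (rule has_derivative_at_withinI)
      show "onorm (G' z) \<le> L" if "z \<in> ball x e" for z by (rule onorm_le) (rule bound[OF that])
    qed (use y in auto)
    then show ?thesis using eq y by simp
  qed
  then show thesis using eL by (rule that[rotated 2])
qed

lemma coord_tendsto:
  assumes chart: "is_chart X c" and lim: "limitin X x z sequentially" and z: "z \<in> chart_dom c"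
  shows "(\<lambda>n. coord c (x n)) \<longlonglongrightarrow> coord c z"
proof -
  have "limitin (subtopology X (chart_dom c)) x z sequentially"
    using lim z chart unfolding limitin_subtopology by (auto simp: limitin_def is_chart_def)
  from continuous_map_limit[OF continuous_map_coord[OF chart] this] show ?thesis by (simp add: o_def)
qed

lemma chart_inv_tendsto:
  assumes chart: "is_chart X c" and u: "range u \<subseteq> coord c ` chart_dom c" "u \<longlonglongrightarrow> coord c z" and z: "z \<in> chart_dom c"
  shows "limitin X (\<lambda>n. chart_inv c (u n)) z sequentially"
proof -
  have "limitin (top_of_set (coord c ` chart_dom c)) u (coord c z) sequentially"
    using u z by (simp add: limitin_subtopology always_eventually range_subsetD)
  from continuous_map_limit[OF continuous_map_chart_inv[OF chart] this]
  show ?thesis by (simp add: o_def chart_inv_coord[OF chart z])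
qed

sublocale corner_tensor \<subseteq> ext_pseudometric Y d
  by unfold_locales (auto intro: riemannian_dist_self riemannian_dist_sym riemannian_dist_triangle)

context near_face
begin

lemma eventually_in_nhd:
  assumes "limitin X x z sequentially" "z \<in> nhd \<delta>"
  shows "\<forall>\<^sub>F n in sequentially. x n \<in> nhd \<delta>"
proof -
  have "openin X (nhd \<delta>)" by (rule openin_chart_preimage[OF is_chart[OF cA]]) simp
  then show ?thesis using assms unfolding limitin_def by blast
qed

text \<open>Provides a sequence representing z in the completion, by pushing z along the inward
  diagonal.\<close>

lemma interior_approximation:
  assumes z: "z \<in> nhd \<epsilon>"
  obtains x where "range x \<subseteq> Y" "limitin X x z sequentially"
proof -
  note chart = is_chart[OF cA]
  have zm: "coord c z \<in> ball x0 \<epsilon> \<inter> corner_model (corner c)"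
    using z coord_nonneg[OF chart] by (auto simp: corner_model_def)
  have "coord c z \<in> ball x0 \<epsilon>" using z by simp
  then obtain s where s: "s > 0" "ball (coord c z) s \<subseteq> ball x0 \<epsilon>" using open_contains_ball open_ball by metis
  \<comment> \<open>Small enough that all pushed points remain in the ball of radius s around the
    coordinates of z; the summand 1 covers \<open>e0 = 0\<close>.\<close>
  define k where "k = s / (norm e0 + 1)"
  have ne: "norm e0 + 1 > 0" by (simp add: add_nonneg_pos)
  have k: "k > 0" "k * norm e0 < s" using s(1) ne by (auto simp: k_def field_simps)
  define u where "u n = coord c z + (k / real (Suc n)) *\<^sub>R e0" for n
  have kn: "0 < k / real (Suc n)" "k / real (Suc n) \<le> k" for n
    using k(1) by (auto simp: divide_le_eq)
  have in_ball: "u n \<in> ball x0 \<epsilon>" for n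
  proof -
    have "dist (coord c z) (u n) = k / real (Suc n) * norm e0" using k by (simp add: u_def dist_norm)
    also have "\<dots> \<le> k * norm e0" by (rule mult_right_mono[OF kn(2)]) simp
    finally have "u n \<in> ball (coord c z) s" using k(2) by simp
    then show ?thesis using s(2) by blast
  qed
  have pos: "0 < u n $ j" if "j \<in> corner c" for n j
    unfolding u_def by (rule inward_pos[OF zm kn(1) that])
  have im: "u n \<in> coord c ` chart_dom c" for n by (rule pos_in_image[OF in_ball pos])
  have "(\<lambda>n. k * inverse (real (Suc n))) \<longlonglongrightarrow> k * 0" by (intro tendsto_mult tendsto_const LIMSEQ_inverse_real_of_nat)
  then have "(\<lambda>n. coord c z + (k / real (Suc n)) *\<^sub>R e0) \<longlonglongrightarrow> coord c z + 0 *\<^sub>R e0"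
    by (intro tendsto_intros) (simp add: divide_inverse)
  then have "u \<longlonglongrightarrow> coord c z" by (simp add: u_def[abs_def])
  then have "limitin X (\<lambda>n. chart_inv c (u n)) z sequentially"
    using z im by (intro chart_inv_tendsto[OF chart]) auto
  moreover have "chart_inv c (u n) \<in> Y" for n
    using Y_iff[OF cA, of "chart_inv c (u n)"] chart_inv_in_dom[OF chart im] pos by simp
  ultimately show thesis by (intro that[of "\<lambda>n. chart_inv c (u n)"]) auto
qed

text \<open>The upper estimate is a Hoelder bound in coordinates. Coordinates converge along both
  sequences, so both are Cauchy and their mutual distances tend to 0.\<close>

lemma approximations_equivalent:
  assumes b: "b < 1" and z: "z \<in> nhd radius"
    and x: "range x \<subseteq> Y" "limitin X x z sequentially" and x': "range x' \<subseteq> Y" "limitin X x' z sequentially"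
  shows "(x, x') \<in> cauchy_equiv Y d"
proof -
  define C where "C = upper_const"
  have C: "C > 0" using const_pos b by (auto simp: C_def upper_const_def intro!: add_nonneg_pos)
  have upper: "d p q \<le> ennreal (C * norm (coord c p - coord c q) powr (1 - b))"
    if "p \<in> Y" "p \<in> nhd radius" "q \<in> Y" "q \<in> nhd radius" for p q
    unfolding C_def using that by (intro dist_upper[OF b]) auto
  define near where "near \<eta> e \<longleftrightarrow> (\<forall>p q. p \<in> Y \<longrightarrow> q \<in> Y \<longrightarrow> p \<in> nhd radius \<longrightarrow> q \<in> nhd radius \<longrightarrow>
      dist (coord c p) (coord c z) < \<eta> \<longrightarrow> dist (coord c q) (coord c z) < \<eta> \<longrightarrow> d p q < e)" for \<eta> e
  have small: "\<exists>\<eta>>0. near \<eta> e" if "e > 0" for e :: ennreal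
  proof -
    \<comment> \<open>An infinite e is replaced by a positive real, from which the radius below can
      be computed.\<close>
    obtain e' where e': "0 < e'" "ennreal e' \<le> e"
    proof (cases e)
      case (real k)
      then show thesis using that \<open>e > 0\<close> by (intro that[of k]) auto
    next
      case top
      then show thesis by (intro that[of 1]) auto
    qed
    \<comment> \<open>Solves \<open>C * (2 * \<eta>) powr (1 - b) = e' / 2\<close>; two points
      within \<eta> of z are within \<open>2 * \<eta>\<close> of each other.\<close>
    define \<eta> where "\<eta> = ((e' / (2 * C)) powr (1 / (1 - b))) / 2"
    have \<eta>: "\<eta> > 0" using e' C by (simp add: \<eta>_def)
    have "d p q < e" if "p \<in> Y" "q \<in> Y" "p \<in> nhd radius" "q \<in> nhd radius"
      "dist (coord c p) (coord c z) < \<eta>" "dist (coord c q) (coord c z) < \<eta>" for p q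
    proof -
      have "norm (coord c p - coord c q) \<le> 2 * \<eta>"
        using dist_triangle2[of "coord c p" "coord c q" "coord c z"] that by (simp add: dist_norm)
      then have "norm (coord c p - coord c q) powr (1 - b) \<le> (2 * \<eta>) powr (1 - b)"
        using b by (intro powr_mono2) auto
      also have "\<dots> = e' / (2 * C)" using b e' C by (simp add: \<eta>_def powr_powr)
      finally have "C * norm (coord c p - coord c q) powr (1 - b) \<le> e' / 2"
        using C by (simp add: field_simps)
      then have "d p q \<le> ennreal (e' / 2)" using upper[of p q] that ennreal_leI order_trans by blast
      also have "\<dots> < ennreal e'" using e' by (simp add: ennreal_lessI)
      finally show ?thesis using e'(2) by simp
    qed
    then show ?thesis using \<eta> unfolding near_def by blast
  qed
  have zdom: "z \<in> chart_dom c" using z by simp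
  have ev: "\<forall>\<^sub>F n in sequentially. y n \<in> nhd radius \<and> dist (coord c (y n)) (coord c z) < \<eta>"
    if "limitin X y z sequentially" "\<eta> > 0" for y \<eta>
    using eventually_in_nhd[OF that(1) z] tendstoD[OF coord_tendsto[OF is_chart[OF cA] that(1) zdom] that(2)]
    by eventually_elim simp
  have cauchy: "y \<in> cauchy_seqs Y d" if y: "range y \<subseteq> Y" "limitin X y z sequentially" for y
  proof -
    have "\<exists>M. \<forall>m\<ge>M. \<forall>n\<ge>M. d (y m) (y n) < e" if e_pos: "e > 0" for e
    proof -
      obtain \<eta> where \<eta>: "\<eta> > 0" "near \<eta> e"
        using small[OF e_pos] by metis
      obtain M where "\<forall>n\<ge>M. y n \<in> nhd radius \<and> dist (coord c (y n)) (coord c z) < \<eta>"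
        using ev[OF y(2) \<eta>(1)] unfolding eventually_sequentially by blast
      then show ?thesis using \<eta>(2) y(1) by (intro exI[of _ M]) (simp add: near_def range_subsetD)
    qed
    then show ?thesis using y(1) by (simp add: cauchy_seqs_def)
  qed
  have "(\<lambda>n. d (x n) (x' n)) \<longlonglongrightarrow> 0"
    unfolding order_tendsto_iff
  proof (intro conjI allI impI)
    fix e :: ennreal assume "0 < e"
    then obtain \<eta> where \<eta>: "\<eta> > 0" "near \<eta> e"
      using small by metis
    show "\<forall>\<^sub>F n in sequentially. d (x n) (x' n) < e"
      using ev[OF x(2) \<eta>(1)] ev[OF x'(2) \<eta>(1)]
      by eventually_elim (use \<eta>(2) x(1) x'(1) in \<open>simp add: near_def range_subsetD\<close>)
  qed simp
  then show ?thesis using cauchy x x' by (simp add: cauchy_equiv_def)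
qed

text \<open>Both interior estimates pass to the limit along sequences approaching z and z'. As r
  vanishes at z, the defect \<open>r powr (1 - b)\<close> of the lower one disappears.\<close>

lemma boundary_dist_bounds:
  assumes b: "b < 1" and z: "z \<in> nhd radius" "r (coord c z) = 0" and z': "z' \<in> nhd radius"
  shows "ennreal (lower_const * norm (coord c z - coord c z') powr (1 - b)) \<le> boundary_dist X Y d z z'"
    and "boundary_dist X Y d z z' \<le> ennreal (upper_const * norm (coord c z - coord c z') powr (1 - b))"
proof -
  note chart = is_chart[OF cA]
  define D where "D = boundary_dist X Y d z z'"
  have sub: "q \<in> nhd \<epsilon>" "q \<in> nhd (\<epsilon> / 4)" if "q \<in> nhd radius" for q
    using that radius_bounds(4) less_le_trans[OF _ radius_bounds(3)] by auto
  obtain x where x: "range x \<subseteq> Y" "limitin X x z sequentially" using interior_approximation[OF sub(1)[OF z(1)]] by metis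
  obtain y where y: "range y \<subseteq> Y" "limitin X y z' sequentially" using interior_approximation[OF sub(1)[OF z']] by metis
  have evx: "\<forall>\<^sub>F n in sequentially. x n \<in> nhd radius" by (rule eventually_in_nhd[OF x(2) z(1)])
  have evy: "\<forall>\<^sub>F n in sequentially. y n \<in> nhd radius" by (rule eventually_in_nhd[OF y(2) z'])
  have cx: "(\<lambda>n. coord c (x n)) \<longlonglongrightarrow> coord c z" using z by (intro coord_tendsto[OF chart x(2)]) simp
  have cy: "(\<lambda>n. coord c (y n)) \<longlonglongrightarrow> coord c z'" using z' by (intro coord_tendsto[OF chart y(2)]) simp
  have norms: "(\<lambda>n. norm (coord c (x n) - coord c (y n)) powr (1 - b)) \<longlonglongrightarrow> norm (coord c z - coord c z') powr (1 - b)"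
    using b by (intro tendsto_powr' tendsto_norm tendsto_diff cx cy tendsto_const) auto
  have upper: "\<forall>\<^sub>F n in sequentially. d (x n) (y n) \<le> ennreal (upper_const * norm (coord c (x n) - coord c (y n)) powr (1 - b))"
    using evx evy by eventually_elim (use x y in \<open>intro dist_upper[OF b]; auto\<close>)
  then have fin: "\<forall>\<^sub>F n in sequentially. d (x n) (y n) < \<infinity>"
    by eventually_elim (simp add: order_le_less_trans)
  have D: "(\<lambda>n. d (x n) (y n)) \<longlonglongrightarrow> D"
    unfolding D_def
    by (rule boundary_dist_tendsto[OF _ _ x y fin]; rule approximations_equivalent[OF b]) (use z z' x y in auto)
  have "(\<lambda>n. ennreal (upper_const * norm (coord c (x n) - coord c (y n)) powr (1 - b)))
    \<longlonglongrightarrow> ennreal (upper_const * norm (coord c z - coord c z') powr (1 - b))"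
    by (intro tendsto_ennrealI tendsto_mult tendsto_const norms)
  then show "boundary_dist X Y d z z' \<le> ennreal (upper_const * norm (coord c z - coord c z') powr (1 - b))"
    using tendsto_le[OF trivial_limit_sequentially _ D upper] by (simp add: D_def)
  have "isCont r (coord c z)" using r_deriv[of "coord c z"] sub(1)[OF z(1)] has_derivative_continuous by auto
  then have "(\<lambda>n. r (coord c (x n))) \<longlonglongrightarrow> 0" using isCont_tendsto_compose[OF _ cx, of r] z(2) by simp
  moreover have "\<forall>\<^sub>F n in sequentially. 0 \<le> r (coord c (x n))"
    using evx
  proof eventually_elim
    case (elim n)
    have "x n \<in> Y" using x(1) by blast
    then show ?case using r_pos[of "coord c (x n)"] Y_iff[OF cA, of "x n"] elim sub(1)[OF elim] by (simp add: less_imp_le)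
  qed
  ultimately have "(\<lambda>n. r (coord c (x n)) powr (1 - b)) \<longlonglongrightarrow> 0 powr (1 - b)"
    using b by (intro tendsto_powr' tendsto_const) auto
  then have "(\<lambda>n. ennreal (lower_const * (norm (coord c (x n) - coord c (y n)) powr (1 - b) - r (coord c (x n)) powr (1 - b))))
    \<longlonglongrightarrow> ennreal (lower_const * (norm (coord c z - coord c z') powr (1 - b) - 0 powr (1 - b)))"
    by (intro tendsto_ennrealI tendsto_mult tendsto_diff tendsto_const norms)
  moreover have "\<forall>\<^sub>F n in sequentially. ennreal (lower_const * (norm (coord c (x n) - coord c (y n)) powr (1 - b) - r (coord c (x n)) powr (1 - b))) \<le> d (x n) (y n)"
    using evx evy by eventually_elim (use x y sub(2) in \<open>intro dist_lower[OF b]; auto\<close>)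
  ultimately show "ennreal (lower_const * norm (coord c z - coord c z') powr (1 - b)) \<le> boundary_dist X Y d z z'"
    using tendsto_le[OF trivial_limit_sequentially D] by (simp add: D_def)
qed

text \<open>Along a sequence tending to p the function r tends to 0, so \<open>ln r\<close> is
  unbounded, while for \<open>b \<ge> 1\<close> the logarithmic estimate would bound its oscillation
  on a Cauchy sequence.\<close>

lemma accessible_imp_b_less_1:
  assumes acc: "accessible X Y d p" and p: "p \<in> nhd (\<epsilon> / 4)" "r (coord c p) = 0"
  shows "b < 1"
proof (rule ccontr)
  assume "\<not> b < 1"
  then have b: "b \<ge> 1" by simp
  obtain x where x: "x \<in> cauchy_seqs Y d" "limitin X x p sequentially" using acc by (auto simp: accessible_def)
  have xY: "x n \<in> Y" for n using x(1) by (auto simp: cauchy_seqs_def)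
  define R where "R n = r (coord c (x n))" for n
  have "coord c p \<in> ball x0 \<epsilon>" using p const_pos(1) by auto
  then have "isCont r (coord c p)" using r_deriv has_derivative_continuous by blast
  moreover have "(\<lambda>n. coord c (x n)) \<longlonglongrightarrow> coord c p"
    using p by (intro coord_tendsto[OF is_chart[OF cA] x(2)]) simp
  ultimately have R: "R \<longlonglongrightarrow> 0" unfolding R_def[abs_def] using isCont_tendsto_compose[of "coord c p" r] p(2) by fastforce
  obtain M1 where M1: "\<And>n. n \<ge> M1 \<Longrightarrow> x n \<in> nhd (\<epsilon> / 4)"
    using eventually_in_nhd[OF x(2) p(1)] unfolding eventually_sequentially by metis
  \<comment> \<open>A distance below \<eta> rules out the escape alternative and forces the
    logarithms to differ by less than 1.\<close>
  define \<eta> where "\<eta> = min (c2 * (\<epsilon> / 2)) (c2 / \<Lambda>)"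
  have \<eta>: "\<eta> > 0" using const_pos by (simp add: \<eta>_def)
  then have "ennreal \<eta> > 0" by simp
  then obtain M2 where M2: "\<And>m n. m \<ge> M2 \<Longrightarrow> n \<ge> M2 \<Longrightarrow> d (x m) (x n) < ennreal \<eta>"
    using x(1) unfolding cauchy_seqs_def mem_Collect_eq by metis
  define M where "M = max M1 M2"
  have R_pos: "0 < R n" if "n \<ge> M" for n
  proof -
    have "x n \<in> nhd (\<epsilon> / 4)" using M1 that by (simp add: M_def)
    then show ?thesis unfolding R_def using xY[of n] Y_iff[OF cA, of "x n"] const_pos(1) by (intro r_pos) auto
  qed
  have close: "\<bar>ln (R n) - ln (R M)\<bar> < 1" if "n \<ge> M" for n
  proof -
    have "ennreal (min (c2 * (\<epsilon> / 2)) (c2 / \<Lambda> * \<bar>ln (R n) - ln (R M)\<bar>)) \<le> d (x M) (x n)"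
      unfolding R_def using that M1 xY by (intro dist_lower_log[OF b]) (simp_all add: M_def)
    also have "\<dots> < ennreal \<eta>" using that by (intro M2) (auto simp: M_def)
    finally have "min (c2 * (\<epsilon> / 2)) (c2 / \<Lambda> * \<bar>ln (R n) - ln (R M)\<bar>) < \<eta>"
      using \<eta> by (simp add: ennreal_less_iff const_pos less_imp_le)
    then have "c2 / \<Lambda> * \<bar>ln (R n) - ln (R M)\<bar> < c2 / \<Lambda>" by (auto simp: \<eta>_def)
    moreover have "c2 / \<Lambda> > 0" using const_pos by simp
    ultimately show ?thesis by (metis mult.right_neutral mult_less_cancel_left_pos)
  qed
  \<comment> \<open>The factor \<open>exp (- 1)\<close> lowers the logarithm by 1, contradicting
    \<open>close\<close>.\<close>
  have "\<forall>\<^sub>F n in sequentially. R n < R M * exp (- 1)"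
    using R R_pos[of M] by (intro order_tendstoD(2)) auto
  then obtain M3 where M3: "\<And>n. n \<ge> M3 \<Longrightarrow> R n < R M * exp (- 1)" unfolding eventually_sequentially by metis
  define n where "n = max M M3"
  have "ln (R n) < ln (R M * exp (- 1))" using M3[of n] R_pos[of n] R_pos[of M] by (subst ln_less_cancel_iff) (auto simp: n_def)
  also have "\<dots> = ln (R M) - 1" using R_pos[of M] by (simp add: ln_mult)
  finally have "ln (R n) < ln (R M) - 1" .
  moreover have "M \<le> n" by (simp add: n_def)
  ultimately show False using close[of n] by linarith
qed

end

section \<open>The Hausdorff dimension of a face\<close>

text \<open>Two charts around p occur: c carries the distance estimates, and c' flattens the face.
  Both transitions are Lipschitz near p, so the snowflake comparison moves from c to c' with changed
  constants. Vanishing is claimed for a piece of F, to be glued later; nonvanishing already for all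
  of F.\<close>

lemma (in singular_product) local_dimension:
  assumes F: "F = {p \<in> topspace X. {i \<in> {1..N}. \<rho> i p = 0} = I}" and I: "I \<noteq> {}"
    and emb: "embedded_submanifold X A m F" and p: "p \<in> F" and acc: "accessible X Y d p"
  defines "\<beta> \<equiv> 1 - (\<Sum>i\<in>I. \<alpha> i) / 2" and "D \<equiv> boundary_dist X Y d"
  shows "0 < \<beta> \<and> (\<exists>W. openin X W \<and> p \<in> W \<and>
    (\<forall>s. real m / \<beta> < s \<longrightarrow> hausdorff_measure D s (F \<inter> W) = 0) \<and>
    (\<forall>s. 0 \<le> s \<longrightarrow> s < real m / \<beta> \<longrightarrow> hausdorff_measure D s F \<noteq> 0))"
proof -
  have "p \<in> topspace X" using p F by blast
  then obtain c where c: "c \<in> A" "p \<in> chart_dom c" using chart_exists by blast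
  note chart = is_chart[OF c(1)]
  have Ip: "I = {i \<in> {1..N}. \<rho> i p = 0}" using p F by blast
  obtain \<epsilon> r r' c2 C2 \<Lambda> where nf: "near_face X A (product_metric N \<rho> \<alpha> g0) c (coord c p) (inward (corner c) (coord c p))
      \<epsilon> r r' ((\<Sum>i\<in>I. \<alpha> i) / 2) c2 C2 \<Lambda>"
    and r: "\<forall>x\<in>ball (coord c p) \<epsilon> \<inter> corner_model (corner c). r x = (\<Sum>i\<in>I. \<rho> i (chart_inv c x))"
    using near_face_exists[OF c Ip I] by metis
  interpret nf: near_face X A "product_metric N \<rho> \<alpha> g0" c "coord c p" "inward (corner c) (coord c p)"
      \<epsilon> r r' "(\<Sum>i\<in>I. \<alpha> i) / 2" c2 C2 \<Lambda> by (rule nf)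
  define \<delta> where "\<delta> = nf.radius"
  have \<delta>: "0 < \<delta>" "\<delta> < \<epsilon>" using nf.radius_bounds by (auto simp: \<delta>_def)
  have r0: "r (coord c z) = 0" if z: "z \<in> F" "z \<in> chart_dom c" "coord c z \<in> ball (coord c p) \<epsilon>" for z
  proof -
    have "coord c z \<in> ball (coord c p) \<epsilon> \<inter> corner_model (corner c)" using z coord_in_model[OF c(1)] by blast
    then have "r (coord c z) = (\<Sum>i\<in>I. \<rho> i z)" using r chart_inv_coord[OF chart z(2)] by simp
    also have "\<dots> = 0" using z(1) F by (intro sum.neutral) auto
    finally show ?thesis .
  qed
  have b: "(\<Sum>i\<in>I. \<alpha> i) / 2 < 1"
    using nf.const_pos(1) c(2) r0[OF p c(2)] by (intro nf.accessible_imp_b_less_1[OF acc]) auto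
  then have \<beta>: "0 < \<beta>" by (simp add: \<beta>_def)
  obtain c' J where c': "c' \<in> maximal_atlas X A" "p \<in> chart_dom c'" and J: "card J + m = CARD('n)"
    and flat: "F \<inter> chart_dom c' = {q \<in> chart_dom c'. \<forall>j\<in>J. coord c' q $ j = 0}"
    using emb p unfolding embedded_submanifold_def by blast
  have chart': "is_chart X c'" and compat: "smoothly_compatible c' c"
    using c'(1) c(1) by (auto simp: maximal_atlas_def)
  define V where "V = chart_dom c \<inter> chart_dom c'"
  have sm: "smooth_map_on (coord c ` V) (transition c c')" "smooth_map_on (coord c' ` V) (transition c' c)"
    using compat by (auto simp: smoothly_compatible_def V_def Int_commute)
  have pV: "p \<in> V" using c(2) c'(2) by (simp add: V_def)
  obtain e1 L1 where L1: "e1 > 0" "L1 > 0"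
    "\<And>y y'. y \<in> ball (coord c p) e1 \<inter> coord c ` V \<Longrightarrow> y' \<in> ball (coord c p) e1 \<inter> coord c ` V \<Longrightarrow>
      norm (transition c c' y - transition c c' y') \<le> L1 * norm (y - y')"
    using smooth_map_on_Lipschitz_near[OF sm(1) imageI[OF pV]] by metis
  obtain e2 L2 where L2: "e2 > 0" "L2 > 0"
    "\<And>y y'. y \<in> ball (coord c' p) e2 \<inter> coord c' ` V \<Longrightarrow> y' \<in> ball (coord c' p) e2 \<inter> coord c' ` V \<Longrightarrow>
      norm (transition c' c y - transition c' c y') \<le> L2 * norm (y - y')"
    using smooth_map_on_Lipschitz_near[OF sm(2) imageI[OF pV]] by metis
  \<comment> \<open>Small in both charts: the bound in c serves the distance estimates and the
    Lipschitz bound of the transition to c', the bound in c' the Lipschitz bound of its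
    inverse.\<close>
  define W where "W = {q \<in> chart_dom c. coord c q \<in> ball (coord c p) (min e1 \<delta>)} \<inter> {q \<in> chart_dom c'. coord c' q \<in> ball (coord c' p) e2}"
  have W: "openin X W" unfolding W_def by (intro openin_Int openin_chart_preimage chart chart' open_ball)
  have pW: "p \<in> W" using c(2) c'(2) L1(1) L2(1) \<delta>(1) by (simp add: W_def)
  have WV: "q \<in> V" if "q \<in> W" for q using that by (simp add: W_def V_def)
  have W1: "norm (coord c' q - coord c' q') \<le> L1 * norm (coord c q - coord c q')" if "q \<in> W" "q' \<in> W" for q q'
    using L1(3)[of "coord c q" "coord c q'"] that WV chart_inv_coord[OF chart]
    by (simp add: W_def V_def transition_def)
  have W2: "norm (coord c q - coord c q') \<le> L2 * norm (coord c' q - coord c' q')" if "q \<in> W" "q' \<in> W" for q q'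
    using L2(3)[of "coord c' q" "coord c' q'"] that WV chart_inv_coord[OF chart']
    by (simp add: W_def V_def transition_def)
  have W\<delta>: "q \<in> chart_dom c" "coord c q \<in> ball (coord c p) \<delta>" "q \<in> chart_dom c'" if "q \<in> W" for q
    using that by (auto simp: W_def)
  define cl Cu where "cl = nf.lower_const" and "Cu = nf.upper_const"
  have pos: "cl > 0" "Cu > 0" using nf.const_pos b
    by (auto simp: cl_def Cu_def nf.lower_const_def nf.upper_const_def intro!: add_nonneg_pos)
  have D: "ennreal (cl * norm (coord c z - coord c z') powr \<beta>) \<le> D z z'"
      "D z z' \<le> ennreal (Cu * norm (coord c z - coord c z') powr \<beta>)" if z: "z \<in> F \<inter> W" "z' \<in> F \<inter> W" for z z'
  proof -
    have zn: "z \<in> nf.nhd nf.radius" "z' \<in> nf.nhd nf.radius"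
      using z W\<delta> by (auto simp: \<delta>_def)
    have "r (coord c z) = 0" using z W\<delta>[of z] \<delta>(2) by (intro r0) auto
    from nf.boundary_dist_bounds[OF b zn(1) this zn(2)]
    show "ennreal (cl * norm (coord c z - coord c z') powr \<beta>) \<le> D z z'"
      "D z z' \<le> ennreal (Cu * norm (coord c z - coord c z') powr \<beta>)"
      by (simp_all add: cl_def Cu_def D_def \<beta>_def)
  qed
  have lower: "ennreal (cl * (1 / L1) powr \<beta> * norm (coord c' z - coord c' z') powr \<beta>) \<le> D z z'" if z: "z \<in> F \<inter> W" "z' \<in> F \<inter> W" for z z'
  proof -
    have "(1 / L1) powr \<beta> * norm (coord c' z - coord c' z') powr \<beta> = (1 / L1 * norm (coord c' z - coord c' z')) powr \<beta>"
      using L1(2) by (subst powr_mult) auto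
    also have "\<dots> \<le> norm (coord c z - coord c z') powr \<beta>"
      using W1[of z z'] z L1(2) \<beta> by (intro powr_mono2) (auto simp: field_simps)
    finally have "cl * (1 / L1) powr \<beta> * norm (coord c' z - coord c' z') powr \<beta> \<le> cl * norm (coord c z - coord c z') powr \<beta>"
      using pos by (simp add: mult.assoc)
    then show ?thesis using D(1)[OF z] ennreal_leI order_trans by blast
  qed
  have upper: "D z z' \<le> ennreal (Cu * L2 powr \<beta> * norm (coord c' z - coord c' z') powr \<beta>)" if z: "z \<in> F \<inter> W" "z' \<in> F \<inter> W" for z z'
  proof -
    have "norm (coord c z - coord c z') powr \<beta> \<le> (L2 * norm (coord c' z - coord c' z')) powr \<beta>"
      using W2[of z z'] z \<beta> by (intro powr_mono2) auto
    also have "\<dots> = L2 powr \<beta> * norm (coord c' z - coord c' z') powr \<beta>" using L2(2) by (simp add: powr_mult)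
    finally have "Cu * norm (coord c z - coord c z') powr \<beta> \<le> Cu * L2 powr \<beta> * norm (coord c' z - coord c' z') powr \<beta>"
      using pos by (simp add: mult.assoc)
    then show ?thesis using D(2)[OF z] ennreal_leI order_trans by blast
  qed
  have FJ: "coord c' z $ j = 0" if "z \<in> F \<inter> W" "j \<in> J" for z j
    using flat W\<delta>(3)[of z] that by blast
  have "hausdorff_measure D s (F \<inter> W) = 0" if s: "real m / \<beta> < s" for s
  proof (rule hausdorff_measure_snowflake_eq_0[OF J _ FJ upper])
    fix z j assume z: "z \<in> F \<inter> W"
    have "norm (coord c' z) \<le> norm (coord c' p) + dist (coord c' p) (coord c' z)"
      using norm_triangle_ineq[of "coord c' p" "coord c' z - coord c' p"] by (simp add: dist_norm norm_minus_commute)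
    moreover have "dist (coord c' p) (coord c' z) < e2" using z by (auto simp: W_def)
    moreover have "\<bar>coord c' z $ j\<bar> \<le> norm (coord c' z)" by (rule component_le_norm_cart)
    ultimately show "\<bar>coord c' z $ j\<bar> \<le> norm (coord c' p) + e2" by linarith
  next
    show "0 < norm (coord c' p) + e2" using L2(1) by (simp add: add_nonneg_pos)
  qed (use s \<beta> pos L2 in auto)
  moreover have "hausdorff_measure D s F \<noteq> 0" if s: "0 \<le> s" "s < real m / \<beta>" for s
  proof -
    have "W \<subseteq> chart_dom c'" using W\<delta>(3) by blast
    then obtain \<eta>' where \<eta>': "\<eta>' > 0" "ball (coord c' p) \<eta>' \<inter> corner_model (corner c') \<subseteq> coord c' ` W"
      using coord_image_contains_ball[OF chart' W _ pW] by metis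
    \<comment> \<open>Side of a cube that starts at p and extends in increasing directions, which
      keeps the corner coordinates nonnegative. The divisor bounds the l1 distance from p by
      \<open>\<eta>' / 2\<close>.\<close>
    define \<eta> where "\<eta> = \<eta>' / (2 * real CARD('n))"
    have \<eta>: "\<eta> > 0" using \<eta>'(1) by (simp add: \<eta>_def)
    have cube: "\<exists>z\<in>F \<inter> W. coord c' z = y"
      if y: "\<And>j. j \<in> J \<Longrightarrow> y $ j = 0" "\<And>j. j \<notin> J \<Longrightarrow> y $ j \<in> {coord c' p $ j..coord c' p $ j + \<eta>}" for y
    proof -
      have p0: "coord c' p $ j = 0" if "j \<in> J" for j using FJ[of p j] p pW that by simp
      have yj: "coord c' p $ j \<le> y $ j" "y $ j \<le> coord c' p $ j + \<eta>" for j
        using y p0[of j] \<eta> by (cases "j \<in> J"; force)+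
      have "dist (coord c' p) y = norm (y - coord c' p)" by (simp add: dist_norm norm_minus_commute)
      also have "\<dots> \<le> (\<Sum>j\<in>UNIV. \<bar>(y - coord c' p) $ j\<bar>)" by (rule norm_le_l1_cart)
      also have "\<dots> \<le> (\<Sum>j\<in>(UNIV::'n set). \<eta>)"
      proof (rule sum_mono)
        fix j show "\<bar>(y - coord c' p) $ j\<bar> \<le> \<eta>" using yj[of j] by simp
      qed
      also have "\<dots> = \<eta>' / 2" by (simp add: \<eta>_def)
      also have "\<dots> < \<eta>'" using \<eta>'(1) by simp
      finally have "y \<in> ball (coord c' p) \<eta>'" by simp
      moreover have "y \<in> corner_model (corner c')"
        unfolding corner_model_def using yj(1) coord_nonneg[OF chart' c'(2)] order_trans by blast
      ultimately obtain z where z: "z \<in> W" "coord c' z = y" using \<eta>'(2) by blast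
      then have "z \<in> F" using flat W\<delta>(3)[OF z(1)] y(1) by blast
      then show ?thesis using z by blast
    qed
    \<comment> \<open>The sets of a cover may be any subsets of F; the cube lies in
      \<open>F \<inter> W\<close>, and only their traces there are compared with it.\<close>
    show ?thesis
      by (rule hausdorff_measure_snowflake_neq_0[OF J _ \<eta> cube lower]) (use s \<beta> pos L1 in auto)
  qed
  ultimately show ?thesis using \<beta> W pW by blast
qed

theorem corollary6p12:
  fixes X :: "'a topology"
    and A :: "('a, 'n::finite) corner_chart set"
    and N :: nat
    and H :: "nat \<Rightarrow> 'a set"
    and \<rho> :: "nat \<Rightarrow> 'a \<Rightarrow> real"
    and g\<^sub>0 :: "('a, 'n) tensor2"
    and \<alpha> :: "nat \<Rightarrow> real"
    and I :: "nat set"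
    and m :: nat
  defines "Y \<equiv> mfd_interior A"
    and "F \<equiv> open_face X N H I"
    and "d \<equiv> riemannian_dist X A (mfd_interior A) (product_metric N \<rho> \<alpha> g\<^sub>0)"
  assumes "manifold_with_corners X A"
    and "compact_space X"
    and "bij_betw H {1..N} (boundary_hypersurfaces X A)"
    and "\<And>i. i \<in> {1..N} \<Longrightarrow> embedded_submanifold X A (CARD('n) - 1) (H i)"
    and "\<And>i. i \<in> {1..N} \<Longrightarrow> boundary_defining X A (H i) (\<rho> i)"
    and "riemannian_metric A g\<^sub>0"
    and "\<And>i. i \<in> {1..N} \<Longrightarrow> 0 \<le> \<alpha> i"
    and "I \<subseteq> {1..N}" and "I \<noteq> {}"
    and "F \<noteq> {}"
    and "embedded_submanifold X A m F"
    and "\<And>p. p \<in> F \<Longrightarrow> accessible X Y d p"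
  shows "hausdorff_dim F (boundary_dist X Y d) = ereal (real m / (1 - (\<Sum>i\<in>I. \<alpha> i) / 2))"
proof -
  note mfd = assms(4) and bdf = assms(8) and met = assms(9) and alpha = assms(10)
    and I_ne = assms(12) and F_ne = assms(13) and emb = assms(14) and acc = assms(15)
  define \<beta> where "\<beta> = 1 - (\<Sum>i\<in>I. \<alpha> i) / 2"
  define D where "D = boundary_dist X Y d"
  have H_eq: "H i = {p \<in> topspace X. \<rho> i p = 0}" if "i \<in> {1..N}" for i
    using bdf[OF that] by (simp add: boundary_defining_def)
  interpret singular_product X A N \<rho> \<alpha> g\<^sub>0
  proof
    show "smooth_atlas X A" "Hausdorff_space X" using mfd by (auto simp: manifold_with_corners_def)
    show "riemannian_metric A g\<^sub>0" by (rule met)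
    fix i assume i: "i \<in> {1..N}"
    show "smooth_function A (\<rho> i)" using bdf[OF i] by (simp add: boundary_defining_def)
    show "0 \<le> \<alpha> i" by (rule alpha[OF i])
    fix p assume p: "p \<in> topspace X"
    show "0 \<le> \<rho> i p"
      using bdf[OF i] H_eq[OF i] p by (cases "\<rho> i p = 0") (auto simp: boundary_defining_def less_imp_le)
    fix c assume "\<rho> i p = 0" "c \<in> A" "p \<in> chart_dom c"
    moreover have "p \<in> H i" using H_eq[OF i] p \<open>\<rho> i p = 0\<close> by blast
    ultimately show "frechet_derivative (\<rho> i \<circ> chart_inv c) (at (coord c p) within coord c ` chart_dom c) \<noteq> (\<lambda>_. 0)"
      using bdf[OF i] unfolding boundary_defining_def by blast
  qed
  have F_eq: "F = {p \<in> topspace X. {i \<in> {1..N}. \<rho> i p = 0} = I}"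
    unfolding F_def open_face_def incident_def using H_eq by (auto 0 3)
  have loc: "0 < \<beta> \<and> (\<exists>W. openin X W \<and> p \<in> W \<and>
    (\<forall>s. real m / \<beta> < s \<longrightarrow> hausdorff_measure D s (F \<inter> W) = 0) \<and>
    (\<forall>s. 0 \<le> s \<longrightarrow> s < real m / \<beta> \<longrightarrow> hausdorff_measure D s F \<noteq> 0))" if "p \<in> F" for p
    using local_dimension[OF F_eq I_ne emb that] acc[OF that]
    unfolding \<beta>_def D_def Y_def d_def by blast
  \<comment> \<open>A nonempty face supplies an accessible point, and this forces
    \<open>A_I < 2\<close>.\<close>
  have \<beta>: "0 < \<beta>" using loc F_ne by blast
  have "hausdorff_dim F D = ereal (real m / \<beta>)"
  proof (rule hausdorff_dim_eqI)
    show "0 \<le> real m / \<beta>" using \<beta> by simp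
    show "hausdorff_measure D s F \<noteq> 0" if "0 \<le> s" "s < real m / \<beta>" for s using loc F_ne that by blast
    fix s assume s: "real m / \<beta> < s"
    obtain W where W: "\<And>p. p \<in> F \<Longrightarrow> openin X (W p)" "\<And>p. p \<in> F \<Longrightarrow> p \<in> W p"
      "\<And>p. p \<in> F \<Longrightarrow> hausdorff_measure D s (F \<inter> W p) = 0" using loc s by metis
    have FX: "F \<subseteq> topspace X" using F_eq by blast
    \<comment> \<open>F may fail to be compact even though X is, so countably many null pieces are
      extracted by the Lindelof property.\<close>
    have "second_countable X" using mfd by (simp add: manifold_with_corners_def)
    then have "Lindelof_space (subtopology X F)"
      by (intro second_countable_imp_Lindelof_space second_countable_subtopology)
    moreover have "openin (subtopology X F) U" if "U \<in> (\<lambda>p. F \<inter> W p) ` F" for U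
      using that W(1) by (auto intro: openin_subtopology_Int2)
    moreover have "\<Union>((\<lambda>p. F \<inter> W p) ` F) = topspace (subtopology X F)" using W(2) FX by auto
    ultimately have "\<exists>\<V>. countable \<V> \<and> \<V> \<subseteq> (\<lambda>p. F \<inter> W p) ` F \<and> \<Union>\<V> = topspace (subtopology X F)"
      by (rule Lindelof_spaceD)
    then obtain \<V> where \<V>: "countable \<V>" "\<V> \<subseteq> (\<lambda>p. F \<inter> W p) ` F" "\<Union>\<V> = topspace (subtopology X F)"
      by (elim exE conjE) (rule that)
    have UF: "\<Union>\<V> = F" using \<V>(3) FX by auto
    then have ne: "\<V> \<noteq> {}" using F_ne by auto
    \<comment> \<open>The enumeration may repeat members, which is harmless for a countable
      union.\<close>
    define T where "T = from_nat_into \<V>"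
    have "range T = \<V>" unfolding T_def using \<V>(1) ne by (simp add: range_from_nat_into)
    then have "F = (\<Union>n. T n)" using UF by simp
    moreover have "hausdorff_measure D s (T n) = 0" for n
    proof -
      have "T n \<in> \<V>" using \<open>range T = \<V>\<close> by blast
      then have "T n \<in> (\<lambda>p. F \<inter> W p) ` F" by (rule subsetD[OF \<V>(2)])
      then show ?thesis by (rule imageE) (simp add: W(3))
    qed
    ultimately show "hausdorff_measure D s F = 0" using hausdorff_measure_countable_Union_eq_0[of D s T] by simp
  qed
  then show ?thesis by (simp add: D_def \<beta>_def)
qed

end
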